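(* Let $\alpha=(\alpha_1,\alpha_2)\in(0,1]\times(0,1]$, let $A=(a_{ij})\in\mathbb R^{2\times 2}$, and let $f=(f_1,f_2):[0,\infty)\to\mathbb R^2$ be continuous and exponentially bounded (i.e. there are $M>0,\gamma>0$ with $\|f(t)\|\le Me^{\gamma t}$ for all $t\ge 0$). Consider the initial value problem $${}^{C}D^{\alpha}_{0^+}x(t)=Ax(t)+f(t)\quad (t>0),\qquad x(0)=x^0\in\mathbb R^2. \qquad (\ast)$$ Suppose that all zeros of the characteristic function $Q(s)=s^{\alpha_1+\alpha_2}-a_{11}s^{\alpha_2}-a_{22}s^{\alpha_1}+\det A$ lie in the open left half of the complex plane. Then: (i) If $f$ is bounded, then for every $x^0\in\mathbb R^2$ the solution of $(\ast)$ is bounded on $[0,\infty)$. (ii) If $\lim_{t\to\infty}f(t)=0$, then for every $x^0\in\mathbb R^2$ the solution of $(\ast)$ tends to $0$ as $t\to\infty$. (iii) If $\|f(t)\|=O(t^{-\eta})$ as $t\to\infty$ for some $\eta>0$, then for every $x^0\in\mathbb R^2$ the solution $x$ of $(\ast)$ satisfies $\|x(t)\|=O(t^{-\mu})$ as $t\to\infty$, where $\mu=\min\{\alpha_1,\alpha_2,\eta\}$.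
   Context: On $\mathbb R^2$ use $\|x\|=\max\{|x_1|,|x_2|\}$. For $0<\kappa<1$ the Riemann–Liouville integral is $I^{\kappa}_{0^+}g(t)=\frac{1}{\Gamma(\kappa)}\int_0^t(t-s)^{\kappa-1}g(s)\,ds$, and the Caputo derivative of order $\kappa\in(0,1)$ is ${}^CD^{\kappa}_{0^+}g(t)=\frac{d}{dt}I^{1-\kappa}_{0^+}(g(t)-g(0))$, $t>0$; for $\kappa=1$ it is the usual derivative. For $x=(x_1,x_2)$, ${}^CD^{\alpha}_{0^+}x=({}^CD^{\alpha_1}_{0^+}x_1,{}^CD^{\alpha_2}_{0^+}x_2)$. A solution is a continuous function $x:[0,\infty)\to\mathbb R^2$ with $x(0)=x^0$ satisfying the differential equations for $t>0$; under the stated assumptions on $f$ it exists and is unique for every $x^0$. Powers $s^{\kappa}$ of complex $s\neq 0$ are taken with the principal branch, $\arg s\in(-\pi,\pi]$, and $0^{\kappa}=0$ for $\kappa>0$. *)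

theory Defs
  imports "HOL-Analysis.Analysis" "HOL-Library.Landau_Symbols"
begin

definition RL_integral :: "real \<Rightarrow> (real \<Rightarrow> real) \<Rightarrow> real \<Rightarrow> real" where
  "RL_integral \<kappa> g t = 1 / Gamma \<kappa> * integral {0..t} (\<lambda>s. (t - s) powr (\<kappa> - 1) * g s)"

text \<open>
  The Caputo derivative of order \<open>\<kappa> \<in> (0,1]\<close> of \<open>g\<close> exists at \<open>t > 0\<close> and has the value \<open>d\<close>.
  The order 1 is treated separately: \<open>RL_integral 0\<close> is not the identity.
\<close>

definition has_caputo_derivative :: "real \<Rightarrow> (real \<Rightarrow> real) \<Rightarrow> real \<Rightarrow> real \<Rightarrow> bool" where
  "has_caputo_derivative \<kappa> g d t \<longleftrightarrow>
     (if \<kappa> = 1 then (g has_real_derivative d) (at t)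
      else (RL_integral (1 - \<kappa>) (\<lambda>s. g s - g 0) has_real_derivative d) (at t))"

text \<open>Only the values of \<open>f\<close> and \<open>x\<close> on \<open>[0,\<infinity>)\<close> matter.\<close>

definition caputo_solution ::
  "real^2 \<Rightarrow> real^2^2 \<Rightarrow> (real \<Rightarrow> real^2) \<Rightarrow> real^2 \<Rightarrow> (real \<Rightarrow> real^2) \<Rightarrow> bool" where
  "caputo_solution \<alpha> A f x0 x \<longleftrightarrow>
     continuous_on {0..} x \<and> x 0 = x0 \<and>
     (\<forall>t>0. \<forall>i. has_caputo_derivative (\<alpha> $ i) (\<lambda>s. x s $ i) ((A *v x t + f t) $ i) t)"

text \<open>
  Complex \<open>powr\<close> uses the principal branch with argument in \<open>(-\<pi>, \<pi>]\<close>, and \<open>0 powr w = 0\<close>.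
\<close>

definition char_fun :: "real^2 \<Rightarrow> real^2^2 \<Rightarrow> complex \<Rightarrow> complex" where
  "char_fun \<alpha> A s =
     s powr of_real (\<alpha> $ 1 + \<alpha> $ 2)
     - of_real (A $ 1 $ 1) * s powr of_real (\<alpha> $ 2)
     - of_real (A $ 2 $ 2) * s powr of_real (\<alpha> $ 1)
     + of_real (det A)"

end

theory Submission
  imports Defs "HOL-Complex_Analysis.Complex_Analysis" "HOL-Real_Asymp.Real_Asymp"
begin

text \<open>
  In terms of the Laplace transform, the solution is governed by the resolvent
  \<open>H(s) = (diag(s\<^sup>\<alpha>) - A)\<^sup>-\<^sup>1\<close>, whose entries have denominator \<open>Q\<close>. As \<open>Q\<close> has no zeros in the closed
  right half plane, neither has it any in a sector \<open>\<bar>arg s\<bar> < b\<close> with \<open>b > \<pi>/2\<close>, and the entries of \<open>H\<close> are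
  transforms of the kernels \<open>K(t) = 1/\<pi> Im (\<integral> exp (t s) H(s) ds)\<close>, the integral being taken along a ray of
  argument in \<open>(\<pi>/2, b)\<close>. As the integral of \<open>exp (t s)\<close> itself along the ray is the real number \<open>- 1/t\<close>, only \<open>H(s) - H(0) = O(\<bar>s\<bar>\<^sup>\<nu>)\<close> with
  \<open>\<nu> = min \<alpha>\<^sub>1 \<alpha>\<^sub>2\<close> matters, which gives \<open>K(t) = O(t\<^bsup>-1-\<nu>\<^esup>)\<close> and integrability of \<open>K\<close>.
  Convolving the integrated equation with \<open>K\<close> yields
  \<open>x(t) = (K * f)(t) - (\<integral>\<^bsub>t\<^esub>\<^bsup>\<infinity>\<^esup> K) A x\<^sup>0\<close>, from which the three claims are read off.
\<close>

section \<open>Integrals along horizontal lines\<close>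

text \<open>A Laplace transform of the solution would presuppose a bound on its growth. Only kernels
  are transformed here: the resolvent identity for \<open>K\<close> is carried back to the time
  domain by uniqueness of the transform, and the solution enters afterwards through convolutions,
  for which local bounds suffice. The direction of the inversion matters as well. \<open>K\<close>
  is defined by its contour integral, and its transform is computed from that definition by Fubini;
  the outcome is a Cauchy integral of H along a single ray, whose imaginary part has to be
  identified with the value of H at a positive real point. That point lies off the ray, and the
  shift of the ray to the real axis runs into the pole there, which is why a formula with the pole
  removed comes first. The rate min(alpha_1, alpha_2) has its origin at s = 0: det A is nonzero, so
  H is regular there up to powers of s, of which this is the smallest exponent that can
  occur.\<close>

lemma integrable_exp_minus_abs:
  fixes d :: real
  assumes "d > 0"
  shows "integrable lborel (\<lambda>a::real. exp (- d * \<bar>a\<bar>))"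
proof -
  have "(\<lambda>a. exp (- d * a)) absolutely_integrable_on {0::real..}"
    using has_integral_exp_minus_to_infinity[OF assms, of 0]
    by (intro nonnegative_absolutely_integrable_1) (auto simp: integrable_on_def)
  hence *: "integrable lborel (\<lambda>a::real. indicator {0..} a *\<^sub>R exp (- d * a))"
    unfolding set_integrable_def by (subst (asm) integrable_completion) auto
  have "integrable lborel (\<lambda>a::real. indicator {0..} (-a) *\<^sub>R exp (- d * (-a)))"
    using lborel_integrable_real_affine[OF *, of "-1" 0] by simp
  with * have "integrable lborel (\<lambda>a::real. indicator {0..} a *\<^sub>R exp (- d * a) + indicator {0..} (-a) *\<^sub>R exp (- d * (-a)))"
    by (rule Bochner_Integration.integrable_add)
  thus ?thesis
    by (rule Bochner_Integration.integrable_bound) (auto simp: indicator_def split: if_splits)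
qed

lemma integral_line_FTC:
  fixes g P :: "real \<Rightarrow> complex"
  assumes int: "integrable lborel g" and cont: "continuous_on UNIV g"
    and P: "\<And>a. (P has_vector_derivative g a) (at a)"
    and L: "(P \<longlongrightarrow> L) at_top" and M: "(P \<longlongrightarrow> M) at_bot"
  shows "integral\<^sup>L lborel g = L - M"
proof -
  have "(LBINT x=-\<infinity>..\<infinity>. g x) = L - M"
  proof (rule interval_integral_FTC_integrable)
    show "isCont g x" for x using cont by (simp add: continuous_on_eq_continuous_at)
    show "set_integrable lborel (einterval (- \<infinity>) \<infinity>) g"
      using int by (simp add: set_integrable_def einterval_eq)
    show "((P \<circ> real_of_ereal) \<longlongrightarrow> M) (at_right (- \<infinity>))"
      using M by (simp add: ereal_tendsto_simps)
    show "((P \<circ> real_of_ereal) \<longlongrightarrow> L) (at_left \<infinity>)"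
      using L by (simp add: ereal_tendsto_simps)
  qed (use P in auto)
  thus ?thesis by (simp add: interval_integral_to_infinity_eq interval_lebesgue_integral_def einterval_eq set_lebesgue_integral_def)
qed

lemma convex_strip: "convex {w::complex. \<bar>Im w\<bar> < b}"
proof -
  have "{w::complex. \<bar>Im w\<bar> < b} = {w. Im w < b} \<inter> {w. Im w > -b}" by auto
  thus ?thesis by (simp add: convex_Int convex_halfspace_Im_lt convex_halfspace_Im_gt)
qed

lemma open_strip: "open {w::complex. \<bar>Im w\<bar> < b}"
  by (intro open_Collect_less continuous_intros)

lemma holomorphic_on_line:
  assumes "g holomorphic_on {w. \<bar>Im w\<bar> < b}" "\<bar>y\<bar> < b"
  shows "continuous_on UNIV (\<lambda>a. g (Complex a y))"
proof -
  have "continuous_on {w. \<bar>Im w\<bar> < b} g" using assms(1) by (rule holomorphic_on_imp_continuous_on)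
  moreover have "continuous_on UNIV (\<lambda>a. Complex a y)"
    by (simp add: Complex_eq continuous_intros)
  ultimately show ?thesis
    by (rule continuous_on_compose2) (use assms(2) in auto)
qed

text \<open>A primitive \<open>P\<close> on the convex strip replaces rectangular contours:
  \<open>P (Complex a th) - P (Complex a 0)\<close> has the difference of the two integrands as its
  derivative and, by the bound on \<open>g\<close> along a vertical segment, vanishes at both ends
  of the line.\<close>

lemma integral_shift_strip:
  fixes g :: "complex \<Rightarrow> complex"
  assumes hol: "g holomorphic_on {w. \<bar>Im w\<bar> < b}"
    and th: "0 \<le> th" "th < b" and d: "d > 0"
    and bd: "\<And>w. 0 \<le> Im w \<Longrightarrow> Im w \<le> th \<Longrightarrow> norm (g w) \<le> B * exp (- d * \<bar>Re w\<bar>)"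
  shows "integrable lborel (\<lambda>a. g (Complex a 0))" "integrable lborel (\<lambda>a. g (Complex a th))"
    and "(LINT a|lborel. g (Complex a th)) = (LINT a|lborel. g (Complex a 0))"
proof -
  have int: "integrable lborel (\<lambda>a. g (Complex a y))" if "0 \<le> y" "y \<le> th" for y
  proof (rule Bochner_Integration.integrable_bound)
    show "integrable lborel (\<lambda>a::real. B * exp (- d * \<bar>a\<bar>))"
      using integrable_exp_minus_abs[OF d] by simp
    show "(\<lambda>a. g (Complex a y)) \<in> borel_measurable lborel"
      using holomorphic_on_line[OF hol, of y] that th
      by (auto intro: borel_measurable_continuous_onI)
    show "AE x in lborel. norm (g (Complex x y)) \<le> norm (B * exp (- d * \<bar>x\<bar>))"
      using bd[of "Complex _ y"] that by (auto intro!: AE_I2 order_trans[OF _ abs_ge_self])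
  qed
  show i0: "integrable lborel (\<lambda>a. g (Complex a 0))" and ith: "integrable lborel (\<lambda>a. g (Complex a th))"
    using int th by auto
  obtain P where P: "\<And>w. \<bar>Im w\<bar> < b \<Longrightarrow> (P has_field_derivative g w) (at w)"
  proof -
    have "g field_differentiable at w" if "w \<in> interior {w. \<bar>Im w\<bar> < b} - {}" for w
      using that holomorphic_on_imp_differentiable_at[OF hol open_strip] interior_subset by blast
    from holomorphic_convex_primitive[OF convex_strip _ holomorphic_on_imp_continuous_on[OF hol], of "{}", OF _ this]
    obtain P where "\<And>w. w \<in> {w. \<bar>Im w\<bar> < b} \<Longrightarrow> (P has_field_derivative g w) (at w within {w. \<bar>Im w\<bar> < b})"
      by auto
    thus ?thesis using that at_within_open[OF _ open_strip] by (metis mem_Collect_eq)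
  qed
  have Pv: "((\<lambda>a. P (Complex a y)) has_vector_derivative g (Complex a y)) (at a)" if "0 \<le> y" "y \<le> th" for y a
  proof -
    have "((\<lambda>a. Complex a y) has_vector_derivative 1) (at a)"
      unfolding Complex_eq by (auto intro!: derivative_eq_intros)
    from field_vector_diff_chain_at[OF this] show ?thesis
      using P[of "Complex a y"] that th by (simp add: o_def)
  qed
  let ?D = "\<lambda>a. P (Complex a th) - P (Complex a 0)"
  have D: "norm (?D a) \<le> th * B * exp (- d * \<bar>a\<bar>)" for a
  proof -
    have "norm (?D a) \<le> (B * exp (- d * \<bar>a\<bar>)) * norm (Complex a th - Complex a 0)"
    proof (rule field_differentiable_bound[where S = "{w. Re w = a \<and> 0 \<le> Im w \<and> Im w \<le> th}"])
      show "convex {w. Re w = a \<and> 0 \<le> Im w \<and> Im w \<le> th}"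
      proof -
        have "{w. Re w = a \<and> 0 \<le> Im w \<and> Im w \<le> th} = {w. Re w \<le> a} \<inter> {w. Re w \<ge> a} \<inter> {w. Im w \<le> th} \<inter> {w. Im w \<ge> 0}" by auto
        thus ?thesis by (auto intro!: convex_Int convex_halfspace_Im_le convex_halfspace_Im_ge convex_halfspace_Re_le convex_halfspace_Re_ge)
      qed
      show "(P has_field_derivative g z) (at z within {w. Re w = a \<and> 0 \<le> Im w \<and> Im w \<le> th})"
        if "z \<in> {w. Re w = a \<and> 0 \<le> Im w \<and> Im w \<le> th}" for z
        using P[of z] that th by (auto intro: has_field_derivative_at_within)
    qed (use bd th in auto)
    also have "norm (Complex a th - Complex a 0) = th" using th by (simp add: cmod_def)
    finally show ?thesis by (simp add: mult_ac)
  qed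
  have top: "((\<lambda>a. th * B * exp (- d * \<bar>a\<bar>)) \<longlongrightarrow> 0) at_top"
    and bot: "((\<lambda>a. th * B * exp (- d * \<bar>a\<bar>)) \<longlongrightarrow> 0) at_bot"
    using d by real_asymp+
  have "(LINT a|lborel. g (Complex a th) - g (Complex a 0)) = 0 - 0"
  proof (rule integral_line_FTC)
    show "continuous_on UNIV (\<lambda>a. g (Complex a th) - g (Complex a 0))"
      by (intro continuous_intros holomorphic_on_line[OF hol]) (use th in auto)
    show "(?D has_vector_derivative g (Complex a th) - g (Complex a 0)) (at a)" for a
      by (intro has_vector_derivative_diff Pv) (use th in auto)
    show "(?D \<longlongrightarrow> 0) at_top" by (rule Lim_null_comparison[OF _ top]) (use D in auto)
    show "(?D \<longlongrightarrow> 0) at_bot" by (rule Lim_null_comparison[OF _ bot]) (use D in auto)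
  qed (use i0 ith in auto)
  thus "(LINT a|lborel. g (Complex a th)) = (LINT a|lborel. g (Complex a 0))"
    using i0 ith by simp
qed


section \<open>Lower bounds for \<open>exp w + c\<close> and \<open>exp w - c\<close>, and an
  explicit logarithmic integral\<close>

lemma norm_exp_plus_real_ge:
  assumes "0 \<le> Im w" "Im w \<le> th" "pi / 2 \<le> th" "th < pi" "c \<ge> 0"
  shows "norm (exp w + of_real c) \<ge> sin th * max (exp (Re w)) c"
proof -
  define r where "r = exp (Re w)"
  define y where "y = Im w"
  have r: "r > 0" by (simp add: r_def)
  have eq: "norm (exp w + of_real c) ^ 2 = (r * cos y + c) ^ 2 + (r * sin y) ^ 2"
    by (simp add: cmod_power2 Re_exp Im_exp r_def y_def)
  have s: "0 < sin th" "sin th \<le> 1" using assms by (auto intro: sin_gt_zero)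
  have "(sin th * max r c) ^ 2 \<le> norm (exp w + of_real c) ^ 2"
  \<comment> \<open>While the cosine is nonnegative the cross term only helps. Beyond
    \<open>pi / 2\<close> the square is completed in either way, which leaves
    \<open>(r * sin y)^2\<close> or \<open>(c * sin y)^2\<close>, and the sine decreases there down
    to \<open>sin th\<close>.\<close>
  proof (cases "y \<le> pi / 2")
    case True
    have "cos y \<ge> 0" using True assms by (intro cos_ge_zero) (auto simp: y_def)
    have "norm (exp w + of_real c) ^ 2 = r^2 * (cos y ^2 + sin y ^ 2) + c^2 + 2 * r * c * cos y"
      unfolding eq by algebra
    also have "\<dots> = r^2 + c^2 + 2 * r * c * cos y" by simp
    also have "\<dots> \<ge> r^2 + c^2" using r assms \<open>cos y \<ge> 0\<close> by simp
    finally have "r^2 + c^2 \<le> norm (exp w + of_real c) ^ 2" .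
    moreover have "(max r c)^2 \<le> r^2 + c^2" by (auto simp: max_def)
    moreover have "(sin th * max r c)^2 \<le> 1 * (max r c)^2"
      unfolding power_mult_distrib using s by (intro mult_right_mono power_le_one) auto
    ultimately show ?thesis by linarith
  next
    case False
    have sy: "sin th \<le> sin y"
    proof -
      have "sin (pi - th) \<le> sin (pi - y)"
        using False assms by (intro sin_monotone_2pi_le) (auto simp: y_def)
      thus ?thesis by simp
    qed
    hence sy2: "(sin th)^2 \<le> (sin y)^2" using s by (intro power_mono) auto
    have e1: "norm (exp w + of_real c) ^ 2 = (r * sin y)^2 + (r * cos y + c) ^ 2" using eq by simp
    have e2: "norm (exp w + of_real c) ^ 2 = (c * sin y)^2 + (r + c * cos y) ^ 2"
    proof -
      have "(r * cos y + c) ^ 2 + (r * sin y) ^ 2 = r^2 * (cos y ^2 + sin y ^ 2) + c^2 + 2 * r * c * cos y"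
        by algebra
      also have "\<dots> = r^2 + c^2 * (sin y ^2 + cos y ^ 2) + 2 * r * c * cos y"
        by simp
      also have "\<dots> = (c * sin y)^2 + (r + c * cos y) ^ 2"
        by algebra
      finally show ?thesis using eq by simp
    qed
    have "(sin th)^2 * r^2 \<le> norm (exp w + of_real c) ^ 2"
      unfolding e1 using mult_right_mono[OF sy2, of "r^2"] by (simp add: power_mult_distrib mult.commute add_increasing2)
    moreover have "(sin th)^2 * c^2 \<le> norm (exp w + of_real c) ^ 2"
      unfolding e2 using mult_right_mono[OF sy2, of "c^2"] by (simp add: power_mult_distrib mult.commute add_increasing2)
    ultimately show ?thesis by (auto simp: max_def power_mult_distrib)
  qed
  thus ?thesis unfolding r_def by (rule power2_le_imp_le) auto
qed

text \<open>The law of cosines with the square completed in either way; the larger of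
  \<open>exp a\<close> and \<open>c\<close> decides which form is used.\<close>

lemma norm_exp_minus_real_ge:
  assumes "0 < th" "th < pi" "c > 0"
  shows "norm (exp (Complex a th) - of_real c) \<ge> sin th * max (exp a) c"
proof -
  define r where "r = exp a"
  have r: "r > 0" by (simp add: r_def)
  have s: "0 < sin th" using assms by (auto intro: sin_gt_zero)
  have eq: "norm (exp (Complex a th) - of_real c) ^ 2 = (r * cos th - c) ^ 2 + (r * sin th) ^ 2"
    by (simp add: cmod_power2 Re_exp Im_exp r_def)
  have "(r * cos th - c) ^ 2 + (r * sin th) ^ 2 = r^2 * (cos th ^2 + sin th ^ 2) + c^2 - 2 * r * c * cos th"
    by algebra
  also have "\<dots> = r^2 + c^2 * (sin th ^2 + cos th ^ 2) - 2 * r * c * cos th"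
    by simp
  also have "\<dots> = (c * sin th)^2 + (r - c * cos th) ^ 2"
    by algebra
  finally have eq2: "norm (exp (Complex a th) - of_real c) ^ 2 = (c * sin th)^2 + (r - c * cos th) ^ 2"
    using eq by simp
  have "(sin th * max r c) ^ 2 \<le> norm (exp (Complex a th) - of_real c) ^ 2"
  proof (cases "c \<le> r")
    case True
    thus ?thesis unfolding eq by (simp add: power_mult_distrib mult.commute)
  next
    case False
    thus ?thesis unfolding eq2 by (simp add: power_mult_distrib mult.commute)
  qed
  thus ?thesis unfolding r_def by (rule power2_le_imp_le) auto
qed

text \<open>With s = exp w this is the integral of 1 / ((s + 1) (s - sig)) along the ray. Partial
  fractions give the primitive (Ln (sig - s) - Ln (1 + s)) / (sig + 1). It is real in the limit s =
  0 and tends to - i pi / (sig + 1) at infinity, which produces the imaginary part.\<close>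

lemma integral_ray_log:
  fixes th sig :: real
  assumes th: "0 < th" "th < pi" and sig: "sig > 0"
  defines "g \<equiv> \<lambda>w. exp w / ((exp w + 1) * (exp w - complex_of_real sig))"
  shows "integrable lborel (\<lambda>a. g (Complex a th))"
    and "Im (LINT a|lborel. g (Complex a th)) = - pi / (sig + 1)"
proof -
  let ?w = "\<lambda>a. Complex a th"
  have s: "sin th > 0" using th by (auto intro: sin_gt_zero)
  have cexp: "continuous_on UNIV (\<lambda>a. exp (?w a))" by (simp add: Complex_eq continuous_intros)
  have im: "Im (exp (?w a)) > 0" for a using s by (simp add: Im_exp)
  have nz: "exp (?w a) + 1 \<noteq> 0" "exp (?w a) - of_real sig \<noteq> 0" for a
    using im[of a] by (auto simp: complex_eq_iff)
  have cont: "continuous_on UNIV (\<lambda>a. g (?w a))"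
    unfolding g_def using nz by (intro continuous_intros cexp) auto
  show int: "integrable lborel (\<lambda>a. g (?w a))"
  proof (rule Bochner_Integration.integrable_bound)
    let ?K = "1 / (sin th ^ 2 * min 1 sig)"
    show "integrable lborel (\<lambda>a::real. ?K * exp (- 1 * \<bar>a\<bar>))"
      using integrable_exp_minus_abs[of 1] by simp
    show "(\<lambda>a. g (?w a)) \<in> borel_measurable lborel"
      using borel_measurable_continuous_onI[OF cont] by simp
    have "norm (g (?w a)) \<le> ?K * exp (- 1 * \<bar>a\<bar>)" for a
    proof -
      have 1: "norm (exp (?w a) + 1) \<ge> sin th * max (exp a) 1"
      proof -
        have "norm (exp (?w a) + 1) = norm (exp (Complex a (pi - th)) - of_real 1)"
          by (simp add: cmod_def Re_exp Im_exp power2_eq_square algebra_simps)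
        thus ?thesis using norm_exp_minus_real_ge[of "pi - th" 1 a] th by simp
      qed
      have 2: "norm (exp (?w a) - of_real sig) \<ge> sin th * (min 1 sig * max (exp a) 1)"
      proof -
        have "min 1 sig * max (exp a) 1 \<le> max (exp a) sig"
        proof -
          have "min 1 sig * exp a \<le> 1 * exp a" "min 1 sig \<le> sig" by (intro mult_right_mono) auto
          thus ?thesis by (cases "exp a \<le> 1") (auto simp only: max_def split: if_splits)
        qed
        hence "sin th * (min 1 sig * max (exp a) 1) \<le> sin th * max (exp a) sig"
          using s by (intro mult_left_mono) auto
        also have "\<dots> \<le> norm (exp (?w a) - of_real sig)"
          by (rule norm_exp_minus_real_ge[OF th sig])
        finally show ?thesis .
      qed
      have "norm (g (?w a)) = exp a / (norm (exp (?w a) + 1) * norm (exp (?w a) - of_real sig))"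
        by (simp add: g_def norm_divide norm_mult norm_exp_eq_Re)
      also have "\<dots> \<le> exp a / ((sin th * max (exp a) 1) * (sin th * (min 1 sig * max (exp a) 1)))"
        using s sig by (intro divide_left_mono mult_mono 1 2) (use nz[of a] in \<open>auto intro!: mult_pos_pos simp: less_max_iff_disj\<close>)
      also have "\<dots> = ?K * (exp a / (max (exp a) 1)^2)"
        by (simp add: power2_eq_square field_simps)
      also have "exp a / (max (exp a) 1)^2 = exp (- 1 * \<bar>a\<bar>)"
        by (cases "a \<ge> 0") (auto simp: max_def power2_eq_square exp_minus field_simps)
      finally show ?thesis .
    qed
    thus "AE a in lborel. norm (g (?w a)) \<le> norm (?K * exp (- 1 * \<bar>a\<bar>))"
      unfolding real_norm_def by (intro AE_I2 order_trans[OF _ abs_ge_self])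
  qed
  \<comment> \<open>\<open>sig - exp\<close> rather than \<open>exp - sig\<close>: on the ray it
    stays in the lower half plane, off the branch cut, and at the origin it tends to the positive
    number \<open>sig\<close>, where the principal logarithm is continuous.\<close>
  define P where "P = (\<lambda>a. (Ln (of_real sig - exp (?w a)) - Ln (1 + exp (?w a))) / (of_real sig + 1))"
  have sig1: "of_real sig + (1::complex) \<noteq> 0"
    using sig by (auto simp: complex_eq_iff)
  have dw: "(?w has_vector_derivative 1) (at a)" for a
    unfolding Complex_eq by (auto intro!: derivative_eq_intros)
  have "integral\<^sup>L lborel (\<lambda>a. g (?w a)) = (- \<i> * of_real pi) / (of_real sig + 1) - of_real (ln sig) / (of_real sig + 1)"
  proof (rule integral_line_FTC[OF int cont])
    fix a
    have n1: "of_real sig - exp (?w a) \<notin> \<real>\<^sub>\<le>\<^sub>0" "1 + exp (?w a) \<notin> \<real>\<^sub>\<le>\<^sub>0"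
      using im[of a] by (auto simp: complex_nonpos_Reals_iff)
    have e: "(exp (?w a) / (exp (?w a) - of_real sig) - exp (?w a) / (1 + exp (?w a))) / (of_real sig + 1) = g (?w a)"
      using nz[of a] sig1 unfolding g_def by (simp add: divide_simps) (simp add: algebra_simps)
    have e2: "- exp (?w a) / (of_real sig - exp (?w a)) = exp (?w a) / (exp (?w a) - of_real sig)"
      by (metis minus_diff_eq minus_divide_divide minus_minus)
    have "((\<lambda>w. (Ln (of_real sig - exp w) - Ln (1 + exp w)) / (of_real sig + 1)) has_field_derivative g (?w a)) (at (?w a))"
      unfolding e[symmetric] e2[symmetric] using n1 sig1
      by (auto intro!: derivative_eq_intros simp: divide_simps)
    from field_vector_diff_chain_at[OF dw this]
    show "(P has_vector_derivative g (?w a)) (at a)" by (simp add: P_def o_def)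
  next
    have e0: "((\<lambda>a. exp (?w a)) \<longlongrightarrow> 0) at_bot"
    proof (rule tendsto_norm_zero_cancel)
      show "((\<lambda>a. norm (exp (?w a))) \<longlongrightarrow> 0) at_bot" unfolding norm_exp_eq_Re
        by (simp add: exp_at_bot)
    qed
    have "(P \<longlongrightarrow> (Ln (of_real sig - 0) - Ln (1 + 0)) / (of_real sig + 1)) at_bot"
      unfolding P_def using sig sig1
      by (intro tendsto_intros e0) (auto simp: complex_nonpos_Reals_iff)
    thus "(P \<longlongrightarrow> of_real (ln sig) / (of_real sig + 1)) at_bot" using sig by (simp add: Ln_of_real)
  next
    have e0: "((\<lambda>a. exp (- ?w a)) \<longlongrightarrow> 0) at_top"
    proof (rule tendsto_norm_zero_cancel)
      show "((\<lambda>a. norm (exp (- ?w a))) \<longlongrightarrow> 0) at_top" unfolding norm_exp_eq_Re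
        by simp real_asymp
    qed
    have lim: "((\<lambda>a. (Ln ((1 - of_real sig * exp (- ?w a)) / (1 + exp (- ?w a))) - \<i> * of_real pi) / (of_real sig + 1)) \<longlongrightarrow>
            (Ln ((1 - of_real sig * 0) / (1 + 0)) - \<i> * of_real pi) / (of_real sig + 1)) at_top"
      using sig1 by (intro tendsto_intros e0) (auto simp: complex_nonpos_Reals_iff)
    \<comment> \<open>At infinity both logarithms diverge, so they are merged into the logarithm of
      a quotient that tends to 1. Negating \<open>?z1\<close>, which lies in the upper half plane,
      costs i pi; the arguments in (0, pi) keep the merged logarithm on the principal
      branch.\<close>
    have eq: "P a = (Ln ((1 - of_real sig * exp (- ?w a)) / (1 + exp (- ?w a))) - \<i> * of_real pi) / (of_real sig + 1)" for a
    proof -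
      let ?z1 = "exp (?w a) - of_real sig" and ?z2 = "1 + exp (?w a)"
      have z: "Im ?z1 > 0" "Im ?z2 > 0" using im[of a] by auto
      have zn: "?z1 \<noteq> 0" "?z2 \<noteq> 0" using z by (auto simp: complex_eq_iff)
      have m: "Ln (of_real sig - exp (?w a)) = Ln ?z1 - \<i> * pi"
        using Ln_minus[of ?z1] z zn by simp
      have i: "Ln (inverse ?z2) = - Ln ?z2"
        using z by (intro Ln_inverse) (auto simp: complex_nonpos_Reals_iff)
      have b1: "0 < Im (Ln ?z1)" "Im (Ln ?z1) < pi" "0 < Im (Ln ?z2)" "Im (Ln ?z2) < pi"
        using z zn Im_Ln_pos_lt_imp[of ?z1] Im_Ln_pos_lt_imp[of ?z2] by auto
      have "Ln (?z1 * inverse ?z2) = Ln ?z1 + Ln (inverse ?z2)"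
        using zn by (subst Ln_times) (use b1 i in auto)
      moreover have "?z1 * inverse ?z2 = (1 - of_real sig * exp (- ?w a)) / (1 + exp (- ?w a))"
      proof -
        have "?z1 = exp (?w a) * (1 - of_real sig * exp (- ?w a))" "?z2 = exp (?w a) * (1 + exp (- ?w a))"
          by (simp_all add: exp_minus algebra_simps)
        thus ?thesis by (simp add: divide_inverse)
      qed
      ultimately have "Ln ((1 - of_real sig * exp (- ?w a)) / (1 + exp (- ?w a))) = Ln ?z1 - Ln ?z2"
        using i by simp
      thus ?thesis unfolding P_def m by simp
    qed
    show "(P \<longlongrightarrow> (- \<i> * of_real pi) / (of_real sig + 1)) at_top"
      using lim unfolding eq[abs_def] by simp
  qed
  also have "\<dots> = of_real (- ln sig / (sig + 1)) + \<i> * of_real (- pi / (sig + 1))"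
    using sig1 by (simp add: field_simps)
  finally have "(LINT a|lborel. g (?w a)) = of_real (- ln sig / (sig + 1)) + \<i> * of_real (- pi / (sig + 1))" .
  thus "Im (LINT a|lborel. g (?w a)) = - pi / (sig + 1)"
    by (simp only:) simp
qed

section \<open>Cauchy formula on a sector\<close>

lemma exp_eq_of_real_strip:
  assumes "\<bar>Im w\<bar> < pi" "exp w = of_real s" "s > 0"
  shows "w = of_real (ln s)"
proof (rule exp_complex_eqI)
  show "\<bar>Im w - Im (of_real (ln s))\<bar> < 2 * pi" using assms(1) pi_gt_zero by simp
  show "exp w = exp (of_real (ln s))" using assms by (simp add: exp_of_real)
qed

text \<open>\<open>exp x\<close> is the Jacobian of s = exp w, and \<open>max (exp x) 1\<close> is
  the size of a denominator such as s + const. On the right the quotient is 1 and the decay comes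
  from \<open>u\<close>; on the left it is \<open>exp x\<close>, which is at most
  \<open>exp (rho * x)\<close> because \<open>rho \<le> 1\<close>.\<close>

lemma decay_weight:
  fixes u C rho x :: real
  assumes "u \<le> C" "u \<le> C * exp (- rho * x)" "0 \<le> u" "rho \<le> 1"
  shows "u * exp x / max (exp x) 1 \<le> C * exp (- rho * \<bar>x\<bar>)"
proof (cases "x \<ge> 0")
  case True
  hence "max (exp x) 1 = exp x" by (intro max.absorb1) simp
  thus ?thesis using assms True by simp
next
  case False
  have "x \<le> rho * x" using mult_right_mono_neg[of rho 1 x] False assms by simp
  hence "u * exp x \<le> C * exp (rho * x)"
    using assms by (intro mult_mono) auto
  moreover have "max (exp x) 1 = 1" using False by (simp add: max_def)
  ultimately show ?thesis using False by simp
qed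

text \<open>
  The pole of \<open>h(w) exp(w) / (\<sigma> - exp(w))\<close> at \<open>l = ln \<sigma>\<close> is removed by replacing \<open>h\<close> with
  \<open>h(w) - h(l) (\<sigma> + 1) / (exp(w) + 1)\<close>. The integral of the resulting holomorphic function \<open>G\<close> can be
  shifted to the real line, where it is real; the subtracted term is the explicit logarithm above.
\<close>
lemma Cauchy_ray_formula:
  fixes h :: "complex \<Rightarrow> complex"
  assumes hol: "h holomorphic_on {w. \<bar>Im w\<bar> < b}"
    and th: "pi / 2 \<le> th" "th < b" "b \<le> pi" and rho: "0 < rho" "rho \<le> 1"
    and bd1: "\<And>w. \<bar>Im w\<bar> < b \<Longrightarrow> norm (h w) \<le> C"
    and bd2: "\<And>w. \<bar>Im w\<bar> < b \<Longrightarrow> norm (h w) \<le> C * exp (- rho * Re w)"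
    and real: "\<And>a. h (of_real a) \<in> \<real>"
    and sig: "sig > 0"
  defines "g \<equiv> \<lambda>w. h w * exp w / (of_real sig - exp w)"
  shows "integrable lborel (\<lambda>a. g (Complex a th))"
    and "Im (LINT a|lborel. g (Complex a th)) = pi * Re (h (of_real (ln sig)))"
proof -
  let ?S = "{w::complex. \<bar>Im w\<bar> < b}"
  define l where "l = complex_of_real (ln sig)"
  have el: "exp l = of_real sig" using sig by (simp add: l_def exp_of_real)
  have lS: "l \<in> ?S" using th pi_gt_zero by (simp add: l_def)
  have C: "C \<ge> 0" using bd1[of l] lS norm_ge_zero order_trans by blast
  define num where "num = (\<lambda>w. h w - h l * (of_real sig + 1) / (exp w + 1))"
  define den where "den = (\<lambda>w. exp w - complex_of_real sig)"
  have sth: "0 < sin th" "sin th \<le> 1" using th pi_gt_zero by (auto intro: sin_gt_zero)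
  have sig1: "complex_of_real sig + 1 \<noteq> 0" using sig by (auto simp: complex_eq_iff)
  \<comment> \<open>The only candidates for zeros are plus and minus i pi, and
    \<open>b \<le> pi\<close> puts them outside the open strip.\<close>
  have en: "exp w + 1 \<noteq> 0" if "w \<in> ?S" for w
  proof
    assume "exp w + 1 = 0"
    hence *: "exp w = -1" by (simp add: eq_neg_iff_add_eq_0)
    have "w = \<i> * pi \<or> w = - (\<i> * pi)"
    proof (cases "Im w \<ge> 0")
      case True
      have "w = \<i> * pi"
      proof (rule exp_complex_eqI)
        show "\<bar>Im w - Im (\<i> * pi)\<bar> < 2 * pi" using True that th pi_gt_zero by simp
        show "exp w = exp (\<i> * pi)" using * by simp
      qed
      thus ?thesis by simp
    next
      case False
      have "w = - (\<i> * pi)"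
      proof (rule exp_complex_eqI)
        show "\<bar>Im w - Im (- (\<i> * pi))\<bar> < 2 * pi" using False that th pi_gt_zero by simp
        show "exp w = exp (- (\<i> * pi))" using * by (simp add: exp_minus)
      qed
      thus ?thesis by simp
    qed
    thus False using that th by auto
  qed
  have numh: "num holomorphic_on ?S" unfolding num_def using en
    by (intro holomorphic_intros hol) auto
  have denh: "den holomorphic_on ?S" unfolding den_def by (intro holomorphic_intros)
  have num0: "num l = 0" using sig1 by (simp add: num_def el)
  have den0: "den l = 0" by (simp add: den_def el)
  have dennz: "den w \<noteq> 0" if "w \<in> ?S" "w \<noteq> l" for w
    using exp_eq_of_real_strip[of w sig] that th sig by (auto simp: den_def l_def)
  have dden: "deriv den l = of_real sig"
    unfolding den_def by (rule DERIV_imp_deriv) (auto intro!: derivative_eq_intros simp: el)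
  \<comment> \<open>\<open>num\<close> and \<open>den\<close> both vanish at \<open>l\<close>. Their
    divided differences are holomorphic there and \<open>d1 l = sig\<close> is nonzero, so
    \<open>G\<close> continues \<open>num / den * exp\<close> across \<open>l\<close>.\<close>
  define n1 where "n1 = (\<lambda>w. if w = l then deriv num l else (num w - num l) / (w - l))"
  define d1 where "d1 = (\<lambda>w. if w = l then deriv den l else (den w - den l) / (w - l))"
  have n1h: "n1 holomorphic_on ?S" unfolding n1_def by (rule pole_lemma_open[OF numh open_strip])
  have d1h: "d1 holomorphic_on ?S" unfolding d1_def by (rule pole_lemma_open[OF denh open_strip])
  have d1nz: "d1 w \<noteq> 0" if "w \<in> ?S" for w
    using dennz[OF that] sig by (auto simp: d1_def dden den0)
  define G where "G = (\<lambda>w. n1 w / d1 w * exp w)"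
  have Gh: "G holomorphic_on ?S" unfolding G_def using d1nz by (intro holomorphic_intros n1h d1h) auto
  have G: "G w = num w / den w * exp w" if "w \<noteq> l" for w
    using that by (simp add: G_def n1_def d1_def num0 den0)
  have hbd: "norm (h w) * exp (Re w) / max (exp (Re w)) 1 \<le> C * exp (- rho * \<bar>Re w\<bar>)" if "w \<in> ?S" for w
    using decay_weight[of "norm (h w)" C rho "Re w"] bd1[of w] bd2[of w] rho that by auto
  have rbd: "exp x / (max (exp x) 1)^2 \<le> exp (- rho * \<bar>x\<bar>)" for x :: real
  proof -
    have "exp x / (max (exp x) 1)^2 = exp (- \<bar>x\<bar>)"
      by (cases "x \<ge> 0") (auto simp: max_def power2_eq_square exp_minus field_simps)
    also have "\<dots> \<le> exp (- rho * \<bar>x\<bar>)" using mult_right_mono[of rho 1 "\<bar>x\<bar>"] rho by simp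
    finally show ?thesis .
  qed
  \<comment> \<open>At distance at least 1 from \<open>ln sig\<close>, the numbers
    \<open>exp (Re w)\<close> and \<open>sig\<close> differ by a factor of at least
    \<open>exp 1\<close>, so their difference is at least \<open>1 - exp (- 1)\<close> times the
    larger one. The factor \<open>min 1 sig\<close> trades \<open>sig\<close> for 1 in that
    maximum.\<close>
  let ?k = "(1 - exp (- 1)) * min 1 sig"
  have k: "?k > 0" using sig by simp
  let ?B1 = "(C + norm (h l) * (sig + 1) / sin th) / ?k"
  have far: "norm (G w) \<le> ?B1 * exp (- rho * \<bar>Re w\<bar>)"
    if w: "0 \<le> Im w" "Im w \<le> th" "\<bar>Re w - ln sig\<bar> \<ge> 1" for w
  proof -
    have wS: "w \<in> ?S" using w th by auto
    have wl: "w \<noteq> l" using w by (auto simp: l_def)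
    let ?m = "max (exp (Re w)) 1"
    have 1: "norm (exp w + 1) \<ge> sin th * ?m"
      using norm_exp_plus_real_ge[of w th 1] w th by simp
    have 2: "norm (den w) \<ge> ?k * ?m"
    proof -
      have "min 1 sig * ?m \<le> max (exp (Re w)) sig"
      proof -
        have "min 1 sig * exp (Re w) \<le> 1 * exp (Re w)" "min 1 sig \<le> sig" by (intro mult_right_mono) auto
        thus ?thesis by (cases "exp (Re w) \<le> 1") (auto simp only: max_def split: if_splits)
      qed
      hence "?k * ?m \<le> (1 - exp (- 1)) * max (exp (Re w)) sig"
        unfolding mult.assoc by (intro mult_left_mono) auto
      also have "\<dots> \<le> \<bar>exp (Re w) - sig\<bar>"
      proof (cases "Re w \<ge> ln sig")
        case True
        hence "ln sig \<le> -1 + Re w" using w by auto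
        hence "sig \<le> exp (-1 + Re w)" using sig by (metis exp_le_cancel_iff exp_ln)
        hence a: "sig \<le> exp (-1) * exp (Re w)" by (simp only: exp_add)
        have b: "exp (-1) * exp (Re w) \<le> 1 * exp (Re w)" by (intro mult_right_mono) auto
        have m: "max (exp (Re w)) sig = exp (Re w)" using a b by (intro max.absorb1) linarith
        show ?thesis unfolding m using a b by (simp add: algebra_simps)
      next
        case False
        hence "Re w \<le> -1 + ln sig" using w by auto
        hence "exp (Re w) \<le> exp (-1 + ln sig)" by simp
        hence a: "exp (Re w) \<le> exp (-1) * sig" using sig by (simp only: exp_add exp_ln)
        have b: "exp (-1) * sig \<le> 1 * sig" using sig by (intro mult_right_mono) auto
        have m: "max (exp (Re w)) sig = sig" using a b by (intro max.absorb2) linarith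
        show ?thesis unfolding m using a b by (simp add: algebra_simps)
      qed
      also have "\<dots> \<le> norm (den w)"
        using norm_triangle_ineq3[of "exp w" "of_real sig"] sig by (simp add: den_def norm_exp_eq_Re)
      finally show ?thesis .
    qed
    have "norm (G w) = norm (num w) * exp (Re w) / norm (den w)"
      using G[OF wl] by (simp add: norm_mult norm_divide norm_exp_eq_Re)
    also have "\<dots> \<le> norm (num w) * exp (Re w) / (?k * ?m)"
      using 2 k dennz[OF wS wl] by (intro divide_left_mono) (auto intro!: mult_pos_pos simp: less_max_iff_disj)
    also have "norm (num w) \<le> norm (h w) + norm (h l) * (sig + 1) / norm (exp w + 1)"
    proof -
      have "norm (complex_of_real sig + 1) = sig + 1" using sig
        by (metis abs_of_pos add_pos_pos norm_of_real of_real_1 of_real_add zero_less_one)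
      thus ?thesis using norm_triangle_ineq4[of "h w" "h l * (of_real sig + 1) / (exp w + 1)"]
        by (simp add: num_def norm_mult norm_divide)
    qed
    also have "norm (h l) * (sig + 1) / norm (exp w + 1) \<le> norm (h l) * (sig + 1) / (sin th * ?m)"
      using 1 sth sig en[OF wS] by (intro divide_left_mono) (auto intro!: mult_pos_pos simp: less_max_iff_disj)
    also have "(norm (h w) + norm (h l) * (sig + 1) / (sin th * ?m)) * exp (Re w) / (?k * ?m) =
      (norm (h w) * exp (Re w) / ?m + norm (h l) * (sig + 1) / sin th * (exp (Re w) / ?m^2)) / ?k"
    proof -
      have "?m > 0" by (simp add: less_max_iff_disj)
      thus ?thesis using sth k by (simp add: field_simps power2_eq_square)
    qed
    also have "\<dots> \<le> (C * exp (- rho * \<bar>Re w\<bar>) + norm (h l) * (sig + 1) / sin th * exp (- rho * \<bar>Re w\<bar>)) / ?k"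
      using k sth sig by (intro divide_right_mono add_mono hbd[OF wS] mult_left_mono rbd) auto
    also have "\<dots> = ?B1 * exp (- rho * \<bar>Re w\<bar>)" by (simp add: field_simps)
    finally show ?thesis using k by (simp add: divide_right_mono mult_right_mono)
  qed
  \<comment> \<open>Around the removed singularity the lower bound for \<open>den\<close> fails;
    compactness of a box takes its place.\<close>
  obtain M where M: "\<And>w. 0 \<le> Im w \<Longrightarrow> Im w \<le> th \<Longrightarrow> \<bar>Re w - ln sig\<bar> \<le> 1 \<Longrightarrow> norm (G w) \<le> M"
  proof -
    let ?K = "cbox (Complex (ln sig - 1) 0) (Complex (ln sig + 1) th)"
    have "?K \<subseteq> ?S" using th by (auto simp: cbox_def Basis_complex_def)
    hence "continuous_on ?K G"
      using Gh holomorphic_on_imp_continuous_on continuous_on_subset by blast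
    hence "bounded (G ` ?K)" by (intro compact_imp_bounded compact_continuous_image) auto
    then obtain M where "\<And>x. x \<in> ?K \<Longrightarrow> norm (G x) \<le> M" by (auto simp: bounded_iff)
    moreover have "w \<in> ?K" if "0 \<le> Im w" "Im w \<le> th" "\<bar>Re w - ln sig\<bar> \<le> 1" for w
      using that by (auto simp: cbox_def Basis_complex_def)
    ultimately show ?thesis using that by blast
  qed
  \<comment> \<open>The exponential in the second entry compensates for
    \<open>exp (- rho * \<bar>Re w\<bar>)\<close> on the box, where \<open>\<bar>Re w\<bar>\<close>
    is at most \<open>\<bar>ln sig\<bar> + 1\<close>.\<close>
  define B where "B = max ?B1 (\<bar>M\<bar> * exp (rho * (\<bar>ln sig\<bar> + 1)))"
  have Gbd: "norm (G w) \<le> B * exp (- rho * \<bar>Re w\<bar>)" if w: "0 \<le> Im w" "Im w \<le> th" for w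
  proof (cases "\<bar>Re w - ln sig\<bar> \<ge> 1")
    case True
    have "?B1 * exp (- rho * \<bar>Re w\<bar>) \<le> B * exp (- rho * \<bar>Re w\<bar>)"
      by (intro mult_right_mono) (auto simp: B_def)
    with far[OF w True] show ?thesis by linarith
  next
    case False
    have "\<bar>Re w\<bar> \<le> \<bar>ln sig\<bar> + 1" using False by linarith
    hence "rho * \<bar>Re w\<bar> \<le> rho * (\<bar>ln sig\<bar> + 1)" using rho by (intro mult_left_mono) auto
    hence "1 \<le> exp (rho * (\<bar>ln sig\<bar> + 1)) * exp (- rho * \<bar>Re w\<bar>)"
      by (simp add: exp_add[symmetric])
    hence "\<bar>M\<bar> * 1 \<le> \<bar>M\<bar> * (exp (rho * (\<bar>ln sig\<bar> + 1)) * exp (- rho * \<bar>Re w\<bar>))"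
      by (intro mult_left_mono) auto
    also have "\<dots> \<le> B * exp (- rho * \<bar>Re w\<bar>)"
      unfolding mult.assoc[symmetric] by (intro mult_right_mono) (auto simp: B_def)
    finally show ?thesis using M[OF w] False by fastforce
  qed
  have th0: "0 < th" "th < pi" using th pi_gt_zero by auto
  note shift = integral_shift_strip[OF Gh less_imp_le[OF th0(1)] th(2) rho(1) Gbd]
  \<comment> \<open>Off \<open>l\<close> the quotient formula shows that \<open>G\<close> is real on
    the axis; the single point \<open>l\<close> is a null set.\<close>
  have "(LINT a|lborel. Im (G (Complex a 0))) = (LINT a::real|lborel. 0)"
  proof (rule Bochner_Integration.integral_cong_AE)
    show "AE a in lborel. Im (G (Complex a 0)) = 0"
    proof (rule AE_mp[OF AE_lborel_singleton[of "ln sig"]], rule AE_I2, rule impI)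
      fix a :: real assume a: "a \<noteq> ln sig"
      have c: "Complex a 0 = of_real a" by (simp add: complex_eq_iff)
      have "of_real a \<noteq> l" using a by (simp add: l_def)
      moreover have "num (of_real a) \<in> \<real>" "den (of_real a) \<in> \<real>"
        using real by (auto simp: num_def den_def l_def exp_of_real)
      ultimately have "G (of_real a) \<in> \<real>" using G by (auto simp: exp_of_real)
      thus "Im (G (Complex a 0)) = 0" unfolding c by (simp add: complex_is_Real_iff)
    qed
  qed (use shift(1) in \<open>auto dest: borel_measurable_integrable\<close>)
  hence "Im (LINT a|lborel. G (Complex a 0)) = 0"
    using shift(1) by simp
  hence ImG: "Im (LINT a|lborel. G (Complex a th)) = 0" using shift(3) by simp
  define r where "r = (\<lambda>w. exp w / ((exp w + 1) * (exp w - complex_of_real sig)))"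
  have rint: "integrable lborel (\<lambda>a. r (Complex a th))" "Im (LINT a|lborel. r (Complex a th)) = - pi / (sig + 1)"
    unfolding r_def by (rule integral_ray_log[OF th0 sig])+
  have geq: "g (Complex a th) = - (G (Complex a th) + h l * (of_real sig + 1) * r (Complex a th))" for a
  proof -
    let ?w = "Complex a th"
    have wS: "?w \<in> ?S" using th th0 by auto
    have wl: "?w \<noteq> l" using th0 by (auto simp: l_def complex_eq_iff)
    have n: "exp ?w + 1 \<noteq> 0" "exp ?w - of_real sig \<noteq> 0" "of_real sig - exp ?w \<noteq> 0"
      using en[OF wS] dennz[OF wS wl] by (auto simp: den_def)
    have "g ?w = - (h ?w * exp ?w / (exp ?w - of_real sig))"
      unfolding g_def by (metis minus_diff_eq minus_divide_right)
    also have "h ?w * exp ?w / (exp ?w - of_real sig) = G ?w + h l * (of_real sig + 1) * r ?w"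
      unfolding G[OF wl] num_def den_def r_def using n by (simp add: divide_simps) (simp add: algebra_simps)
    finally show ?thesis .
  qed
  show "integrable lborel (\<lambda>a. g (Complex a th))"
    unfolding geq by (intro Bochner_Integration.integrable_minus Bochner_Integration.integrable_add
        integrable_mult_right shift(2) rint(1))
  have "(LINT a|lborel. g (Complex a th)) =
      - ((LINT a|lborel. G (Complex a th)) + h l * (of_real sig + 1) * (LINT a|lborel. r (Complex a th)))"
    unfolding geq using shift(2) rint(1) by simp
  also have "Im \<dots> = - Im (h l * (of_real sig + 1) * (LINT a|lborel. r (Complex a th)))"
    using ImG by simp
  also have "h l * (of_real sig + 1) = of_real (Re (h l) * (sig + 1))"
    using real[of "ln sig"] by (auto simp: l_def elim!: Reals_cases)
  also have "- Im (of_real (Re (h l) * (sig + 1)) * (LINT a|lborel. r (Complex a th))) = pi * Re (h l)"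
    using rint(2) sig by simp
  finally show "Im (LINT a|lborel. g (Complex a th)) = pi * Re (h (of_real (ln sig)))"
    by (simp add: l_def)
qed

section \<open>Inversion of the Laplace transform on a ray\<close>

lemma integrable_lborel_of_nonneg:
  fixes f :: "real \<Rightarrow> real"
  assumes "f integrable_on S" "\<And>x. x \<in> S \<Longrightarrow> 0 \<le> f x" "S \<in> sets borel" "f \<in> borel_measurable borel"
  shows "integrable lborel (\<lambda>x. indicator S x * f x)"
proof -
  have "f absolutely_integrable_on S"
    using assms by (intro nonnegative_absolutely_integrable_1) auto
  thus ?thesis
    unfolding set_integrable_def using assms by (subst (asm) integrable_completion) auto
qed

text \<open>With r = exp a this is the integrand exp (- c r) r^p dr / r of a Gamma integral. It is
  the modulus of exp (t s) s^p on the ray of argument th when c = - t cos th.\<close>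

definition exp_weight :: "real \<Rightarrow> real \<Rightarrow> real \<Rightarrow> real" where
  "exp_weight c p a = exp (- c * exp a) * exp (p * a)"

lemma exp_weight_integrable:
  assumes "c > 0" "p > 0"
  shows "integrable lborel (exp_weight c p)"
proof (rule Bochner_Integration.integrable_bound)
  \<comment> \<open>For nonnegative \<open>a\<close>, the tangent line of \<open>exp\<close> at
    \<open>ln (2 * p / c)\<close> gives a lower bound for \<open>c * exp a\<close> of slope
    \<open>2 * p\<close>: half of it pays for the factor \<open>exp (p * a)\<close>, the other half
    is the decay of rate \<open>p\<close>. For negative \<open>a\<close> the constant 1
    suffices.\<close>
  let ?M = "max 1 (exp (2 * p * (ln (2 * p / c) - 1)))"
  show "integrable lborel (\<lambda>a::real. ?M * exp (- p * \<bar>a\<bar>))"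
    using integrable_exp_minus_abs[OF assms(2)] by simp
  show "exp_weight c p \<in> borel_measurable lborel"
    by (auto simp: exp_weight_def[abs_def])
  have "exp_weight c p a \<le> ?M * exp (- p * \<bar>a\<bar>)" for a
  proof (cases "a \<ge> 0")
    case True
    let ?s = "ln (2 * p / c)"
    have "1 + (a - ?s) \<le> exp (a - ?s)" by (rule exp_ge_add_one_self)
    also have "\<dots> = exp a * c / (2 * p)" using assms by (simp add: exp_diff)
    finally have "2 * p * (1 + (a - ?s)) \<le> c * exp a"
      using assms by (simp add: field_simps)
    hence "- c * exp a + p * a \<le> 2 * p * (?s - 1) - p * \<bar>a\<bar>"
      using True by (simp add: algebra_simps)
    hence "exp_weight c p a \<le> exp (2 * p * (?s - 1) - p * \<bar>a\<bar>)"
      unfolding exp_weight_def exp_add[symmetric] by simp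
    also have "\<dots> = exp (2 * p * (?s - 1)) * exp (- p * \<bar>a\<bar>)"
      by (simp add: exp_add[symmetric])
    also have "\<dots> \<le> ?M * exp (- p * \<bar>a\<bar>)" by (intro mult_right_mono) auto
    finally show ?thesis .
  next
    case False
    have "exp_weight c p a \<le> 1 * exp (- p * \<bar>a\<bar>)"
      unfolding exp_weight_def using False assms by (intro mult_mono) auto
    also have "\<dots> \<le> ?M * exp (- p * \<bar>a\<bar>)" by (intro mult_right_mono) auto
    finally show ?thesis .
  qed
  thus "AE a in lborel. norm (exp_weight c p a) \<le> norm (?M * exp (- p * \<bar>a\<bar>))"
    by (intro AE_I2) (auto simp: exp_weight_def)
qed

text \<open>Translation by \<open>- ln t\<close> scales the ray by 1 / t. This is how a power s^p
  under the integral becomes t^(-p) in the kernel.\<close>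

lemma exp_weight_scaled:
  assumes "c > 0" "p > 0" "t > 0"
  shows "integrable lborel (exp_weight (c * t) p)"
    and "integral\<^sup>L lborel (exp_weight (c * t) p) = integral\<^sup>L lborel (exp_weight c p) * t powr (- p)"
proof -
  show "integrable lborel (exp_weight (c * t) p)" using assms by (intro exp_weight_integrable) auto
  have "integral\<^sup>L lborel (exp_weight (c * t) p) = (LINT a|lborel. exp_weight (c * t) p (- ln t + 1 * a))"
    by (subst lborel_integral_real_affine[where c = 1 and t = "- ln t"]) auto
  also have "(\<lambda>a. exp_weight (c * t) p (- ln t + 1 * a)) = (\<lambda>a. exp_weight c p a * t powr (- p))"
  proof
    fix a
    have 1: "t * exp (- ln t + 1 * a) = exp a"
      using assms by (simp add: exp_diff)
    have 2: "exp (p * (- ln t + 1 * a)) = exp (p * a) * t powr (- p)"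
      using assms by (simp add: powr_def exp_add[symmetric] algebra_simps)
    have 3: "- (c * t) * exp (- ln t + 1 * a) = - c * (t * exp (- ln t + 1 * a))" by simp
    show "exp_weight (c * t) p (- ln t + 1 * a) = exp_weight c p a * t powr (- p)"
      unfolding exp_weight_def 3 1 2 by simp
  qed
  finally show "integral\<^sup>L lborel (exp_weight (c * t) p) = integral\<^sup>L lborel (exp_weight c p) * t powr (- p)"
    by simp
qed

lemma norm_integral_le:
  fixes f :: "real \<Rightarrow> complex"
  assumes "integrable lborel w" "\<And>a. norm (f a) \<le> w a"
  shows "norm (integral\<^sup>L lborel f) \<le> integral\<^sup>L lborel w"
proof (cases "integrable lborel f")
  case True
  have "norm (integral\<^sup>L lborel f) \<le> (LINT a|lborel. norm (f a))" by (rule integral_norm_bound)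
  also have "\<dots> \<le> integral\<^sup>L lborel w"
    using True assms by (intro integral_mono) auto
  finally show ?thesis .
next
  case False
  \<comment> \<open>The Bochner integral of a function that is not integrable is 0 by convention,
    and \<open>w\<close> is nonnegative.\<close>
  have "0 \<le> integral\<^sup>L lborel w"
    using assms order_trans[OF norm_ge_zero] by (intro integral_nonneg_AE) auto
  with False show ?thesis by (simp add: not_integrable_integral_eq)
qed

text \<open>The inner time integral of a later Fubini argument, with z = s - exp w: its value is the
  Cauchy kernel, and its L1 norm provides the absolute integrability.\<close>

lemma integral_exp_halfline:
  fixes z :: complex
  assumes "Re z > 0"
  shows "integrable lborel (\<lambda>t. indicator {0<..} t *\<^sub>R exp (- z * of_real t))"
    and "(LINT t|lborel. indicator {0<..} t *\<^sub>R exp (- z * of_real t)) = 1 / z"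
    and "(LINT t|lborel. norm (indicator {0<..} t *\<^sub>R exp (- z * of_real t))) = 1 / Re z"
proof -
  have z: "z \<noteq> 0" using assms by auto
  show int: "integrable lborel (\<lambda>t. indicator {0<..} t *\<^sub>R exp (- z * of_real t))"
  proof (rule Bochner_Integration.integrable_bound)
    show "integrable lborel (\<lambda>t::real. exp (- Re z * \<bar>t\<bar>))"
      by (rule integrable_exp_minus_abs[OF assms])
  qed (auto simp: indicator_def norm_exp_eq_Re)
  have "(LBINT t=0..\<infinity>. exp (- z * of_real t)) = 0 - (- 1 / z)"
  proof (rule interval_integral_FTC_integrable)
    show "((\<lambda>t. - exp (- z * of_real t) / z) has_vector_derivative exp (- z * of_real x)) (at x)" for x
    proof -
      have "((\<lambda>t. - exp (- z * t) / z) has_field_derivative exp (- z * of_real x)) (at (of_real x))"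
        using z by (auto intro!: derivative_eq_intros)
      from has_vector_derivative_real_field[OF this] show ?thesis by (simp add: o_def)
    qed
    show "isCont (\<lambda>t. exp (- z * of_real t)) x" for x by (intro continuous_intros)
    show "set_integrable lborel (einterval 0 \<infinity>) (\<lambda>t. exp (- z * of_real t))"
      using int by (simp add: set_integrable_def einterval_def greaterThan_def zero_ereal_def)
    have "((\<lambda>t. - exp (- z * of_real t) / z) \<longlongrightarrow> - exp (- z * of_real 0) / z) (at_right 0)"
      by (intro tendsto_intros z)
    thus "(((\<lambda>t. - exp (- z * of_real t) / z) \<circ> real_of_ereal) \<longlongrightarrow> - 1 / z) (at_right 0)"
      by (simp add: zero_ereal_def ereal_tendsto_simps)
    have "((\<lambda>t. - exp (- z * of_real t) / z) \<longlongrightarrow> 0) at_top"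
    proof (rule tendsto_norm_zero_cancel)
      have "((\<lambda>t. exp (- c * t) / d) \<longlongrightarrow> 0) at_top" if "c > 0" "d > 0" for c d :: real
        using that by real_asymp
      hence "((\<lambda>t. exp (- Re z * t) / norm z) \<longlongrightarrow> 0) at_top" using assms z by simp
      thus "((\<lambda>t. norm (- exp (- z * of_real t) / z)) \<longlongrightarrow> 0) at_top"
        by (simp add: norm_divide norm_exp_eq_Re)
    qed
    thus "(((\<lambda>t. - exp (- z * of_real t) / z) \<circ> real_of_ereal) \<longlongrightarrow> 0) (at_left \<infinity>)"
      by (simp add: ereal_tendsto_simps)
  qed auto
  thus "(LINT t|lborel. indicator {0<..} t *\<^sub>R exp (- z * of_real t)) = 1 / z"
    by (simp add: interval_lebesgue_integral_def set_lebesgue_integral_def einterval_def greaterThan_def zero_ereal_def)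
  have "((\<lambda>t. exp (- Re z * t)) has_integral exp (- Re z * 0) / Re z) {0..}"
    by (rule has_integral_exp_minus_to_infinity[OF assms])
  hence hk: "((\<lambda>t. exp (- Re z * t)) has_integral 1 / Re z) {0<..}"
    by (subst has_integral_spike_set_eq[where T = "{0..}"]) (auto intro: negligible_subset[of "{0}"])
  have i: "integrable lborel (\<lambda>t. indicator {0<..} t * exp (- Re z * t))"
    using hk by (intro integrable_lborel_of_nonneg) auto
  have "norm (indicator {0<..} t *\<^sub>R exp (- z * of_real t)) = indicator {0<..} t *\<^sub>R exp (- Re z * t)" for t
    by (simp add: norm_exp_eq_Re)
  moreover have "(LINT t:{0<..}|lborel. exp (- Re z * t)) = integral {0<..} (\<lambda>t. exp (- Re z * t))"
    using i by (intro set_borel_integral_eq_integral) (simp add: set_integrable_def)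
  ultimately show "(LINT t|lborel. norm (indicator {0<..} t *\<^sub>R exp (- z * of_real t))) = 1 / Re z"
    using hk by (simp add: set_lebesgue_integral_def integral_unique)
qed

section \<open>Integrability of powers near 0 and near infinity\<close>

lemma integrable_powr_near_0:
  assumes "r > (-1::real)"
  shows "integrable lborel (\<lambda>t. indicator {0..T} t * t powr r)"
proof (cases "T \<ge> 0")
  case True
  show ?thesis
    by (rule integrable_lborel_of_nonneg) (use integrable_on_powr_from_0[OF assms True] in auto)
next
  case False
  hence "(\<lambda>t. indicator {0..T} t * t powr r) = (\<lambda>t. 0)" by (auto simp: indicator_def)
  thus ?thesis by simp
qed

lemma integral_powr_tail:
  assumes "r > (0::real)" "T > 0"
  shows "integrable lborel (\<lambda>t. indicator {T..} t * t powr (- 1 - r))"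
    and "(LINT t|lborel. indicator {T..} t * t powr (- 1 - r)) = T powr (- r) / r"
proof -
  have hk: "((\<lambda>t. t powr (- 1 - r)) has_integral - (T powr (- 1 - r + 1)) / (- 1 - r + 1)) {T..}"
    using assms by (intro has_integral_powr_to_inf) auto
  show i: "integrable lborel (\<lambda>t. indicator {T..} t * t powr (- 1 - r))"
    using hk by (intro integrable_lborel_of_nonneg) auto
  have "(LINT t:{T..}|lborel. t powr (- 1 - r)) = integral {T..} (\<lambda>t. t powr (- 1 - r))"
    using i by (intro set_borel_integral_eq_integral) (simp add: set_integrable_def)
  thus "(LINT t|lborel. indicator {T..} t * t powr (- 1 - r)) = T powr (- r) / r"
    using hk by (simp add: set_lebesgue_integral_def integral_unique)
qed

lemma integrable_of_two_powr_bounds: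
  assumes "K \<in> borel_measurable borel" "0 < rho" "0 < nu"
    and "\<And>t. t \<le> 0 \<Longrightarrow> K t = 0"
    and "\<And>t. t > 0 \<Longrightarrow> \<bar>K t\<bar> \<le> C1 * t powr (rho - 1)"
    and "\<And>t. t > 0 \<Longrightarrow> \<bar>K t\<bar> \<le> C2 * t powr (- 1 - nu)"
  shows "integrable lborel (K :: real \<Rightarrow> real)"
proof (rule Bochner_Integration.integrable_bound)
  show "integrable lborel (\<lambda>t. C1 * (indicator {0..1} t * t powr (rho - 1)) + C2 * (indicator {1..} t * t powr (- 1 - nu)))"
    using assms by (intro Bochner_Integration.integrable_add integrable_mult_right integrable_powr_near_0
        integral_powr_tail(1)) auto
  have "\<bar>K 1\<bar> \<le> C1 * 1 powr (rho - 1)" "\<bar>K 1\<bar> \<le> C2 * 1 powr (- 1 - nu)" using assms(5,6)[of 1] by auto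
  hence C: "C1 \<ge> 0" "C2 \<ge> 0" by auto
  have "\<bar>K t\<bar> \<le> C1 * (indicator {0..1} t * t powr (rho - 1)) + C2 * (indicator {1..} t * t powr (- 1 - nu))" for t
    using assms(4)[of t] assms(5)[of t] assms(6)[of t] C
    by (cases "t \<le> 0"; cases "t \<ge> 1") (auto simp: indicator_def)
  thus "AE t in lborel. norm (K t) \<le> norm (C1 * (indicator {0..1} t * t powr (rho - 1)) + C2 * (indicator {1..} t * t powr (- 1 - nu)))"
    by (intro AE_I2) (simp add: order_trans[OF _ abs_ge_self])
qed (use assms in auto)

lemma integral_ray_exp:
  assumes th: "pi / 2 < th" "th < pi" and t: "t > 0"
  shows "Im (LINT a|lborel. exp (of_real t * exp (Complex a th)) * exp (Complex a th)) = 0"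
    and "integrable lborel (\<lambda>a. exp (of_real t * exp (Complex a th)) * exp (Complex a th))"
proof -
  let ?w = "\<lambda>a. Complex a th"
  have c: "cos th < 0" using cos_gt_zero[of "pi - th"] th by simp
  have cw: "continuous_on UNIV ?w" by (simp add: Complex_eq continuous_intros)
  have cont: "continuous_on UNIV (\<lambda>a. exp (of_real t * exp (?w a)) * exp (?w a))"
    by (intro continuous_intros cw)
  show int: "integrable lborel (\<lambda>a. exp (of_real t * exp (?w a)) * exp (?w a))"
  proof (rule Bochner_Integration.integrable_bound)
    show "integrable lborel (exp_weight (- cos th * t) 1)"
      using c t by (intro exp_weight_integrable) (auto intro: mult_neg_pos)
    show "(\<lambda>a. exp (of_real t * exp (?w a)) * exp (?w a)) \<in> borel_measurable lborel"
      using borel_measurable_continuous_onI[OF cont] by simp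
  qed (auto simp: exp_weight_def norm_mult norm_exp_eq_Re Re_exp mult_ac)
  have dw: "(?w has_vector_derivative 1) (at a)" for a
    unfolding Complex_eq by (auto intro!: derivative_eq_intros)
  have "(LINT a|lborel. exp (of_real t * exp (?w a)) * exp (?w a)) = 0 - 1 / of_real t"
  proof (rule integral_line_FTC[OF int cont])
    fix a
    have "((\<lambda>w. exp (of_real t * exp w) / of_real t) has_field_derivative
        (exp (of_real t * exp (?w a)) * exp (?w a))) (at (?w a))"
      using t by (auto intro!: derivative_eq_intros)
    from field_vector_diff_chain_at[OF dw this]
    show "((\<lambda>a. exp (of_real t * exp (?w a)) / of_real t) has_vector_derivative
        exp (of_real t * exp (?w a)) * exp (?w a)) (at a)" by (simp add: o_def)
  next
    have e0: "((\<lambda>a. exp (?w a)) \<longlongrightarrow> 0) at_bot"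
    proof (rule tendsto_norm_zero_cancel)
      show "((\<lambda>a. norm (exp (?w a))) \<longlongrightarrow> 0) at_bot" unfolding norm_exp_eq_Re
        by (simp add: exp_at_bot)
    qed
    have "((\<lambda>a. exp (of_real t * exp (?w a)) / of_real t) \<longlongrightarrow> exp (of_real t * 0) / of_real t) at_bot"
      using t by (intro tendsto_intros e0) auto
    thus "((\<lambda>a. exp (of_real t * exp (?w a)) / of_real t) \<longlongrightarrow> 1 / of_real t) at_bot" by simp
  next
    show "((\<lambda>a. exp (of_real t * exp (?w a)) / of_real t) \<longlongrightarrow> 0) at_top"
    proof (rule tendsto_norm_zero_cancel)
      have "((\<lambda>a. exp (- (d * exp a)) / t) \<longlongrightarrow> 0) at_top" if "d > 0" for d
        using that t by real_asymp
      from this[of "- t * cos th"]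
      show "((\<lambda>a. norm (exp (of_real t * exp (?w a)) / of_real t)) \<longlongrightarrow> 0) at_top"
        using c t by (simp add: norm_divide norm_exp_eq_Re Re_exp mult_pos_neg mult_ac)
    qed
  qed
  hence "(LINT a|lborel. exp (of_real t * exp (?w a)) * exp (?w a)) = of_real (- 1 / t)" by simp
  thus "Im (LINT a|lborel. exp (of_real t * exp (?w a)) * exp (?w a)) = 0"
    by (simp only: Im_complex_of_real)
qed

text \<open>
  Logarithmic coordinates \<open>s = exp w\<close> turn the sector into a strip, the ray into a line, and
  \<open>s\<^sup>\<alpha>\<close> into an entire function. The decay hypothesis with exponent \<open>\<rho> < 1\<close> makes \<open>K\<close> integrable at \<open>0\<close>.
\<close>
lemma inverse_Laplace_sector:
  fixes h :: "complex \<Rightarrow> complex"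
  assumes hol: "h holomorphic_on {w. \<bar>Im w\<bar> < b}"
    and b: "pi / 2 < b" "b \<le> pi" and rho: "0 < rho" "rho < 1" and nu: "0 < nu"
    and bd1: "\<And>w. \<bar>Im w\<bar> < b \<Longrightarrow> norm (h w) \<le> C"
    and bd2: "\<And>w. \<bar>Im w\<bar> < b \<Longrightarrow> norm (h w) \<le> C * exp (- rho * Re w)"
    and bd3: "\<And>w. \<bar>Im w\<bar> < b \<Longrightarrow> norm (h w - of_real h0) \<le> C * exp (nu * Re w)"
    and real: "\<And>a. h (of_real a) \<in> \<real>"
  obtains K :: "real \<Rightarrow> real" and D where
    "K \<in> borel_measurable borel" "\<And>t. t \<le> 0 \<Longrightarrow> K t = 0"
    "\<And>t. t > 0 \<Longrightarrow> \<bar>K t\<bar> \<le> D * t powr (- 1 - nu)" "integrable lborel K"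
    "\<And>s. s > 0 \<Longrightarrow> (LINT t|lborel. exp (- s * t) * K t) = Re (h (of_real (ln s)))"
    "integral\<^sup>L lborel K = h0"
proof -
  \<comment> \<open>The midpoint lies inside the strip and beyond \<open>pi / 2\<close>, so that
    \<open>c = - cos th\<close> is positive and exp (t s) decays along the ray.\<close>
  define th where "th = (pi / 2 + b) / 2"
  have th: "pi / 2 < th" "th < b" "th < pi" using b by (auto simp: th_def)
  have thb: "\<bar>th\<bar> < b" using th pi_gt_zero by auto
  define c where "c = - cos th"
  have c: "c > 0" using cos_gt_zero[of "pi - th"] th by (simp add: c_def)
  let ?w = "\<lambda>a. Complex a th"
  have C: "C \<ge> 0" using bd1[of 0] b pi_gt_zero norm_ge_zero[of "h 0"] by (simp add: order_trans[of 0 "norm (h 0)" C])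
  have cw: "continuous_on UNIV ?w" by (simp add: Complex_eq continuous_intros)
  have ch: "continuous_on UNIV (\<lambda>a. h (?w a))" by (rule holomorphic_on_line[OF hol thb])
  have [measurable]: "(\<lambda>a. h (?w a)) \<in> borel_measurable borel" "?w \<in> borel_measurable borel"
    using borel_measurable_continuous_onI[OF ch] borel_measurable_continuous_onI[OF cw] by auto
  define E where "E = (\<lambda>t a. exp (complex_of_real t * exp (?w a)))"
  have nE: "norm (E t a) = exp (- (c * t) * exp a)" for t a
    by (simp add: E_def c_def norm_exp_eq_Re Re_exp mult_ac)
  have [measurable]: "(\<lambda>(t,a). E t a) \<in> borel_measurable (borel \<Otimes>\<^sub>M borel)"
    unfolding E_def by measurable
  define k where "k = (\<lambda>t. LINT a|lborel. E t a * h (?w a) * exp (?w a))"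
  \<comment> \<open>A full inversion contour also runs in along the conjugate ray. As
    \<open>h\<close> is real on the real line, that ray contributes the conjugate of I =
    \<open>k t\<close>, and (I - conj I) / (2 pi i) = Im I / pi.\<close>
  define K where "K = (\<lambda>t. if t > 0 then Im (k t) / pi else 0)"
  have [measurable]: "k \<in> borel_measurable borel" unfolding k_def by measurable
  have Km[measurable]: "K \<in> borel_measurable borel" unfolding K_def by measurable
  have b1: "norm (E t a * h (?w a) * exp (?w a)) \<le> C * exp_weight (c * t) (1 - rho) a" for t a
  proof -
    have "norm (E t a * h (?w a) * exp (?w a)) \<le> exp (- (c * t) * exp a) * (C * exp (- rho * a)) * exp a"
      unfolding norm_mult nE using bd2[of "?w a"] thb
      by (intro mult_mono) (auto simp: norm_exp_eq_Re intro!: mult_nonneg_nonneg C)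
    also have "\<dots> = C * (exp (- (c * t) * exp a) * (exp (- rho * a) * exp a))" by (simp add: mult_ac)
    also have "exp (- rho * a) * exp a = exp ((1 - rho) * a)"
      by (simp add: exp_add[symmetric] algebra_simps)
    finally show ?thesis by (simp add: exp_weight_def)
  qed
  have b2: "norm (E t a * (h (?w a) - of_real h0) * exp (?w a)) \<le> C * exp_weight (c * t) (1 + nu) a" for t a
  proof -
    have "norm (E t a * (h (?w a) - of_real h0) * exp (?w a)) \<le> exp (- (c * t) * exp a) * (C * exp (nu * a)) * exp a"
      unfolding norm_mult nE using bd3[of "?w a"] thb
      by (intro mult_mono) (auto simp: norm_exp_eq_Re intro!: mult_nonneg_nonneg C)
    also have "\<dots> = C * (exp (- (c * t) * exp a) * (exp (nu * a) * exp a))" by (simp add: mult_ac)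
    also have "exp (nu * a) * exp a = exp ((1 + nu) * a)"
      by (simp add: exp_add[symmetric] algebra_simps)
    finally show ?thesis by (simp add: exp_weight_def)
  qed
  define D1 where "D1 = C * integral\<^sup>L lborel (exp_weight c (1 - rho)) / pi"
  define D2 where "D2 = C * integral\<^sup>L lborel (exp_weight c (1 + nu)) / pi"
  \<comment> \<open>The decay of \<open>h\<close> at infinity controls the kernel near 0, integrably
    because \<open>rho\<close> is positive. \<open>K2\<close> uses the behaviour of \<open>h\<close>
    at s = 0 and controls the kernel for large times.\<close>
  have K1: "\<bar>K t\<bar> \<le> D1 * t powr (rho - 1)" if "t > 0" for t
  proof -
    have "norm (k t) \<le> (LINT a|lborel. C * exp_weight (c * t) (1 - rho) a)"
      unfolding k_def using b1 exp_weight_scaled(1)[OF c _ that, of "1 - rho"] rho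
      by (intro norm_integral_le) auto
    also have "\<dots> = C * (integral\<^sup>L lborel (exp_weight c (1 - rho)) * t powr (- (1 - rho)))"
      using exp_weight_scaled(2)[OF c _ that, of "1 - rho"] rho by simp
    finally have "norm (k t) / pi \<le> D1 * t powr (rho - 1)"
      by (simp add: D1_def field_simps)
    moreover have "\<bar>K t\<bar> \<le> norm (k t) / pi"
      using that abs_Im_le_cmod[of "k t"] by (simp add: K_def divide_right_mono)
    ultimately show ?thesis by linarith
  qed
  have K2: "\<bar>K t\<bar> \<le> D2 * t powr (- 1 - nu)" if "t > 0" for t
  proof -
    have "integrable lborel (\<lambda>a. E t a * (h (?w a) - of_real h0) * exp (?w a))"
    proof (rule Bochner_Integration.integrable_bound)
      show "integrable lborel (\<lambda>a. C * exp_weight (c * t) (1 + nu) a)"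
        using exp_weight_scaled(1)[OF c _ that, of "1 + nu"] nu by auto
      show "(\<lambda>a. E t a * (h (?w a) - of_real h0) * exp (?w a)) \<in> borel_measurable lborel"
        unfolding E_def by measurable
      show "AE a in lborel. norm (E t a * (h (?w a) - of_real h0) * exp (?w a)) \<le> norm (C * exp_weight (c * t) (1 + nu) a)"
        unfolding real_norm_def by (intro AE_I2 order_trans[OF b2 abs_ge_self])
    qed
    moreover note integral_ray_exp[OF th(1,3) that]
    moreover have "k t = (LINT a|lborel. E t a * (h (?w a) - of_real h0) * exp (?w a) + of_real h0 * (exp (of_real t * exp (?w a)) * exp (?w a)))"
      unfolding k_def E_def by (intro Bochner_Integration.integral_cong) (auto simp: algebra_simps)
    ultimately have "Im (k t) = Im (LINT a|lborel. E t a * (h (?w a) - of_real h0) * exp (?w a))"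
      by simp
    moreover have "norm (LINT a|lborel. E t a * (h (?w a) - of_real h0) * exp (?w a)) \<le> (LINT a|lborel. C * exp_weight (c * t) (1 + nu) a)"
      using b2 exp_weight_scaled(1)[OF c _ that, of "1 + nu"] nu
      by (intro norm_integral_le) auto
    ultimately have "\<bar>Im (k t)\<bar> \<le> (LINT a|lborel. C * exp_weight (c * t) (1 + nu) a)"
      using abs_Im_le_cmod order_trans by metis
    also have "\<dots> = C * (integral\<^sup>L lborel (exp_weight c (1 + nu)) * t powr (- (1 + nu)))"
      using exp_weight_scaled(2)[OF c _ that, of "1 + nu"] nu by simp
    finally have "\<bar>Im (k t)\<bar> / pi \<le> D2 * t powr (- 1 - nu)"
      by (simp add: D2_def field_simps)
    thus ?thesis using that by (simp add: K_def)
  qed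
  have K0: "K t = 0" if "t \<le> 0" for t using that by (simp add: K_def)
  have Kint: "integrable lborel K"
    by (rule integrable_of_two_powr_bounds[OF Km rho(1) nu K0 K1 K2])
  have Lap: "(LINT t|lborel. exp (- s * t) * K t) = Re (h (of_real (ln s)))" if s: "s > 0" for s
  proof -
    \<comment> \<open>Integrated over \<open>a\<close> first, \<open>F\<close> gives
      \<open>exp (- s * t)\<close> times \<open>k t\<close> for positive \<open>t\<close>;
      integrated over \<open>t\<close> first, it gives the integrand of
      \<open>Cauchy_ray_formula\<close>.\<close>
    define F where "F = (\<lambda>(a, t). h (?w a) * exp (?w a) *
        (indicator {0<..} t *\<^sub>R exp (- (of_real s - exp (?w a)) * complex_of_real t)))"
    have Fm[measurable]: "F \<in> borel_measurable (lborel \<Otimes>\<^sub>M lborel)" unfolding F_def by measurable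
    have re: "Re (of_real s - exp (?w a)) = s + c * exp a" for a by (simp add: Re_exp c_def)
    have rep: "Re (of_real s - exp (?w a)) > 0" for a
      unfolding re using s c by (intro add_pos_pos mult_pos_pos) auto
    note hl = integral_exp_halfline[OF rep]
    have Fint: "integrable (lborel \<Otimes>\<^sub>M lborel) F"
    proof (rule lborel_pair.Fubini_integrable[OF Fm])
      show "AE a in lborel. integrable lborel (\<lambda>t. F (a, t))"
        unfolding F_def prod.case by (intro AE_I2 integrable_mult_right hl(1))
      have n: "(LINT t|lborel. norm (F (a, t))) = norm (h (?w a)) * exp a / (s + c * exp a)" for a
      proof -
        have "(LINT t|lborel. norm (F (a, t))) = norm (h (?w a)) * exp a *
            (LINT t|lborel. norm (indicator {0<..} t *\<^sub>R exp (- (of_real s - exp (?w a)) * complex_of_real t)))"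
          unfolding F_def prod.case norm_mult integral_mult_right_zero norm_exp_eq_Re by simp
        thus ?thesis unfolding hl(3) re by simp
      qed
      show "integrable lborel (\<lambda>a. LINT t|lborel. norm (F (a, t)))"
        unfolding n
      proof (rule Bochner_Integration.integrable_bound)
        show "integrable lborel (\<lambda>a::real. (C / min s c) * exp (- rho * \<bar>a\<bar>))"
          using integrable_exp_minus_abs[OF rho(1)] by simp
        have "norm (h (?w a)) * exp a / (s + c * exp a) \<le> (C / min s c) * exp (- rho * \<bar>a\<bar>)" for a
        proof -
          have "min s c * max (exp a) 1 \<le> s + c * exp a"
          proof -
            have "min s c * exp a \<le> c * exp a" "min s c \<le> s" "0 < c * exp a" using c by auto
            thus ?thesis using s by (cases "exp a \<le> 1") (auto simp only: max_def split: if_splits)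
          qed
          hence "norm (h (?w a)) * exp a / (s + c * exp a) \<le> norm (h (?w a)) * exp a / (min s c * max (exp a) 1)"
            using s c by (intro divide_left_mono mult_pos_pos) (auto simp: less_max_iff_disj add_pos_pos)
          also have "\<dots> = norm (h (?w a)) * exp a / max (exp a) 1 / min s c" by (simp add: field_simps)
          also have "\<dots> \<le> C * exp (- rho * \<bar>a\<bar>) / min s c"
            using bd1[of "?w a"] bd2[of "?w a"] thb rho s c
            by (intro divide_right_mono decay_weight) auto
          finally show ?thesis by simp
        qed
        thus "AE a in lborel. norm (norm (h (?w a)) * exp a / (s + c * exp a)) \<le> norm ((C / min s c) * exp (- rho * \<bar>a\<bar>))"
          using s c C by (intro AE_I2) (simp add: add_pos_pos)
      qed measurable
    qed
    have inner: "(LINT a|lborel. F (a, t)) = (if t > 0 then of_real (exp (- s * t)) * k t else 0)" for t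
    proof (cases "t > 0")
      case True
      have "(LINT a|lborel. F (a, t)) = (LINT a|lborel. of_real (exp (- s * t)) * (E t a * h (?w a) * exp (?w a)))"
      proof (rule Bochner_Integration.integral_cong[OF refl])
        fix a
        have "exp (- (of_real s - exp (?w a)) * complex_of_real t) = of_real (exp (- s * t)) * E t a"
          unfolding E_def exp_of_real[symmetric] exp_add[symmetric] by (simp add: algebra_simps)
        thus "F (a, t) = of_real (exp (- s * t)) * (E t a * h (?w a) * exp (?w a))"
          using True by (simp add: F_def mult_ac)
      qed
      thus ?thesis using True by (simp add: k_def)
    qed (simp add: F_def)
    have swap: "(LINT t|lborel. LINT a|lborel. F (a, t)) = (LINT a|lborel. LINT t|lborel. F (a, t))"
      using lborel_pair.Fubini_integral[of "\<lambda>a t. F (a, t)"] Fint by simp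
    have intt: "integrable lborel (\<lambda>t. LINT a|lborel. F (a, t))"
      using lborel_pair.integrable_snd[of "\<lambda>a t. F (a, t)"] Fint by simp
    have "(LINT t|lborel. exp (- s * t) * K t) = (LINT t|lborel. Im (LINT a|lborel. F (a, t)) / pi)"
      unfolding inner by (intro Bochner_Integration.integral_cong) (auto simp: K_def)
    also have "\<dots> = Im (LINT t|lborel. LINT a|lborel. F (a, t)) / pi"
      using intt by simp
    also have "\<dots> = Im (LINT a|lborel. h (?w a) * exp (?w a) / (of_real s - exp (?w a))) / pi"
    proof -
      have "(LINT t|lborel. F (a, t)) = h (?w a) * exp (?w a) / (of_real s - exp (?w a))" for a
        unfolding F_def prod.case integral_mult_right_zero hl(2) by simp
      thus ?thesis unfolding swap by simp
    qed
    also have "\<dots> = Re (h (of_real (ln s)))"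
      using Cauchy_ray_formula(2)[OF hol less_imp_le[OF th(1)] th(2) b(2) rho(1) less_imp_le[OF rho(2)] bd1 bd2 real s]
      by simp
    finally show ?thesis .
  qed
  \<comment> \<open>Let s = 1 / (n + 1) tend to 0 in \<open>Lap\<close>: dominated convergence gives
    the total integral on one side, and \<open>bd3\<close> gives \<open>h0\<close> on the other, as
    \<open>ln s\<close> tends to minus infinity.\<close>
  have "integral\<^sup>L lborel K = h0"
  proof (rule LIMSEQ_unique)
    let ?s = "\<lambda>n. inverse (real (Suc n))"
    show "(\<lambda>n. LINT t|lborel. exp (- ?s n * t) * K t) \<longlonglongrightarrow> integral\<^sup>L lborel K"
    proof (rule integral_dominated_convergence)
      show "integrable lborel (\<lambda>t. \<bar>K t\<bar>)" using Kint by simp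
      have "(\<lambda>n. exp (- ?s n * t) * K t) \<longlonglongrightarrow> exp (- 0 * t) * K t" for t
        by (intro tendsto_intros LIMSEQ_inverse_real_of_nat)
      thus "AE t in lborel. (\<lambda>n. exp (- ?s n * t) * K t) \<longlonglongrightarrow> K t" by simp
      have "\<bar>exp (- ?s n * t) * K t\<bar> \<le> \<bar>K t\<bar>" for n t
      proof (cases "t \<le> 0")
        case False
        hence "exp (- ?s n * t) \<le> 1" by simp
        thus ?thesis using mult_right_mono[of "exp (- ?s n * t)" 1 "\<bar>K t\<bar>"] by (simp add: abs_mult)
      qed (simp add: K0)
      thus "AE t in lborel. norm (exp (- ?s n * t) * K t) \<le> \<bar>K t\<bar>" for n by simp
    qed measurable
    have "(\<lambda>n. Re (h (of_real (ln (?s n)))) - h0) \<longlonglongrightarrow> 0"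
    proof (rule Lim_null_comparison)
      show "(\<lambda>n. C * (?s n powr nu)) \<longlonglongrightarrow> 0" using nu by real_asymp
      have "norm (Re (h (of_real (ln (?s n)))) - h0) \<le> C * (?s n powr nu)" for n
      proof -
        have "norm (Re (h (of_real (ln (?s n)))) - h0) \<le> norm (h (of_real (ln (?s n))) - of_real h0)"
          using abs_Re_le_cmod[of "h (of_real (ln (?s n))) - of_real h0"] by simp
        also have "\<dots> \<le> C * exp (nu * ln (?s n))"
          using bd3[of "of_real (ln (?s n))"] b pi_gt_zero by simp
        finally show ?thesis by (simp add: powr_def)
      qed
      thus "\<forall>\<^sub>F n in sequentially. norm (Re (h (of_real (ln (?s n)))) - h0) \<le> C * (?s n powr nu)" by simp
    qed
    hence "(\<lambda>n. Re (h (of_real (ln (?s n))))) \<longlonglongrightarrow> h0" by (simp add: LIM_zero_iff)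
    thus "(\<lambda>n. LINT t|lborel. exp (- ?s n * t) * K t) \<longlonglongrightarrow> h0"
      using Lap by simp
  qed
  thus ?thesis using that Km K0 K2 Kint Lap by blast
qed

section \<open>Uniqueness of the Laplace transform\<close>

text \<open>Lerch's theorem by Weierstrass approximation: the transforms at s = 2, 3, 4, ... become
  moments on [0, 1] in the variable u = exp (- t). The weight exp (- 2 t) against the growth exp t
  makes the test function continuous at u = 0.\<close>

lemma Laplace_zero_imp_zero:
  fixes f :: "real \<Rightarrow> real"
  assumes meas: "f \<in> borel_measurable borel" and neg: "\<And>t. t < 0 \<Longrightarrow> f t = 0"
    and cont: "continuous_on {0..} f"
    and bd: "\<And>t. t \<ge> 0 \<Longrightarrow> \<bar>f t\<bar> \<le> M * exp t"
    and z: "\<And>s. s \<ge> 2 \<Longrightarrow> (LINT t|lborel. exp (- s * t) * f t) = 0"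
    and t: "t \<ge> 0"
  shows "f t = 0"
proof -
  note [measurable] = meas
  have M: "M \<ge> 0" using bd[of 0] by simp
  have int: "integrable lborel (\<lambda>t. exp (- s * t) * f t)" if "s \<ge> 2" for s
  proof (rule Bochner_Integration.integrable_bound)
    show "integrable lborel (\<lambda>t::real. M * exp (- 1 * \<bar>t\<bar>))"
      using integrable_exp_minus_abs[of 1] by simp
    have "\<bar>exp (- s * t) * f t\<bar> \<le> M * exp (- 1 * \<bar>t\<bar>)" for t
    proof (cases "t < 0")
      case False
      have "2 * t \<le> s * t" using that False by (intro mult_right_mono) auto
      hence "\<bar>exp (- s * t) * f t\<bar> \<le> exp (- 2 * t) * (M * exp t)"
        unfolding abs_mult using bd[of t] False by (intro mult_mono) auto
      also have "\<dots> = M * exp (- 1 * \<bar>t\<bar>)" using False by (simp add: exp_add[symmetric])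
      finally show ?thesis .
    qed (use neg M in auto)
    thus "AE t in lborel. norm (exp (- s * t) * f t) \<le> norm (M * exp (- 1 * \<bar>t\<bar>))"
      using M by (intro AE_I2) simp
  qed measurable
  \<comment> \<open>After the substitution \<open>u = exp (- t)\<close> all moments vanish; test against \<open>phi (exp (- t)) = exp (- 2 t) f t\<close>.\<close>
  define phi where "phi = (\<lambda>u. if u \<le> 0 then 0 else u ^ 2 * f (- ln u))"
  have phi_exp: "phi (exp (- t)) = exp (- 2 * t) * f t" for t
    by (simp add: phi_def power2_eq_square exp_add[symmetric])
  have phi_cont: "continuous_on {0..1} phi"
    unfolding continuous_on_eq_continuous_within
  proof
    fix u :: real assume u: "u \<in> {0..1}"
    show "continuous (at u within {0..1}) phi"
    proof (cases "u = 0")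
      case True
      have "(phi \<longlongrightarrow> 0) (at 0 within {0..1})"
      proof (rule Lim_null_comparison)
        have "norm (phi x) \<le> M * x" if "x \<in> {0..1}" for x
        proof (cases "x = 0")
          case False
          hence x: "x > 0" "x \<le> 1" using that by auto
          have "\<bar>f (- ln x)\<bar> \<le> M * exp (- ln x)" using x by (intro bd) simp
          hence "x ^ 2 * \<bar>f (- ln x)\<bar> \<le> x ^ 2 * (M * exp (- ln x))" by (intro mult_left_mono) auto
          also have "\<dots> = M * x" using x by (simp add: exp_minus power2_eq_square)
          finally show ?thesis using x by (simp add: phi_def abs_mult)
        qed (simp add: phi_def)
        thus "\<forall>\<^sub>F x in at 0 within {0..1}. norm (phi x) \<le> M * x"
          by (auto simp: eventually_at_filter)
        show "((\<lambda>x. M * x) \<longlongrightarrow> 0) (at 0 within {0..1})" by (auto intro!: tendsto_eq_intros)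
      qed
      thus ?thesis using True by (simp add: continuous_within phi_def)
    next
      case False
      hence u0: "0 < u" using u by simp
      have "continuous_on {0<..1} (\<lambda>u. u ^ 2 * f (- ln u))"
        by (intro continuous_intros continuous_on_compose2[OF cont]) auto
      moreover have "continuous_on {0<..1} phi \<longleftrightarrow> continuous_on {0<..1} (\<lambda>u. u ^ 2 * f (- ln u))"
        by (rule continuous_on_cong) (auto simp: phi_def)
      ultimately have "continuous (at u within {0<..1}) phi"
        using u u0 by (simp add: continuous_on_eq_continuous_within)
      moreover have "at u within {0<..1} = at u within {0..1}"
        by (rule at_within_nhd[where S = "{0<..}"]) (use u0 in auto)
      ultimately show ?thesis by simp
    qed
  qed
  \<comment> \<open>By \<open>phi_exp\<close> this is the integral of the square of
    \<open>exp (- 2 * t) * f t\<close>, whereas any polynomial in place of \<open>phi\<close> gives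
    0.\<close>
  define J where "J = (LINT t|lborel. (exp (- 2 * t) * f t) * phi (exp (- t)))"
  define A where "A = (LINT t|lborel. \<bar>exp (- 2 * t) * f t\<bar>)"
  have Jint: "integrable lborel (\<lambda>t. (exp (- 2 * t) * f t) * phi (exp (- t)))"
  proof (rule Bochner_Integration.integrable_bound)
    show "integrable lborel (\<lambda>t. M * (exp (- 2 * t) * f t))" using int[of 2] by simp
    have "\<bar>phi (exp (- t))\<bar> \<le> M" if "t \<ge> 0" for t
    proof -
      have "\<bar>phi (exp (- t))\<bar> \<le> exp (- 2 * t) * (M * exp t)"
        unfolding phi_exp abs_mult using bd[OF that] by simp
      also have "\<dots> = M * exp (- t)" by (simp add: exp_add[symmetric])
      also have "\<dots> \<le> M * 1" using M that by (intro mult_left_mono) auto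
      finally show ?thesis by simp
    qed
    hence "\<bar>(exp (- 2 * t) * f t) * phi (exp (- t))\<bar> \<le> \<bar>M * (exp (- 2 * t) * f t)\<bar>" for t
    proof (cases "t < 0")
      case False
      hence "\<bar>exp (- 2 * t) * f t\<bar> * \<bar>phi (exp (- t))\<bar> \<le> \<bar>exp (- 2 * t) * f t\<bar> * M"
        using \<open>\<And>t. 0 \<le> t \<Longrightarrow> \<bar>phi (exp (- t))\<bar> \<le> M\<close> by (intro mult_left_mono) auto
      thus ?thesis using M by (simp add: abs_mult mult_ac)
    qed (simp add: neg)
    thus "AE t in lborel. norm ((exp (- 2 * t) * f t) * phi (exp (- t))) \<le> norm (M * (exp (- 2 * t) * f t))"
      unfolding real_norm_def by (intro AE_I2)
  qed (unfold phi_exp, measurable)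
  have small: "\<bar>J\<bar> \<le> e * A" if e: "e > 0" for e
  proof -
    obtain g where g: "real_polynomial_function g" "\<And>x. x \<in> {0..1} \<Longrightarrow> \<bar>phi x - g x\<bar> < e"
      using Stone_Weierstrass_real_polynomial_function[OF compact_Icc phi_cont e] by blast
    obtain a n where gs: "g = (\<lambda>x. \<Sum>i\<le>n. a i * x ^ i)"
      using g(1) by (auto simp: real_polynomial_function_iff_sum)
    have gexp: "(exp (- 2 * t) * f t) * g (exp (- t)) = (\<Sum>i\<le>n. a i * (exp (- (2 + real i) * t) * f t))" for t
    proof -
      have "exp (- (2 + real i) * t) = exp (- 2 * t) * exp (- t) ^ i" for i
        by (simp add: exp_of_nat_mult[symmetric] exp_add[symmetric] algebra_simps)
      thus ?thesis unfolding gs sum_distrib_left by (intro sum.cong refl) (simp only: mult_ac)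
    qed
    have gint: "integrable lborel (\<lambda>t. (exp (- 2 * t) * f t) * g (exp (- t)))"
      unfolding gexp by (intro Bochner_Integration.integrable_sum integrable_mult_right int) auto
    have g0: "(LINT t|lborel. (exp (- 2 * t) * f t) * g (exp (- t))) = 0"
      unfolding gexp by (subst Bochner_Integration.integral_sum)
        (auto intro!: integrable_mult_right int sum.neutral simp only: integral_mult_right_zero z)
    have "J = (LINT t|lborel. (exp (- 2 * t) * f t) * phi (exp (- t)) - (exp (- 2 * t) * f t) * g (exp (- t)))"
      using Jint gint g0 by (simp add: J_def)
    also have "\<bar>\<dots>\<bar> \<le> (LINT t|lborel. e * \<bar>exp (- 2 * t) * f t\<bar>)"
      unfolding real_norm_def[symmetric]
    proof (rule Bochner_Integration.integral_norm_bound_integral)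
      show "integrable lborel (\<lambda>t. e * norm (exp (- 2 * t) * f t))" using int[of 2] by auto
      fix t
      show "norm ((exp (- 2 * t) * f t) * phi (exp (- t)) - (exp (- 2 * t) * f t) * g (exp (- t))) \<le> e * norm (exp (- 2 * t) * f t)"
      proof (cases "t < 0")
        case False
        hence "\<bar>phi (exp (- t)) - g (exp (- t))\<bar> \<le> e" using g(2)[of "exp (- t)"] by simp
        hence "\<bar>exp (- 2 * t) * f t\<bar> * \<bar>phi (exp (- t)) - g (exp (- t))\<bar> \<le> \<bar>exp (- 2 * t) * f t\<bar> * e"
          by (intro mult_left_mono) auto
        thus ?thesis unfolding right_diff_distrib[symmetric] real_norm_def abs_mult by (simp only: mult_ac)
      qed (simp add: neg)
    qed (use Jint gint in auto)
    also have "\<dots> = e * A" by (simp add: A_def)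
    finally show ?thesis .
  qed
  have A0: "A \<ge> 0" by (simp add: A_def)
  have "J = 0"
  proof (rule ccontr)
    assume "J \<noteq> 0"
    hence "\<bar>J\<bar> > 0" by simp
    have "\<bar>J\<bar> \<le> \<bar>J\<bar> / (2 * (A + 1)) * A" using small[of "\<bar>J\<bar> / (2 * (A + 1))"] \<open>\<bar>J\<bar> > 0\<close> A0 by simp
    also have "\<dots> < \<bar>J\<bar>" using \<open>\<bar>J\<bar> > 0\<close> A0 by (simp add: field_simps add_nonneg_pos)
    finally show False by simp
  qed
  let ?v = "\<lambda>t. (exp (- 2 * t) * f t) * (exp (- 2 * t) * f t)"
  have "AE t in lborel. ?v t = 0"
    using \<open>J = 0\<close> Jint unfolding J_def phi_exp
    by (subst (asm) integral_nonneg_eq_0_iff_AE) auto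
  hence v0: "AE t in lborel. indicator {0..T} t * ?v t = 0" for T :: real by auto
  have vint: "integrable lborel (\<lambda>t. indicator {0..T} t * ?v t)" for T :: real
    using integrable_mult_indicator[of "{0..T}" lborel ?v] Jint unfolding phi_exp by simp
  \<comment> \<open>The endpoint \<open>t + 1\<close> keeps the interval nondegenerate for t = 0. On
    it, continuity of the nonnegative \<open>?v\<close> turns a vanishing integral into vanishing at
    every point.\<close>
  have "(LINT x:{0..t + 1}|lborel. ?v x) = integral {0..t + 1} ?v" "?v integrable_on {0..t + 1}"
    using vint[of "t + 1"] by (auto intro!: set_borel_integral_eq_integral simp: set_integrable_def)
  moreover have "(LINT x:{0..t + 1}|lborel. ?v x) = 0"
    unfolding set_lebesgue_integral_def using v0[of "t + 1"] by (simp add: integral_eq_zero_AE)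
  ultimately have "(?v has_integral 0) (cbox 0 (t + 1))"
    by (metis integrable_integral cbox_interval)
  moreover have "continuous_on (cbox 0 (t + 1)) ?v"
    by (intro continuous_intros continuous_on_subset[OF cont]) auto
  ultimately have "?v t = 0"
    using t by (intro has_integral_0_cbox_imp_0[of 0 "t + 1"]) auto
  thus ?thesis by simp
qed

section \<open>Convolution of causal functions\<close>

text \<open>
  The integral over the whole line is the usual one over \<open>[0, t]\<close> as soon as both functions vanish on
  the negative axis.
\<close>
definition conv :: "(real \<Rightarrow> real) \<Rightarrow> (real \<Rightarrow> real) \<Rightarrow> real \<Rightarrow> real" where
  "conv f g t = (LINT s|lborel. f (t - s) * g s)"

text \<open>Causal version of L1_loc; \<open>loc_bdd\<close> is the causal version of local
  boundedness. Fractional kernels of order below 1 belong only to the first class, solutions and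
  data to the second. With one factor from each class a convolution converges at every point, so
  that identities hold without exceptional sets.\<close>

definition loc_int :: "(real \<Rightarrow> real) \<Rightarrow> bool" where
  "loc_int f \<longleftrightarrow> f \<in> borel_measurable borel \<and> (\<forall>t<0. f t = 0) \<and>
     (\<forall>T. integrable lborel (\<lambda>t. indicator {..T} t * f t))"

definition loc_bdd :: "(real \<Rightarrow> real) \<Rightarrow> bool" where
  "loc_bdd f \<longleftrightarrow> f \<in> borel_measurable borel \<and> (\<forall>t<0. f t = 0) \<and> (\<forall>T. \<exists>B. \<forall>t\<le>T. \<bar>f t\<bar> \<le> B)"

text \<open>Convolution with it is integration from 0. The value 1 at 0 makes it continuous on
  \<open>{0..}\<close>.\<close>

definition heaviside :: "real \<Rightarrow> real" where "heaviside t = (if t \<ge> 0 then 1 else 0)"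

lemma loc_int_measurable[measurable_dest]: "loc_int f \<Longrightarrow> f \<in> borel_measurable borel"
  and loc_bdd_measurable[measurable_dest]: "loc_bdd f \<Longrightarrow> f \<in> borel_measurable borel"
  by (auto simp: loc_int_def loc_bdd_def)

lemma loc_int_neg: "loc_int f \<Longrightarrow> t < 0 \<Longrightarrow> f t = 0"
  and loc_bdd_neg: "loc_bdd f \<Longrightarrow> t < 0 \<Longrightarrow> f t = 0"
  by (auto simp: loc_int_def loc_bdd_def)

lemma loc_bdd_bound:
  assumes "loc_bdd f" obtains B where "B \<ge> 0" "\<And>t. t \<le> T \<Longrightarrow> \<bar>f t\<bar> \<le> B"
proof -
  obtain B where "\<forall>t\<le>T. \<bar>f t\<bar> \<le> B" using assms unfolding loc_bdd_def by blast
  thus ?thesis using that[of "max 0 B"] by fastforce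
qed

lemma loc_bdd_imp_loc_int:
  assumes "loc_bdd f" shows "loc_int f"
  unfolding loc_int_def
proof (intro conjI allI)
  fix T
  obtain B where B: "B \<ge> 0" "\<And>t. t \<le> T \<Longrightarrow> \<bar>f t\<bar> \<le> B" using loc_bdd_bound[OF assms] by blast
  note [measurable] = loc_bdd_measurable[OF assms]
  show "integrable lborel (\<lambda>t. indicator {..T} t * f t)"
  proof (rule Bochner_Integration.integrable_bound)
    show "integrable lborel (\<lambda>t. B * indicator {0..T} t)" by (simp add: emeasure_lborel_Icc_eq)
    show "AE t in lborel. norm (indicator {..T} t * f t) \<le> norm (B * indicator {0..T} t)"
      using B loc_bdd_neg[OF assms] by (intro AE_I2) (auto simp: indicator_def not_le)
  qed measurable
qed (use assms in \<open>auto simp: loc_bdd_def\<close>)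

lemma loc_int_of_integrable:
  assumes "integrable lborel f" "f \<in> borel_measurable borel" "\<And>t. t < 0 \<Longrightarrow> f t = 0"
  shows "loc_int f"
  unfolding loc_int_def
  using assms integrable_mult_indicator[of "{.._}" lborel f] by auto

lemma conv_commute: "conv f g t = conv g f t"
  unfolding conv_def
  by (subst lborel_integral_real_affine[where c = "-1" and t = t]) (auto simp: mult.commute)

lemma conv_alt: "conv f g t = (LINT s|lborel. g (t - s) * f s)"
  using conv_commute[of f g t] by (simp add: conv_def)

lemma conv_integrable:
  assumes f: "loc_int f" and g: "loc_bdd g"
  shows "integrable lborel (\<lambda>s. f (t - s) * g s)"
proof -
  note [measurable] = loc_int_measurable[OF f] loc_bdd_measurable[OF g]
  obtain B where B: "B \<ge> 0" "\<And>s. s \<le> t \<Longrightarrow> \<bar>g s\<bar> \<le> B" using loc_bdd_bound[OF g] by blast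
  show ?thesis
  proof (rule Bochner_Integration.integrable_bound)
    have "integrable lborel (\<lambda>s. indicator {..t} (t + (-1) * s) * f (t + (-1) * s))"
      using f by (intro lborel_integrable_real_affine) (auto simp: loc_int_def)
    thus "integrable lborel (\<lambda>s. B * (indicator {..t} (t - s) * f (t - s)))"
      by simp
    have "\<bar>f (t - s) * g s\<bar> \<le> \<bar>B * (indicator {..t} (t - s) * f (t - s))\<bar>" for s
    proof (cases "0 \<le> s \<and> s \<le> t")
      case True
      thus ?thesis using B by (auto simp: abs_mult mult.commute intro!: mult_right_mono)
    qed (use loc_int_neg[OF f] loc_bdd_neg[OF g] in \<open>auto simp: not_le\<close>)
    thus "AE s in lborel. norm (f (t - s) * g s) \<le> norm (B * (indicator {..t} (t - s) * f (t - s)))"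
      unfolding real_norm_def by (intro AE_I2)
  qed measurable
qed

lemma conv_bound:
  assumes f: "loc_int f" and g: "loc_bdd g" and B: "\<And>s. s \<le> T \<Longrightarrow> \<bar>g s\<bar> \<le> B" and t: "t \<le> T"
  shows "\<bar>conv f g t\<bar> \<le> B * (LINT s|lborel. \<bar>indicator {..T} s * f s\<bar>)"
proof -
  have fT: "integrable lborel (\<lambda>s. indicator {..T} s * f s)" using f by (auto simp: loc_int_def)
  have B0: "B \<ge> 0" using B[of T] by linarith
  have i: "integrable lborel (\<lambda>s. B * \<bar>indicator {..T} (t - s) * f (t - s)\<bar>)"
    using lborel_integrable_real_affine[OF fT, of "-1" t] by simp
  have "\<bar>conv f g t\<bar> \<le> (LINT s|lborel. B * \<bar>indicator {..T} (t - s) * f (t - s)\<bar>)"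
    unfolding conv_def real_norm_def[symmetric]
  proof (rule Bochner_Integration.integral_norm_bound_integral[OF conv_integrable[OF f g]])
    show "integrable lborel (\<lambda>s. B * norm (indicator {..T} (t - s) * f (t - s)))" using i by simp
    show "norm (f (t - s) * g s) \<le> B * norm (indicator {..T} (t - s) * f (t - s))" for s
    proof (cases "0 \<le> s \<and> s \<le> t")
      case True
      thus ?thesis using B[of s] t by (auto simp: abs_mult mult.commute intro!: mult_right_mono)
    qed (use loc_int_neg[OF f] loc_bdd_neg[OF g] B0 in \<open>auto simp: not_le\<close>)
  qed
  also have "\<dots> = B * (LINT s|lborel. \<bar>indicator {..T} s * f s\<bar>)"
    by (subst (2) lborel_integral_real_affine[where c = "-1" and t = t]) auto
  finally show ?thesis .
qed

lemma conv_measurable: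
  assumes [measurable]: "f \<in> borel_measurable borel" "g \<in> borel_measurable borel"
  shows "conv f g \<in> borel_measurable borel"
  unfolding conv_def[abs_def] by measurable

lemma conv_neg:
  assumes "loc_int f" "loc_int g" "t < 0"
  shows "conv f g t = 0"
proof -
  have "(\<lambda>s. f (t - s) * g s) = (\<lambda>s. 0)"
    using assms loc_int_neg[of f "t - _"] loc_int_neg[of g] by (metis diff_less_0_iff_less le_less_trans mult_eq_0_iff not_le)
  thus ?thesis unfolding conv_def by simp
qed

lemma loc_bdd_conv:
  assumes f: "loc_int f" and g: "loc_bdd g"
  shows "loc_bdd (conv f g)"
  unfolding loc_bdd_def
proof (intro conjI allI impI)
  show "conv f g \<in> borel_measurable borel"
    using f g by (intro conv_measurable) (auto simp: loc_int_def loc_bdd_def)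
  show "conv f g t = 0" if "t < 0" for t
    using conv_neg[OF f loc_bdd_imp_loc_int[OF g] that] .
  fix T
  obtain B where "B \<ge> 0" "\<And>t. t \<le> T \<Longrightarrow> \<bar>g t\<bar> \<le> B" using loc_bdd_bound[OF g] by blast
  thus "\<exists>B. \<forall>t\<le>T. \<bar>conv f g t\<bar> \<le> B" using conv_bound[OF f g] by blast
qed

lemma loc_bdd_conv': "loc_bdd f \<Longrightarrow> loc_int g \<Longrightarrow> loc_bdd (conv f g)"
  using loc_bdd_conv[of g f] by (simp add: conv_commute[of f g, abs_def])

lemma loc_bdd_mult: "loc_bdd f \<Longrightarrow> loc_bdd (\<lambda>t. c * f t)"
  unfolding loc_bdd_def
proof (intro conjI allI)
  fix T assume "f \<in> borel_measurable borel \<and> (\<forall>t<0. f t = 0) \<and> (\<forall>T. \<exists>B. \<forall>t\<le>T. \<bar>f t\<bar> \<le> B)"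
  then obtain B where "\<forall>t\<le>T. \<bar>f t\<bar> \<le> B" by blast
  thus "\<exists>B. \<forall>t\<le>T. \<bar>c * f t\<bar> \<le> B"
    by (intro exI[of _ "\<bar>c\<bar> * B"]) (auto simp: abs_mult mult_left_mono)
qed auto

lemma loc_bdd_add:
  assumes f: "loc_bdd f" and g: "loc_bdd g"
  shows "loc_bdd (\<lambda>t. f t + g t)"
  unfolding loc_bdd_def
proof (intro conjI allI)
  fix T
  obtain B1 where "\<And>t. t \<le> T \<Longrightarrow> \<bar>f t\<bar> \<le> B1" using loc_bdd_bound[OF f] by blast
  moreover obtain B2 where "\<And>t. t \<le> T \<Longrightarrow> \<bar>g t\<bar> \<le> B2" using loc_bdd_bound[OF g] by blast
  ultimately show "\<exists>B. \<forall>t\<le>T. \<bar>f t + g t\<bar> \<le> B"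
    by (intro exI[of _ "B1 + B2"]) (auto intro: order_trans[OF abs_triangle_ineq add_mono])
qed (use f g in \<open>auto simp: loc_bdd_def\<close>)

lemma loc_bdd_sum:
  assumes "\<And>i. loc_bdd (g i)"
  shows "loc_bdd (\<lambda>t. \<Sum>i\<in>I. c i * g i t)"
proof (induction I rule: infinite_finite_induct)
  case (insert i I)
  thus ?case using loc_bdd_add[OF loc_bdd_mult[OF assms] insert.IH, of "c i" i] by simp
qed (auto simp: loc_bdd_def intro: exI[of _ 0])

lemma loc_bdd_abs: "loc_bdd f \<Longrightarrow> loc_bdd (\<lambda>t. \<bar>f t\<bar>)"
  by (auto simp: loc_bdd_def)

lemma loc_int_abs: "loc_int f \<Longrightarrow> loc_int (\<lambda>t. \<bar>f t\<bar>)"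
proof -
  assume f: "loc_int f"
  have "integrable lborel (\<lambda>t. \<bar>indicator {..T} t * f t\<bar>)" for T
    using f by (auto simp: loc_int_def)
  thus ?thesis using f by (auto simp: loc_int_def abs_mult)
qed

text \<open>Fubini's theorem. The intermediate \<open>conv f g\<close> may diverge at single points,
  but there the default value 0 of the integral appears on both sides of the inner identity.\<close>

lemma conv_assoc:
  assumes f: "loc_int f" and g: "loc_int g" and y: "loc_bdd y"
  shows "conv f (conv g y) t = conv (conv f g) y t"
proof -
  note [measurable] = loc_int_measurable[OF f] loc_int_measurable[OF g] loc_bdd_measurable[OF y]
  let ?F = "\<lambda>s r. f (t - s) * (g (s - r) * y r)"
  have "integrable (lborel \<Otimes>\<^sub>M lborel) (case_prod ?F)"
  proof (rule lborel_pair.Fubini_integrable)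
    show "AE s in lborel. integrable lborel (\<lambda>r. case_prod ?F (s, r))"
      using conv_integrable[OF g y] by (intro AE_I2) simp
    have "(LINT r|lborel. norm (case_prod ?F (s, r))) = \<bar>f (t - s)\<bar> * conv (\<lambda>t. \<bar>g t\<bar>) (\<lambda>t. \<bar>y t\<bar>) s" for s
      by (simp add: conv_def abs_mult)
    thus "integrable lborel (\<lambda>s. LINT r|lborel. norm (case_prod ?F (s, r)))"
      using conv_integrable[OF loc_int_abs[OF f] loc_bdd_conv[OF loc_int_abs[OF g] loc_bdd_abs[OF y]]] by simp
  qed measurable
  hence "(LINT s|lborel. LINT r|lborel. ?F s r) = (LINT r|lborel. LINT s|lborel. ?F s r)"
    by (rule lborel_pair.Fubini_integral[symmetric])
  moreover have "(LINT s|lborel. ?F s r) = conv f g (t - r) * y r" for r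
  proof -
    have "conv f g (t - r) = (LINT s|lborel. f (t - s) * g (s - r))"
      unfolding conv_def
      by (subst lborel_integral_real_affine[where c = 1 and t = "- r"]) (auto simp: algebra_simps)
    moreover have "(LINT s|lborel. ?F s r) = (LINT s|lborel. f (t - s) * g (s - r) * y r)"
      by (simp only: mult.assoc)
    ultimately show ?thesis by simp
  qed
  ultimately show ?thesis by (simp add: conv_def)
qed

lemma conv_sum_right:
  assumes "loc_int f" "\<And>i. i \<in> I \<Longrightarrow> loc_bdd (g i)"
  shows "conv f (\<lambda>s. \<Sum>i\<in>I. c i * g i s) t = (\<Sum>i\<in>I. c i * conv f (g i) t)"
proof -
  have "conv f (\<lambda>s. \<Sum>i\<in>I. c i * g i s) t = (LINT s|lborel. (\<Sum>i\<in>I. c i * (f (t - s) * g i s)))"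
    unfolding conv_def sum_distrib_left by (simp only: mult_ac)
  also have "\<dots> = (\<Sum>i\<in>I. c i * conv f (g i) t)"
    using conv_integrable[OF assms] by (subst Bochner_Integration.integral_sum) (auto simp: conv_def)
  finally show ?thesis .
qed

lemma conv_add_right:
  assumes "loc_int f" "loc_bdd g" "loc_bdd h"
  shows "conv f (\<lambda>s. g s + h s) t = conv f g t + conv f h t"
  using conv_integrable[OF assms(1,2)] conv_integrable[OF assms(1,3)]
  by (simp add: conv_def distrib_left)

lemma conv_mult_right: "conv f (\<lambda>s. c * g s) t = c * conv f g t"
proof -
  have "conv f (\<lambda>s. c * g s) t = (LINT s|lborel. c * (f (t - s) * g s))"
    unfolding conv_def by (simp only: mult_ac)
  thus ?thesis by (simp add: conv_def)
qed

text \<open>\<open>g\<close> may jump at 0, but for a fixed \<open>t\<close> the argument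
  \<open>t - s\<close> meets the jump only at s = t, a null set; dominated convergence along
  sequences does the rest. Hence continuity at every \<open>t\<close>, with 0 included.\<close>

lemma conv_continuous:
  assumes k: "loc_int k" and g: "loc_bdd g" and cont: "continuous_on {0..} g"
  shows "isCont (conv k g) t"
  unfolding continuous_at_sequentially
proof (intro allI impI)
  note [measurable] = loc_int_measurable[OF k] loc_bdd_measurable[OF g]
  fix x :: "nat \<Rightarrow> real" assume x: "x \<longlonglongrightarrow> t"
  have "Bseq x" using x by (intro convergent_imp_Bseq convergentI)
  then obtain T where "\<And>n. \<bar>x n\<bar> \<le> T" by (auto simp: Bseq_def)
  hence T: "\<And>n. x n \<le> T" by (meson abs_le_iff)
  obtain B where B: "B \<ge> 0" "\<And>s. s \<le> T \<Longrightarrow> \<bar>g s\<bar> \<le> B" using loc_bdd_bound[OF g] by blast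
  have "(\<lambda>n. LINT s|lborel. g (x n - s) * k s) \<longlonglongrightarrow> (LINT s|lborel. g (t - s) * k s)"
  proof (rule integral_dominated_convergence)
    show "integrable lborel (\<lambda>s. B * \<bar>indicator {..T} s * k s\<bar>)"
      using k by (auto simp: loc_int_def)
    show "AE s in lborel. (\<lambda>n. g (x n - s) * k s) \<longlonglongrightarrow> g (t - s) * k s"
    proof (rule AE_mp[OF AE_lborel_singleton[of t]], rule AE_I2, rule impI)
      fix s assume s: "s \<noteq> t"
      have lim: "(\<lambda>n. x n - s) \<longlonglongrightarrow> t - s" by (intro tendsto_intros x)
      have "(\<lambda>n. g (x n - s)) \<longlonglongrightarrow> g (t - s)"
      proof (cases "t - s > 0")
        case True
        have "continuous_on {0<..} g" by (rule continuous_on_subset[OF cont]) auto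
        hence "isCont g (t - s)" using True by (simp add: continuous_on_eq_continuous_at)
        thus ?thesis using lim isCont_tendsto_compose by blast
      next
        case False
        hence "t - s < 0" using s by simp
        hence "\<forall>\<^sub>F n in sequentially. x n - s < 0" using lim by (intro order_tendstoD(2)[of _ "t - s"])
        hence "\<forall>\<^sub>F n in sequentially. g (x n - s) = g (t - s)"
          by eventually_elim (use \<open>t - s < 0\<close> loc_bdd_neg[OF g] in auto)
        thus ?thesis by (rule tendsto_eventually)
      qed
      thus "(\<lambda>n. g (x n - s) * k s) \<longlonglongrightarrow> g (t - s) * k s" by (intro tendsto_intros)
    qed
    fix n
    have "\<bar>g (x n - s) * k s\<bar> \<le> B * \<bar>indicator {..T} s * k s\<bar>" for s
    proof (cases "0 \<le> s \<and> s \<le> x n")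
      case True
      thus ?thesis using B(2)[of "x n - s"] T[of n] by (auto simp: abs_mult intro!: mult_right_mono)
    qed (use loc_int_neg[OF k] loc_bdd_neg[OF g] B in \<open>auto simp: not_le\<close>)
    thus "AE s in lborel. norm (g (x n - s) * k s) \<le> B * \<bar>indicator {..T} s * k s\<bar>" by simp
  qed measurable
  thus "((conv k g) \<circ> x) \<longlonglongrightarrow> conv k g t"
    unfolding o_def conv_alt[of k g] .
qed

section \<open>Convolution with the Heaviside function\<close>

lemma loc_bdd_heaviside: "loc_bdd heaviside"
  by (auto simp: loc_bdd_def heaviside_def[abs_def] intro!: exI[of _ 1])

lemma continuous_on_heaviside: "continuous_on {0..} heaviside"
  by (rule continuous_on_eq[of _ "\<lambda>_. 1"]) (auto simp: heaviside_def)

lemma conv_heaviside: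
  assumes f: "loc_int f"
  shows "conv heaviside f t = integral {0..t} f"
proof -
  have e: "heaviside (t - s) * f s = indicator {0..t} s * f s" for s
    using loc_int_neg[OF f, of s] by (auto simp: heaviside_def indicator_def not_le)
  have "integrable lborel (\<lambda>s. heaviside (t - s) * f s)"
    using conv_integrable[OF f loc_bdd_heaviside, of t]
      lborel_integrable_real_affine[of "\<lambda>s. f (t - s) * heaviside s" "-1" t] by (simp add: mult.commute)
  hence "set_integrable lborel {0..t} f" unfolding e set_integrable_def by simp
  from set_borel_integral_eq_integral[OF this]
  show "conv heaviside f t = integral {0..t} f"
    by (simp add: conv_def e set_lebesgue_integral_def)
qed

lemma conv_heaviside_cancel:
  assumes f: "loc_bdd f" "continuous_on {0..} f" and g: "loc_bdd g" "continuous_on {0..} g"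
    and eq: "\<And>t. t \<ge> 0 \<Longrightarrow> conv heaviside f t = conv heaviside g t" and t: "t \<ge> 0"
  shows "f t = g t"
proof -
  have int: "integral {0..u} f = integral {0..u} g" if "u \<ge> 0" for u
    using eq[OF that] conv_heaviside f(1) g(1) loc_bdd_imp_loc_int by simp
  \<comment> \<open>The derivative is taken within \<open>{0..t + 1}\<close>, which has
    \<open>t\<close> as a limit point even for t = 0.\<close>
  have "((\<lambda>u. integral {0..u} f) has_vector_derivative f t) (at t within {0..t + 1})"
    using t by (intro integral_has_vector_derivative continuous_on_subset[OF f(2)]) auto
  moreover have "((\<lambda>u. integral {0..u} g) has_vector_derivative g t) (at t within {0..t + 1})"
    using t by (intro integral_has_vector_derivative continuous_on_subset[OF g(2)]) auto
  hence "((\<lambda>u. integral {0..u} f) has_vector_derivative g t) (at t within {0..t + 1})"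
    by (rule has_vector_derivative_transform[rotated 2]) (use t int in auto)
  ultimately show ?thesis
    using t by (intro vector_derivative_unique_within[of t "{0..t + 1}"])
      (auto simp: trivial_limit_within islimpt_Icc)
qed

section \<open>Integrals and Laplace transforms of convolutions\<close>

lemma integral_conv:
  fixes f g :: "real \<Rightarrow> real"
  assumes f: "integrable lborel f" and g: "integrable lborel g"
  shows "(LINT t|lborel. conv f g t) = integral\<^sup>L lborel f * integral\<^sup>L lborel g"
    and "integrable lborel (conv f g)"
proof -
  have [measurable]: "f \<in> borel_measurable borel" "g \<in> borel_measurable borel"
    using f g by (auto dest: borel_measurable_integrable)
  let ?F = "\<lambda>s t. f (t - s) * g s"
  have fs: "integrable lborel (\<lambda>t. f (t - s))" for s
    using lborel_integrable_real_affine[OF f, of 1 "-s"] by simp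
  have shift: "(LINT t|lborel. h (t - s)) = integral\<^sup>L lborel h" for h :: "real \<Rightarrow> real" and s
    using lborel_integral_real_affine[of 1 h "-s"] by simp
  have F: "integrable (lborel \<Otimes>\<^sub>M lborel) (case_prod ?F)"
  proof (rule lborel_pair.Fubini_integrable)
    show "AE s in lborel. integrable lborel (\<lambda>t. case_prod ?F (s, t))"
      using fs by (intro AE_I2) simp
    have "(LINT t|lborel. norm (case_prod ?F (s, t))) = (LINT t|lborel. \<bar>f t\<bar>) * \<bar>g s\<bar>" for s
      using shift[of "\<lambda>t. \<bar>f t\<bar>" s] by (simp add: abs_mult)
    thus "integrable lborel (\<lambda>s. LINT t|lborel. norm (case_prod ?F (s, t)))"
      using g by simp
  qed measurable
  have "(LINT t|lborel. conv f g t) = (LINT s|lborel. LINT t|lborel. ?F s t)"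
    unfolding conv_def by (rule lborel_pair.Fubini_integral[OF F])
  thus "(LINT t|lborel. conv f g t) = integral\<^sup>L lborel f * integral\<^sup>L lborel g"
    using shift[of f] by simp
  show "integrable lborel (conv f g)"
    using lborel_pair.integrable_snd[OF F] by (simp add: conv_def[abs_def])
qed

text \<open>exp (- s t) splits into exp (- s (t - r)) exp (- s r), so the weight is absorbed by the
  two factors and \<open>integral_conv\<close> applies.\<close>

lemma Laplace_conv:
  fixes f g :: "real \<Rightarrow> real"
  assumes "integrable lborel (\<lambda>t. exp (- s * t) * f t)" "integrable lborel (\<lambda>t. exp (- s * t) * g t)"
  shows "(LINT t|lborel. exp (- s * t) * conv f g t) =
      (LINT t|lborel. exp (- s * t) * f t) * (LINT t|lborel. exp (- s * t) * g t)"
    and "integrable lborel (\<lambda>t. exp (- s * t) * conv f g t)"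
proof -
  have "(\<lambda>t. exp (- s * t) * conv f g t) = conv (\<lambda>t. exp (- s * t) * f t) (\<lambda>t. exp (- s * t) * g t)"
  proof
    fix t
    have "exp (- s * t) * (f (t - r) * g r) = exp (- s * (t - r)) * f (t - r) * (exp (- s * r) * g r)" for r
    proof -
      have "exp (- s * t) = exp (- s * (t - r)) * exp (- s * r)"
        by (simp add: exp_add[symmetric] algebra_simps)
      thus ?thesis by simp
    qed
    note e = this
    have "exp (- s * t) * conv f g t = (LINT r|lborel. exp (- s * t) * (f (t - r) * g r))"
      by (simp add: conv_def)
    also have "\<dots> = conv (\<lambda>t. exp (- s * t) * f t) (\<lambda>t. exp (- s * t) * g t) t"
      unfolding conv_def by (intro Bochner_Integration.integral_cong refl e)
    finally show "exp (- s * t) * conv f g t = conv (\<lambda>t. exp (- s * t) * f t) (\<lambda>t. exp (- s * t) * g t) t" .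
  qed
  thus "(LINT t|lborel. exp (- s * t) * conv f g t) =
      (LINT t|lborel. exp (- s * t) * f t) * (LINT t|lborel. exp (- s * t) * g t)"
    and "integrable lborel (\<lambda>t. exp (- s * t) * conv f g t)"
    using integral_conv[OF assms] by simp_all
qed

section \<open>Caputo derivatives and the resolvent\<close>

text \<open>The kernel of the Riemann-Liouville integral, made causal. Its value 0 at 0 agrees with
  \<open>0 powr _ = 0\<close> in the integrand of \<open>RL_integral\<close>.\<close>

definition frac_kernel :: "real \<Rightarrow> real \<Rightarrow> real" where
  "frac_kernel \<kappa> t = (if t > 0 then t powr (\<kappa> - 1) / Gamma \<kappa> else 0)"

lemma frac_kernel_measurable[measurable]: "frac_kernel \<kappa> \<in> borel_measurable borel"
  unfolding frac_kernel_def[abs_def] by measurable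

lemma loc_int_frac_kernel:
  assumes "\<kappa> > 0"
  shows "loc_int (frac_kernel \<kappa>)"
  unfolding loc_int_def
proof (intro conjI allI)
  fix T
  have "integrable lborel (\<lambda>t. (indicator {0..T} t * t powr (\<kappa> - 1)) / Gamma \<kappa>)"
    using integrable_powr_near_0[of "\<kappa> - 1" T] assms by simp
  moreover have "(\<lambda>t. (indicator {0..T} t * t powr (\<kappa> - 1)) / Gamma \<kappa>) = (\<lambda>t. indicator {..T} t * frac_kernel \<kappa> t)"
    by (auto simp: frac_kernel_def indicator_def)
  ultimately show "integrable lborel (\<lambda>t. indicator {..T} t * frac_kernel \<kappa> t)" by simp
qed (auto simp: frac_kernel_def[abs_def])

text \<open>Euler's Gamma integral after the substitution of s t for t.\<close>

lemma Laplace_frac_kernel: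
  assumes k: "\<kappa> > 0" and s: "s > 0"
  shows "integrable lborel (\<lambda>t. exp (- s * t) * frac_kernel \<kappa> t)"
    and "(LINT t|lborel. exp (- s * t) * frac_kernel \<kappa> t) = s powr (- \<kappa>)"
proof -
  have hk: "((\<lambda>t. t powr (\<kappa> - 1) / exp t) has_integral Gamma \<kappa>) {0..}"
    by (rule Gamma_integral_real[OF k])
  hence i: "integrable lborel (\<lambda>t. indicator {0..} t * (t powr (\<kappa> - 1) / exp t))"
    by (intro integrable_lborel_of_nonneg) auto
  hence "(LINT t:{0..}|lborel. t powr (\<kappa> - 1) / exp t) = Gamma \<kappa>"
    using set_borel_integral_eq_integral(2)[of "{0..}" "\<lambda>t. t powr (\<kappa> - 1) / exp t"] hk
    by (simp add: set_integrable_def integral_unique)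
  hence v: "(LINT t|lborel. indicator {0..} t * (t powr (\<kappa> - 1) / exp t)) = Gamma \<kappa>"
    by (simp add: set_lebesgue_integral_def)
  have e: "exp (- s * t) * frac_kernel \<kappa> t =
      s powr (1 - \<kappa>) / Gamma \<kappa> * (indicator {0..} (0 + s * t) * ((0 + s * t) powr (\<kappa> - 1) / exp (0 + s * t)))" for t
  proof (cases "t > 0")
    case True
    have "s powr (1 - \<kappa>) * s powr (\<kappa> - 1) = 1" using s by (simp add: powr_add[symmetric])
    thus ?thesis using True s
      by (simp add: frac_kernel_def powr_mult exp_minus divide_simps mult_ac)
  next
    case False
    thus ?thesis using s by (cases "t = 0") (auto simp: frac_kernel_def indicator_def zero_le_mult_iff)
  qed
  show "integrable lborel (\<lambda>t. exp (- s * t) * frac_kernel \<kappa> t)"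
    unfolding e using s i by (intro integrable_mult_right lborel_integrable_real_affine) auto
  have "(LINT t|lborel. exp (- s * t) * frac_kernel \<kappa> t) = s powr (1 - \<kappa>) / Gamma \<kappa> *
      (LINT t|lborel. indicator {0..} (0 + s * t) * ((0 + s * t) powr (\<kappa> - 1) / exp (0 + s * t)))"
    unfolding e by (rule integral_mult_right_zero)
  also have "(LINT t|lborel. indicator {0..} (0 + s * t) * ((0 + s * t) powr (\<kappa> - 1) / exp (0 + s * t))) = Gamma \<kappa> / s"
    using lborel_integral_real_affine[of s "\<lambda>t. indicator {0..} t * (t powr (\<kappa> - 1) / exp t)" 0] v s
    by (simp add: field_simps)
  also have "s powr (1 - \<kappa>) / Gamma \<kappa> * (Gamma \<kappa> / s) = s powr (- \<kappa>)"
  proof -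
    have "Gamma \<kappa> \<noteq> 0" using Gamma_real_pos[OF k] by simp
    moreover have "s powr (1 - \<kappa>) = s * s powr (- \<kappa>)" using s powr_add[of s 1 "- \<kappa>"] by simp
    ultimately show ?thesis using s by simp
  qed
  finally show "(LINT t|lborel. exp (- s * t) * frac_kernel \<kappa> t) = s powr (- \<kappa>)" .
qed

lemma RL_integral_eq_conv:
  assumes k: "\<kappa> > 0" and y: "loc_bdd y" and g: "\<And>s. 0 \<le> s \<Longrightarrow> y s = g s"
  shows "RL_integral \<kappa> g t = conv (frac_kernel \<kappa>) y t"
proof -
  have e: "frac_kernel \<kappa> (t - s) * y s = indicator {0..t} s * ((t - s) powr (\<kappa> - 1) * g s / Gamma \<kappa>)" for s
    using g[of s] loc_bdd_neg[OF y, of s] by (cases "0 \<le> s"; cases "s = t") (auto simp: frac_kernel_def indicator_def)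
  have "set_integrable lborel {0..t} (\<lambda>s. (t - s) powr (\<kappa> - 1) * g s / Gamma \<kappa>)"
    using conv_integrable[OF loc_int_frac_kernel[OF k] y, of t] by (simp add: set_integrable_def e)
  from set_borel_integral_eq_integral(2)[OF this]
  have "conv (frac_kernel \<kappa>) y t = integral {0..t} (\<lambda>s. (t - s) powr (\<kappa> - 1) * g s / Gamma \<kappa>)"
    by (simp add: conv_def e set_lebesgue_integral_def)
  thus ?thesis by (simp add: RL_integral_def)
qed

text \<open>The left-hand side is continuous on \<open>{0..}\<close>, vanishes at 0 and has
  derivative \<open>h\<close> for positive times. The fundamental theorem with derivatives only in
  the interior turns this into an identity free of derivatives, ready to be convolved.\<close>

lemma caputo_integrated:
  assumes a: "0 < a" "a \<le> 1"
    and y: "loc_bdd y" "continuous_on {0..} y" "\<And>s. 0 \<le> s \<Longrightarrow> y s = x s - x 0"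
    and h: "loc_bdd h"
    and D: "\<And>t. t > 0 \<Longrightarrow> has_caputo_derivative a x (h t) t"
  shows "(if a = 1 then y else conv (frac_kernel (1 - a)) y) = conv heaviside h"
proof -
  define u where "u = (if a = 1 then y else conv (frac_kernel (1 - a)) y)"
  have ub: "loc_bdd u" and uc: "continuous_on {0..} u" and u0: "u 0 = 0"
  proof -
    show "loc_bdd u"
      using y a loc_bdd_conv[OF loc_int_frac_kernel y(1)] by (auto simp: u_def)
    have "continuous_on {0..} (conv (frac_kernel (1 - a)) y)" if "a \<noteq> 1"
      using that a by (intro continuous_at_imp_continuous_on ballI conv_continuous loc_int_frac_kernel y) auto
    thus "continuous_on {0..} u" using y by (auto simp: u_def)
    \<comment> \<open>At time 0 the kernel is supported on negative \<open>s\<close>, where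
      \<open>y\<close> vanishes.\<close>
    have "(\<lambda>s. frac_kernel (1 - a) (0 - s) * y s) = (\<lambda>s. 0)"
      using loc_bdd_neg[OF y(1)] by (auto simp: frac_kernel_def)
    hence "conv (frac_kernel (1 - a)) y 0 = 0" by (simp only: conv_def) simp
    thus "u 0 = 0" using y(3)[of 0] by (simp add: u_def)
  qed
  have du: "(u has_real_derivative h t) (at t)" if t: "t > 0" for t
  proof (cases "a = 1")
    case True
    have "(x has_real_derivative h t) (at t)" using D[OF t] True by (simp add: has_caputo_derivative_def)
    hence "((\<lambda>s. x s - x 0) has_real_derivative h t) (at t)" by (auto intro!: derivative_eq_intros)
    moreover have "\<forall>\<^sub>F s in nhds t. s \<in> {0<..}" using t by (intro eventually_nhds_in_open) auto
    hence "\<forall>\<^sub>F s in nhds t. u s = x s - x 0" by eventually_elim (use y True in \<open>auto simp: u_def\<close>)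
    ultimately show ?thesis by (subst DERIV_cong_ev[OF refl _ refl])
  next
    case False
    have "RL_integral (1 - a) (\<lambda>s. x s - x 0) = u"
      using RL_integral_eq_conv[of "1 - a" y "\<lambda>s. x s - x 0"] y a False by (auto simp: u_def)
    thus ?thesis using D[OF t] False by (simp add: has_caputo_derivative_def)
  qed
  have "u t = conv heaviside h t" for t
  proof (cases "t \<ge> 0")
    case True
    have "(h has_integral (u t - u 0)) {0..t}"
      using True du uc
      by (intro fundamental_theorem_of_calculus_interior continuous_on_subset[OF uc])
        (auto simp: has_real_derivative_iff_has_vector_derivative)
    thus ?thesis using u0 conv_heaviside[OF loc_bdd_imp_loc_int[OF h]] by (simp add: integral_unique)
  next
    case False
    thus ?thesis using loc_bdd_neg[OF ub] conv_neg[OF loc_bdd_imp_loc_int[OF loc_bdd_heaviside] loc_bdd_imp_loc_int[OF h]]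
      by simp
  qed
  thus ?thesis unfolding u_def by (rule ext)
qed

text \<open>For \<open>s \<le> t\<close> the factor exp (t - s) is at least 1, so the integral of
  |f| up to \<open>t\<close> is at most exp t times a weighted global one. This supplies the growth
  bound that \<open>Laplace_zero_imp_zero\<close> asks for.\<close>

lemma conv_exp_bound:
  assumes f: "loc_int f" "integrable lborel (\<lambda>t. exp (- 1 * t) * f t)"
    and g: "loc_bdd g" "\<And>t. \<bar>g t\<bar> \<le> B"
  shows "\<exists>M. \<forall>t. \<bar>conv f g t\<bar> \<le> M * exp t"
proof (intro exI allI)
  fix t :: real
  have B: "B \<ge> 0" using g(2)[of 0] by linarith
  have 1: "\<bar>conv f g t\<bar> \<le> B * (LINT s|lborel. \<bar>indicator {..t} s * f s\<bar>)"
    by (rule conv_bound[OF f(1) g(1)]) (use g(2) in auto)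
  have "(LINT s|lborel. \<bar>indicator {..t} s * f s\<bar>) \<le> (LINT s|lborel. exp t * \<bar>exp (- 1 * s) * f s\<bar>)"
  proof (rule integral_mono)
    show "integrable lborel (\<lambda>s. \<bar>indicator {..t} s * f s\<bar>)" using f by (auto simp: loc_int_def)
    show "integrable lborel (\<lambda>s. exp t * \<bar>exp (- 1 * s) * f s\<bar>)" using f(2) by auto
    fix s
    have "1 * \<bar>f s\<bar> \<le> exp (t - s) * \<bar>f s\<bar>" if "s \<le> t" using that by (intro mult_right_mono) auto
    thus "\<bar>indicator {..t} s * f s\<bar> \<le> exp t * \<bar>exp (- 1 * s) * f s\<bar>"
      by (auto simp: indicator_def abs_mult exp_diff exp_minus field_simps)
  qed
  also have "\<dots> = exp t * (LINT s|lborel. \<bar>exp (- 1 * s) * f s\<bar>)" by simp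
  finally have 2: "(LINT s|lborel. \<bar>indicator {..t} s * f s\<bar>) \<le> exp t * (LINT s|lborel. \<bar>exp (- 1 * s) * f s\<bar>)" .
  show "\<bar>conv f g t\<bar> \<le> (B * (LINT s|lborel. \<bar>exp (- 1 * s) * f s\<bar>)) * exp t"
    using order_trans[OF 1 mult_left_mono[OF 2 B]] by (simp add: mult_ac)
qed

lemma abs_heaviside_le: "\<bar>heaviside t\<bar> \<le> 1"
  by (simp add: heaviside_def)

lemma Laplace_heaviside:
  assumes "s > 0"
  shows "integrable lborel (\<lambda>t. exp (- s * t) * heaviside t)"
    and "(LINT t|lborel. exp (- s * t) * heaviside t) = 1 / s"
proof -
  have e: "AE t in lborel. exp (- s * t) * heaviside t = exp (- s * t) * frac_kernel 1 t"
    by (rule AE_mp[OF AE_lborel_singleton[of 0]]) (auto simp: heaviside_def frac_kernel_def)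
  have [measurable]: "heaviside \<in> borel_measurable borel" using loc_bdd_heaviside by (simp add: loc_bdd_def)
  note L = Laplace_frac_kernel[of 1 s]
  show "integrable lborel (\<lambda>t. exp (- s * t) * heaviside t)"
    using L(1) assms by (subst integrable_cong_AE[OF _ _ e]) auto
  show "(LINT t|lborel. exp (- s * t) * heaviside t) = 1 / s"
    using L(2) assms by (subst Bochner_Integration.integral_cong_AE[OF _ _ e]) (auto simp: powr_minus field_simps)
qed

lemma Laplace_integrable:
  fixes K :: "real \<Rightarrow> real"
  assumes "integrable lborel K" "\<And>t. t \<le> 0 \<Longrightarrow> K t = 0" "K \<in> borel_measurable borel" "s > 0"
  shows "integrable lborel (\<lambda>t. exp (- s * t) * K t)"
proof (rule Bochner_Integration.integrable_bound[OF assms(1)])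
  note [measurable] = assms(3)
  show "(\<lambda>t. exp (- s * t) * K t) \<in> borel_measurable lborel" by measurable
  have "\<bar>exp (- s * t) * K t\<bar> \<le> \<bar>K t\<bar>" for t
  proof (cases "t \<le> 0")
    case False
    hence "exp (- s * t) \<le> 1" using assms by simp
    thus ?thesis using mult_right_mono[of "exp (- s * t)" 1 "\<bar>K t\<bar>"] by (simp add: abs_mult)
  qed (simp add: assms)
  thus "AE t in lborel. norm (exp (- s * t) * K t) \<le> norm (K t)" by simp
qed

text \<open>
  For order 1 the kernel \<open>frac_kernel (1 - \<alpha> j)\<close> would be the Dirac measure, hence the case distinctions.
  Everything is integrated once more (\<open>F\<close> instead of \<open>K\<close>) so that only continuous functions are
  compared, and the two extra integrations are cancelled at the end.
\<close>
lemma resolvent_representation: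
  fixes \<alpha> :: "'n::finite \<Rightarrow> real" and A :: "'n \<Rightarrow> 'n \<Rightarrow> real" and K :: "'n \<Rightarrow> 'n \<Rightarrow> real \<Rightarrow> real"
  assumes \<alpha>: "\<And>i. 0 < \<alpha> i" "\<And>i. \<alpha> i \<le> 1"
    and K: "\<And>i j. K i j \<in> borel_measurable borel" "\<And>i j t. t \<le> 0 \<Longrightarrow> K i j t = 0"
      "\<And>i j. integrable lborel (K i j)"
    and Lap: "\<And>i j s. s > 0 \<Longrightarrow> (LINT t|lborel. exp (- s * t) * K i j t) * s powr (\<alpha> j) =
        (\<Sum>l\<in>UNIV. A l j * (LINT t|lborel. exp (- s * t) * K i l t)) + (if i = j then 1 else 0)"
    and y: "\<And>i. loc_bdd (y i)" "\<And>i. continuous_on {0..} (y i)"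
    and p: "\<And>i. loc_bdd (p i)" "\<And>i. continuous_on {0..} (p i)"
    and h: "\<And>i. loc_bdd (h i)" "\<And>i. h i = (\<lambda>t. (\<Sum>j\<in>UNIV. A i j * y j t) + p i t)"
    and J: "\<And>i. (if \<alpha> i = 1 then y i else conv (frac_kernel (1 - \<alpha> i)) (y i)) = conv heaviside (h i)"
    and t: "t \<ge> 0"
  shows "y i t = (\<Sum>j\<in>UNIV. conv (K i j) (p j) t)"
proof -
  let ?H = heaviside
  let ?L = "\<lambda>i j s. LINT t|lborel. exp (- s * t) * K i j t"
  note Hb = loc_bdd_heaviside and Hi = loc_bdd_imp_loc_int[OF loc_bdd_heaviside]
  have Ki: "loc_int (K i j)" for i j using K by (intro loc_int_of_integrable) auto
  define F where "F = (\<lambda>i j. conv ?H (K i j))"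
  have Fb: "loc_bdd (F i j)" for i j unfolding F_def by (rule loc_bdd_conv'[OF Hb Ki])
  note Fi = loc_bdd_imp_loc_int[OF Fb]
  have Fc: "continuous_on {0..} (F i j)" for i j
    unfolding F_def conv_commute[of ?H, abs_def]
    by (intro continuous_at_imp_continuous_on ballI conv_continuous Ki Hb continuous_on_heaviside)
  have Fbound: "\<bar>F i j t\<bar> \<le> (LINT s|lborel. \<bar>K i j s\<bar>)" for i j t
  proof -
    have "\<bar>F i j t\<bar> \<le> 1 * (LINT s|lborel. \<bar>indicator {..t} s * K i j s\<bar>)"
      unfolding F_def conv_commute[of ?H] by (rule conv_bound[OF Ki Hb]) (auto simp: heaviside_def)
    also have "\<dots> \<le> (LINT s|lborel. \<bar>K i j s\<bar>)"
      unfolding mult_1 using K(3) Ki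
      by (intro integral_mono) (auto simp: loc_int_def indicator_def)
    finally show ?thesis .
  qed
  have LF: "integrable lborel (\<lambda>t. exp (- s * t) * F i j t)"
     "(LINT t|lborel. exp (- s * t) * F i j t) = ?L i j s / s" if "s > 0" for s i j
    unfolding F_def using Laplace_conv[OF Laplace_heaviside(1)[OF that] Laplace_integrable[OF K(3,2,1) that]]
      Laplace_heaviside(2)[OF that] by auto
  \<comment> \<open>\<open>F\<close> is integrated to the further order 1 - alpha_j, so that the
    transform of \<open>G\<close> is that of \<open>K\<close> times s^(alpha_j) / s^2. For alpha_j =
    1 the function \<open>F\<close> already has this transform.\<close>
  define G where "G = (\<lambda>i j. if \<alpha> j = 1 then F i j else conv (frac_kernel (1 - \<alpha> j)) (F i j))"
  have gi: "loc_int (frac_kernel (1 - \<alpha> j))" if "\<alpha> j \<noteq> 1" for j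
    using that \<alpha>[of j] by (intro loc_int_frac_kernel) auto
  have Gb: "loc_bdd (G i j)" for i j
    using Fb loc_bdd_conv[OF gi Fb] by (auto simp: G_def)
  have Gc: "continuous_on {0..} (G i j)" for i j
  proof -
    have "continuous_on {0..} (conv (frac_kernel (1 - \<alpha> j)) (F i j))" if "\<alpha> j \<noteq> 1"
      using that by (intro continuous_at_imp_continuous_on ballI conv_continuous gi Fb Fc) auto
    thus ?thesis using Fc by (auto simp: G_def)
  qed
  have Gexp: "\<exists>M. \<forall>t\<ge>0. \<bar>G i j t\<bar> \<le> M * exp t" for i j
  proof (cases "\<alpha> j = 1")
    case True
    have "(LINT s|lborel. \<bar>K i j s\<bar>) * 1 \<le> (LINT s|lborel. \<bar>K i j s\<bar>) * exp t" if "t \<ge> 0" for t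
      using that by (intro mult_left_mono) auto
    thus ?thesis using Fbound[of i j] True
      by (intro exI[of _ "LINT s|lborel. \<bar>K i j s\<bar>"]) (auto simp: G_def intro: order_trans)
  next
    case False
    have "\<exists>M. \<forall>t. \<bar>conv (frac_kernel (1 - \<alpha> j)) (F i j) t\<bar> \<le> M * exp t"
      using False \<alpha>[of j] by (intro conv_exp_bound[OF gi Laplace_frac_kernel(1) Fb Fbound]) auto
    thus ?thesis using False by (auto simp: G_def)
  qed
  have LG: "integrable lborel (\<lambda>t. exp (- s * t) * G i j t)"
     "(LINT t|lborel. exp (- s * t) * G i j t) = ?L i j s * s powr (\<alpha> j) / s ^ 2" if s: "s > 0" for s i j
  proof -
    have *: "integrable lborel (\<lambda>t. exp (- s * t) * G i j t) \<and>
        (LINT t|lborel. exp (- s * t) * G i j t) = ?L i j s * s powr (\<alpha> j) / s ^ 2"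
    proof (cases "\<alpha> j = 1")
      case True
      thus ?thesis using LF[OF s, of i j] s by (simp add: G_def power2_eq_square)
    next
      case False
      have k: "1 - \<alpha> j > 0" using False \<alpha>[of j] by auto
      have "s powr - (1 - \<alpha> j) = s powr \<alpha> j / s"
        using s powr_diff[of s "\<alpha> j" 1] by simp
      thus ?thesis
        using Laplace_conv[OF Laplace_frac_kernel(1)[OF k s] LF(1)[OF s]] LF(2)[OF s] Laplace_frac_kernel(2)[OF k s] False
        by (simp add: G_def power2_eq_square field_simps)
    qed
    show "integrable lborel (\<lambda>t. exp (- s * t) * G i j t)"
     "(LINT t|lborel. exp (- s * t) * G i j t) = ?L i j s * s powr (\<alpha> j) / s ^ 2" using * by auto
  qed
  \<comment> \<open>The right-hand side of \<open>Lap\<close> divided by s^2, in the time domain: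
    each \<open>heaviside\<close> contributes a factor 1 / s. Thus \<open>G = R\<close> is the
    identity H (diag(s^alpha) - A) = I in integrated form.\<close>
  define R where "R = (\<lambda>i j t. (\<Sum>l\<in>UNIV. A l j * conv ?H (F i l) t) + (if i = j then 1 else 0) * conv ?H ?H t)"
  have HF: "loc_bdd (conv ?H (F i l))" and HFc: "continuous_on {0..} (conv ?H (F i l))" for i l
    by (auto intro!: loc_bdd_conv Hi Fb continuous_at_imp_continuous_on conv_continuous Fc)
  have HH: "loc_bdd (conv ?H ?H)" and HHc: "continuous_on {0..} (conv ?H ?H)"
    by (auto intro!: loc_bdd_conv Hi Hb continuous_at_imp_continuous_on conv_continuous continuous_on_heaviside)
  note [measurable] = loc_bdd_measurable[OF HF] loc_bdd_measurable[OF HH] loc_bdd_measurable[OF Gb]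
  have GR: "G i j = R i j" for i j
  proof
    fix t
    have "G i j t - R i j t = 0" if "t \<ge> 0" for t
    proof -
      obtain MG where MG: "\<And>t. t \<ge> 0 \<Longrightarrow> \<bar>G i j t\<bar> \<le> MG * exp t" using Gexp by blast
      have "\<exists>M. \<forall>l t. \<bar>conv ?H (F i l) t\<bar> \<le> M l * exp t"
        using conv_exp_bound[OF Hi Laplace_heaviside(1) Fb Fbound] by (intro choice allI) simp
      then obtain MF where MF: "\<And>l t. \<bar>conv ?H (F i l) t\<bar> \<le> MF l * exp t" by blast
      obtain MH where MH: "\<And>t. \<bar>conv ?H ?H t\<bar> \<le> MH * exp t"
        using conv_exp_bound[OF Hi Laplace_heaviside(1)[OF zero_less_one] Hb, of 1] abs_heaviside_le by blast
      show ?thesis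
      proof (rule Laplace_zero_imp_zero[OF _ _ _ _ _ that])
        show "(\<lambda>t. G i j t - R i j t) \<in> borel_measurable borel" unfolding R_def by measurable
        show "G i j t - R i j t = 0" if "t < 0" for t
          using loc_bdd_neg[OF Gb that] loc_bdd_neg[OF HF that] loc_bdd_neg[OF HH that] by (simp add: R_def)
        show "continuous_on {0..} (\<lambda>t. G i j t - R i j t)"
          unfolding R_def by (intro continuous_intros Gc HFc HHc)
        show "\<bar>G i j t - R i j t\<bar> \<le> (MG + ((\<Sum>l\<in>UNIV. \<bar>A l j\<bar> * MF l) + MH)) * exp t" if "t \<ge> 0" for t
        proof -
          have "\<bar>\<Sum>l\<in>UNIV. A l j * conv ?H (F i l) t\<bar> \<le> (\<Sum>l\<in>UNIV. \<bar>A l j\<bar> * (MF l * exp t))"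
            by (intro order_trans[OF sum_abs] sum_mono) (auto simp: abs_mult intro!: mult_left_mono MF)
          also have "\<dots> = (\<Sum>l\<in>UNIV. \<bar>A l j\<bar> * MF l) * exp t"
            unfolding sum_distrib_right mult.assoc ..
          finally have 1: "\<bar>\<Sum>l\<in>UNIV. A l j * conv ?H (F i l) t\<bar> \<le> (\<Sum>l\<in>UNIV. \<bar>A l j\<bar> * MF l) * exp t" .
          have 2: "\<bar>(if i = j then 1 else 0) * conv ?H ?H t\<bar> \<le> MH * exp t"
            using MH[of t] order_trans[OF abs_ge_zero MH[of t]] by auto
          show ?thesis using 1 2 MG[OF that] unfolding R_def distrib_right by linarith
        qed
        fix s :: real assume "s \<ge> 2"
        hence s: "s > 0" by simp
        note LHF = Laplace_conv[OF Laplace_heaviside(1)[OF s] LF(1)[OF s]]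
        note LHH = Laplace_conv[OF Laplace_heaviside(1)[OF s] Laplace_heaviside(1)[OF s]]
        have e: "exp (- s * t) * R i j t = (\<Sum>l\<in>UNIV. A l j * (exp (- s * t) * conv ?H (F i l) t)) +
            (if i = j then 1 else 0) * (exp (- s * t) * conv ?H ?H t)" for t
          unfolding R_def distrib_left sum_distrib_left by (simp only: mult_ac)
        have iR1: "integrable lborel (\<lambda>t. \<Sum>l\<in>UNIV. A l j * (exp (- s * t) * conv ?H (F i l) t))"
          using LHF(2) by (intro Bochner_Integration.integrable_sum integrable_mult_right) auto
        have iR2: "integrable lborel (\<lambda>t. (if i = j then 1 else 0) * (exp (- s * t) * conv ?H ?H t))"
          using LHH(2) by (intro integrable_mult_right) auto
        have "(LINT t|lborel. exp (- s * t) * R i j t) =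
            (LINT t|lborel. (\<Sum>l\<in>UNIV. A l j * (exp (- s * t) * conv ?H (F i l) t))) +
            (LINT t|lborel. (if i = j then 1 else 0) * (exp (- s * t) * conv ?H ?H t))"
          unfolding e by (rule Bochner_Integration.integral_add[OF iR1 iR2])
        also have "(LINT t|lborel. (\<Sum>l\<in>UNIV. A l j * (exp (- s * t) * conv ?H (F i l) t))) =
            (\<Sum>l\<in>UNIV. A l j * (LINT t|lborel. exp (- s * t) * conv ?H (F i l) t))"
          using LHF(2) by (subst Bochner_Integration.integral_sum) (auto intro!: integrable_mult_right simp only: integral_mult_right_zero)
        also have "\<dots> = (\<Sum>l\<in>UNIV. A l j * ?L i l s) / s ^ 2"
          unfolding LHF(1) Laplace_heaviside(2)[OF s] LF(2)[OF s]
          by (simp add: sum_divide_distrib power2_eq_square)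
        also have "(LINT t|lborel. (if i = j then 1 else 0) * (exp (- s * t) * conv ?H ?H t)) = (if i = j then 1 else 0) / s ^ 2"
          unfolding integral_mult_right_zero LHH(1) Laplace_heaviside(2)[OF s] by (simp add: power2_eq_square)
        finally have LR: "(LINT t|lborel. exp (- s * t) * R i j t) =
            ((\<Sum>l\<in>UNIV. A l j * ?L i l s) + (if i = j then 1 else 0)) / s ^ 2"
          by (simp add: add_divide_distrib)
        have "integrable lborel (\<lambda>t. exp (- s * t) * R i j t)"
          unfolding e by (rule Bochner_Integration.integrable_add[OF iR1 iR2])
        hence "(LINT t|lborel. exp (- s * t) * (G i j t - R i j t)) = ?L i j s * s powr (\<alpha> j) / s ^ 2 -
            ((\<Sum>l\<in>UNIV. A l j * ?L i l s) + (if i = j then 1 else 0)) / s ^ 2"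
          unfolding right_diff_distrib using LG[OF s] LR by simp
        thus "(LINT t|lborel. exp (- s * t) * (G i j t - R i j t)) = 0"
          using Lap[OF s, of i j] by simp
      qed
    qed
    moreover have "G i j t - R i j t = 0" if "t < 0"
      using loc_bdd_neg[OF Gb that] loc_bdd_neg[OF HF that] loc_bdd_neg[OF HH that] by (simp add: R_def)
    ultimately show "G i j t = R i j t" by (cases "t < 0") auto
  qed
  have Fy: "loc_bdd (conv (F i j) (y l))" for i j l by (rule loc_bdd_conv[OF Fi y(1)])
  have Fp: "loc_bdd (conv (F i j) (p l))" for i j l by (rule loc_bdd_conv[OF Fi p(1)])
  \<comment> \<open>The convolution of \<open>G i j\<close> with \<open>y j\<close> is computed in
    two ways. Here the fractional integral moves over to \<open>y j\<close>, where \<open>J\<close>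
    applies; \<open>Gy2\<close> inserts the resolvent identity instead.\<close>
  have Gy1: "conv (G i j) (y j) t = conv ?H (conv (F i j) (h j)) t" for i j t
  proof -
    have "conv (G i j) (y j) t = conv (F i j) (conv ?H (h j)) t"
    proof (cases "\<alpha> j = 1")
      case True
      thus ?thesis using J[of j] by (simp add: G_def)
    next
      case False
      have "conv (G i j) (y j) t = conv (conv (F i j) (frac_kernel (1 - \<alpha> j))) (y j) t"
        using False by (simp add: G_def conv_commute[of "F i j", abs_def])
      also have "\<dots> = conv (F i j) (conv (frac_kernel (1 - \<alpha> j)) (y j)) t"
        by (rule conv_assoc[OF Fi gi[OF False] y(1), symmetric])
      finally show ?thesis using J[of j] False by simp
    qed
    also have "\<dots> = conv (conv (F i j) ?H) (h j) t" by (rule conv_assoc[OF Fi Hi h(1)])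
    also have "conv (F i j) ?H = conv ?H (F i j)" by (rule ext) (rule conv_commute)
    also have "conv (conv ?H (F i j)) (h j) t = conv ?H (conv (F i j) (h j)) t"
      by (rule conv_assoc[OF Hi Fi h(1), symmetric])
    finally show ?thesis .
  qed
  have Gy2: "conv (G i j) (y j) t = (\<Sum>l\<in>UNIV. A l j * conv ?H (conv (F i l) (y j)) t) +
      (if i = j then 1 else 0) * conv ?H (conv ?H (y j)) t" for i j t
  proof -
    have "conv (G i j) (y j) t = conv (y j) (R i j) t" unfolding GR by (rule conv_commute)
    also have "\<dots> = conv (y j) (\<lambda>t. \<Sum>l\<in>UNIV. A l j * conv ?H (F i l) t) t +
        conv (y j) (\<lambda>t. (if i = j then 1 else 0) * conv ?H ?H t) t"
      unfolding R_def
    proof (rule conv_add_right[OF loc_bdd_imp_loc_int[OF y(1)]])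
      show "loc_bdd (\<lambda>t. \<Sum>l\<in>UNIV. A l j * conv ?H (F i l) t)"
        by (intro loc_bdd_sum HF)
      show "loc_bdd (\<lambda>t. (if i = j then 1 else 0) * conv ?H ?H t)"
        by (intro loc_bdd_mult HH)
    qed
    also have "conv (y j) (\<lambda>t. \<Sum>l\<in>UNIV. A l j * conv ?H (F i l) t) t = (\<Sum>l\<in>UNIV. A l j * conv (y j) (conv ?H (F i l)) t)"
      by (rule conv_sum_right[OF loc_bdd_imp_loc_int[OF y(1)] HF])
    also have "conv (y j) (\<lambda>t. (if i = j then 1 else 0) * conv ?H ?H t) t = (if i = j then 1 else 0) * conv (y j) (conv ?H ?H) t"
      by (rule conv_mult_right)
    finally have 1: "conv (G i j) (y j) t = (\<Sum>l\<in>UNIV. A l j * conv (y j) (conv ?H (F i l)) t) +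
        (if i = j then 1 else 0) * conv (y j) (conv ?H ?H) t" .
    have 2: "conv (y j) (conv ?H (F i l)) t = conv ?H (conv (F i l) (y j)) t" for l
      unfolding conv_commute[of "y j"] by (rule conv_assoc[OF Hi Fi y(1), symmetric])
    have 3: "conv (y j) (conv ?H ?H) t = conv ?H (conv ?H (y j)) t"
      unfolding conv_commute[of "y j"] by (rule conv_assoc[OF Hi Hi y(1), symmetric])
    show ?thesis using 1 unfolding 2 3 .
  qed
  have Fh: "conv ?H (conv (F i j) (h j)) t = (\<Sum>l\<in>UNIV. A j l * conv ?H (conv (F i j) (y l)) t) + conv ?H (conv (F i j) (p j)) t" for i j t
  proof -
    have "conv (F i j) (h j) = (\<lambda>t. (\<Sum>l\<in>UNIV. A j l * conv (F i j) (y l) t) + conv (F i j) (p j) t)"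
    proof
      fix t
      have "conv (F i j) (h j) t = conv (F i j) (\<lambda>t. \<Sum>l\<in>UNIV. A j l * y l t) t + conv (F i j) (p j) t"
        unfolding h(2) by (intro conv_add_right Fi p loc_bdd_sum y)
      thus "conv (F i j) (h j) t = (\<Sum>l\<in>UNIV. A j l * conv (F i j) (y l) t) + conv (F i j) (p j) t"
        by (simp add: conv_sum_right[OF Fi y(1)])
    qed
    hence "conv ?H (conv (F i j) (h j)) t = conv ?H (\<lambda>t. \<Sum>l\<in>UNIV. A j l * conv (F i j) (y l) t) t + conv ?H (conv (F i j) (p j)) t"
      by (simp add: conv_add_right[OF Hi loc_bdd_sum[OF Fy] Fp])
    thus ?thesis by (simp add: conv_sum_right[OF Hi Fy])
  qed
  \<comment> \<open>The factor 1 puts the sum into the shape of \<open>loc_bdd_sum\<close> and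
    \<open>conv_sum_right\<close>.\<close>
  define q where "q = (\<lambda>t. \<Sum>j\<in>UNIV. 1 * conv (K i j) (p j) t)"
  have Kp: "loc_bdd (conv (K i j) (p j))" for j by (rule loc_bdd_conv[OF Ki p(1)])
  have Kpc: "continuous_on {0..} (conv (K i j) (p j))" for j
    by (intro continuous_at_imp_continuous_on ballI conv_continuous Ki p)
  have qb: "loc_bdd q" unfolding q_def by (intro loc_bdd_sum Kp)
  have qc: "continuous_on {0..} q" unfolding q_def by (intro continuous_intros Kpc)
  have main: "conv ?H (conv ?H (y i)) t = conv ?H (conv ?H q) t" for t
  proof -
    have "(\<Sum>j\<in>UNIV. conv ?H (conv (F i j) (h j)) t) =
        (\<Sum>j\<in>UNIV. \<Sum>l\<in>UNIV. A l j * conv ?H (conv (F i l) (y j)) t) + conv ?H (conv ?H (y i)) t"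
      unfolding Gy1[symmetric] Gy2 by (simp add: sum.distrib if_distrib[where f = "\<lambda>x. x * _"] cong: if_cong)
    moreover have "(\<Sum>j\<in>UNIV. conv ?H (conv (F i j) (h j)) t) =
        (\<Sum>j\<in>UNIV. \<Sum>l\<in>UNIV. A j l * conv ?H (conv (F i j) (y l)) t) + (\<Sum>j\<in>UNIV. conv ?H (conv (F i j) (p j)) t)"
      unfolding Fh by (simp add: sum.distrib)
    \<comment> \<open>After an exchange of the summation indices the terms with \<open>A\<close>
      coincide in both computations and cancel.\<close>
    moreover have "(\<Sum>j\<in>UNIV. \<Sum>l\<in>UNIV. A j l * conv ?H (conv (F i j) (y l)) t) =
        (\<Sum>j\<in>UNIV. \<Sum>l\<in>UNIV. A l j * conv ?H (conv (F i l) (y j)) t)"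
      by (rule sum.swap)
    ultimately have 1: "conv ?H (conv ?H (y i)) t = (\<Sum>j\<in>UNIV. 1 * conv ?H (conv (F i j) (p j)) t)" by simp
    have 2: "conv (F i j) (p j) = conv ?H (conv (K i j) (p j))" for j
      unfolding F_def by (rule ext) (rule conv_assoc[OF Hi Ki p(1), symmetric])
    note 1[unfolded 2]
    also have "(\<Sum>j\<in>UNIV. 1 * conv ?H (conv ?H (conv (K i j) (p j))) t) =
        conv ?H (\<lambda>t. \<Sum>j\<in>UNIV. 1 * conv ?H (conv (K i j) (p j)) t) t"
      by (rule conv_sum_right[OF Hi loc_bdd_conv[OF Hi Kp], symmetric])
    also have "(\<lambda>t. \<Sum>j\<in>UNIV. 1 * conv ?H (conv (K i j) (p j)) t) = conv ?H q"
      unfolding q_def by (rule ext) (rule conv_sum_right[OF Hi Kp, symmetric])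
    finally show ?thesis .
  qed
  have "conv ?H (y i) t = conv ?H q t" if "t \<ge> 0" for t
    by (rule conv_heaviside_cancel[OF _ _ _ _ main that])
      (auto intro!: loc_bdd_conv Hi y qb continuous_at_imp_continuous_on conv_continuous qc)
  from conv_heaviside_cancel[OF y qb qc this t] show ?thesis by (simp add: q_def)
qed

section \<open>Kernels of the characteristic function\<close>

text \<open>The characteristic function in the coordinate \<open>w = Ln s\<close>.\<close>
definition log_char :: "real \<Rightarrow> real \<Rightarrow> real \<Rightarrow> real \<Rightarrow> real \<Rightarrow> complex \<Rightarrow> complex" where
  "log_char p q a1 a2 d w = exp (of_real (p + q) * w) - of_real a1 * exp (of_real q * w)
     - of_real a2 * exp (of_real p * w) + of_real d"

lemma norm_exp_of_real_mult: "norm (exp (of_real r * w)) = exp (r * Re w)"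
  by (simp add: norm_exp_eq_Re)

lemma continuous_on_log_char: "continuous_on S (log_char p q a1 a2 d)"
  unfolding log_char_def[abs_def] by (intro continuous_intros)

lemma holomorphic_log_char: "log_char p q a1 a2 d holomorphic_on S"
  unfolding log_char_def[abs_def] by (intro holomorphic_intros)

text \<open>Far to the left the constant \<open>d\<close> dominates, far to the right the leading
  power, and compactness covers the middle. As zeros are thus confined to a bounded range of real
  parts, those in a wider closed strip form a compact set; it keeps a positive distance from the
  closed strip of half-width \<open>pi / 2\<close>, which leaves room for \<open>b\<close>.\<close>

lemma log_char_lower_bound:
  assumes p: "0 < p" and q: "0 < q" and d: "d \<noteq> 0"
    and nz: "\<And>w. \<bar>Im w\<bar> \<le> pi / 2 \<Longrightarrow> log_char p q a1 a2 d w \<noteq> 0"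
  obtains b c where "pi / 2 < b" "b \<le> pi" "c > 0"
    "\<And>w. \<bar>Im w\<bar> < b \<Longrightarrow> c * max 1 (exp ((p + q) * Re w)) \<le> norm (log_char p q a1 a2 d w)"
proof -
  let ?Q = "log_char p q a1 a2 d"
  have bot: "((\<lambda>x. exp (k * x)) \<longlongrightarrow> 0) at_bot" and top: "((\<lambda>x. exp (- k * x)) \<longlongrightarrow> 0) at_top" if "k > 0" for k :: real
    using that by real_asymp+
  have "((\<lambda>x. exp ((p + q) * x) + \<bar>a1\<bar> * exp (q * x) + \<bar>a2\<bar> * exp (p * x)) \<longlongrightarrow> 0) at_bot"
    using p q by (intro tendsto_add_zero tendsto_mult_right_zero bot) auto
  hence "\<forall>\<^sub>F x in at_bot. exp ((p + q) * x) + \<bar>a1\<bar> * exp (q * x) + \<bar>a2\<bar> * exp (p * x) < \<bar>d\<bar> / 2"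
    using d by (intro order_tendstoD) auto
  then obtain x0 where x0: "\<And>x. x \<le> x0 \<Longrightarrow> exp ((p + q) * x) + \<bar>a1\<bar> * exp (q * x) + \<bar>a2\<bar> * exp (p * x) < \<bar>d\<bar> / 2"
    by (auto simp: eventually_at_bot_linorder)
  have "((\<lambda>x. \<bar>a1\<bar> * exp (- p * x) + \<bar>a2\<bar> * exp (- q * x) + \<bar>d\<bar> * exp (- (p + q) * x)) \<longlongrightarrow> 0) at_top"
    using p q by (intro tendsto_add_zero tendsto_mult_right_zero top) auto
  hence "\<forall>\<^sub>F x in at_top. \<bar>a1\<bar> * exp (- p * x) + \<bar>a2\<bar> * exp (- q * x) + \<bar>d\<bar> * exp (- (p + q) * x) < 1 / 2"
    by (intro order_tendstoD) auto
  then obtain x1 where x1: "\<And>x. x \<ge> x1 \<Longrightarrow> \<bar>a1\<bar> * exp (- p * x) + \<bar>a2\<bar> * exp (- q * x) + \<bar>d\<bar> * exp (- (p + q) * x) < 1 / 2"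
    by (auto simp: eventually_at_top_linorder)
  \<comment> \<open>Including 0 makes the maximum in the claim equal to 1 left of \<open>l\<close>
    and equal to the exponential right of \<open>u\<close>.\<close>
  define l where "l = min 0 x0"
  define u where "u = max 0 x1"
  have low: "norm (?Q w) \<ge> \<bar>d\<bar> / 2" if "Re w \<le> l" for w
  proof -
    have "norm (of_real d :: complex) \<le> norm (?Q w) + norm (exp (of_real (p + q) * w)) + norm (of_real a1 * exp (of_real q * w))
        + norm (of_real a2 * exp (of_real p * w))"
      unfolding log_char_def by norm
    thus ?thesis using x0[of "Re w"] that unfolding norm_mult norm_exp_of_real_mult l_def by simp
  qed
  have high: "norm (?Q w) \<ge> 1 / 2 * exp ((p + q) * Re w)" if "Re w \<ge> u" for w
  proof -
    let ?x = "Re w"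
    have "norm (exp (of_real (p + q) * w)) \<le> norm (?Q w) + norm (of_real a1 * exp (of_real q * w))
        + norm (of_real a2 * exp (of_real p * w)) + norm (of_real d :: complex)"
      unfolding log_char_def by norm
    hence 1: "exp ((p + q) * ?x) \<le> norm (?Q w) + (\<bar>a1\<bar> * exp (q * ?x) + \<bar>a2\<bar> * exp (p * ?x) + \<bar>d\<bar>)"
      unfolding norm_mult norm_exp_of_real_mult by simp
    have "\<bar>a1\<bar> * exp (q * ?x) + \<bar>a2\<bar> * exp (p * ?x) + \<bar>d\<bar> =
        exp ((p + q) * ?x) * (\<bar>a1\<bar> * exp (- p * ?x) + \<bar>a2\<bar> * exp (- q * ?x) + \<bar>d\<bar> * exp (- (p + q) * ?x))"
    proof -
      have e: "exp ((p + q) * ?x) * exp (- p * ?x) = exp (q * ?x)" "exp ((p + q) * ?x) * exp (- q * ?x) = exp (p * ?x)"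
        "exp ((p + q) * ?x) * exp (- (p + q) * ?x) = 1"
        by (simp_all add: exp_add[symmetric] algebra_simps)
      have "E * (\<bar>a1\<bar> * x1 + \<bar>a2\<bar> * x2 + \<bar>d\<bar> * x3) = \<bar>a1\<bar> * (E * x1) + \<bar>a2\<bar> * (E * x2) + \<bar>d\<bar> * (E * x3)" for E x1 x2 x3
        by algebra
      thus ?thesis by (simp only: e mult_1_right)
    qed
    also have "\<dots> \<le> exp ((p + q) * ?x) * (1 / 2)"
      using x1[of ?x] that by (intro mult_left_mono) (auto simp: u_def)
    finally show ?thesis using 1 by simp
  qed
  \<comment> \<open>Any angle strictly between \<open>pi / 2\<close> and \<open>pi\<close> would do;
    it bounds the box in which zeros are sought.\<close>
  define b0 where "b0 = 3 * pi / 4"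
  define S where "S = cbox (Complex l (- b0)) (Complex u b0)"
  define Z where "Z = S \<inter> ?Q -` {0}"
  have "compact Z" unfolding Z_def S_def
    by (intro compact_Int_closed compact_cbox closed_vimage continuous_on_log_char) auto
  have "\<exists>b1>pi / 2. \<forall>w\<in>Z. b1 \<le> \<bar>Im w\<bar>"
  proof (cases "Z = {}")
    case True
    thus ?thesis by (intro exI[of _ "pi"]) auto
  next
    case False
    have "continuous_on Z (\<lambda>w. \<bar>Im w\<bar>)" by (intro continuous_intros)
    from continuous_attains_inf[OF \<open>compact Z\<close> False this]
    obtain z where "z \<in> Z" "\<forall>w\<in>Z. \<bar>Im z\<bar> \<le> \<bar>Im w\<bar>" by blast
    moreover have "\<bar>Im z\<bar> > pi / 2" using nz[of z] \<open>z \<in> Z\<close> by (force simp: Z_def)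
    ultimately show ?thesis by blast
  qed
  then obtain b1 where b1: "b1 > pi / 2" "\<And>w. w \<in> Z \<Longrightarrow> b1 \<le> \<bar>Im w\<bar>" by blast
  \<comment> \<open>Strictly between \<open>pi / 2\<close> and the smaller of the box height
    \<open>b0\<close> and the lower bound \<open>b1\<close> for \<open>\<bar>Im w\<bar>\<close> at
    the zeros in the box.\<close>
  define b where "b = (pi / 2 + min b0 b1) / 2"
  have b: "pi / 2 < b" "b < b0" "b < b1" "b \<le> pi" using b1 pi_gt_zero by (auto simp: b_def b0_def min_def)
  define S' where "S' = cbox (Complex l (- b)) (Complex u b)"
  have S'S: "S' \<subseteq> S" using b by (auto simp: S_def S'_def cbox_def Basis_complex_def)
  have nzS: "?Q w \<noteq> 0" if "w \<in> S'" for w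
  proof
    assume "?Q w = 0"
    hence "w \<in> Z" using that S'S by (auto simp: Z_def)
    from b1(2)[OF this] show False using that b by (auto simp: S'_def cbox_def Basis_complex_def)
  qed
  have ne: "S' \<noteq> {}"
  proof -
    have "Complex l 0 \<in> S'" using b pi_gt_zero by (auto simp: S'_def cbox_def Basis_complex_def l_def u_def)
    thus ?thesis by blast
  qed
  have "\<exists>z\<in>S'. \<forall>w\<in>S'. norm (?Q z) \<le> norm (?Q w)"
    unfolding S'_def by (intro continuous_attains_inf compact_cbox ne[unfolded S'_def] continuous_on_norm continuous_on_log_char)
  then obtain z where z: "z \<in> S'" "\<And>w. w \<in> S' \<Longrightarrow> norm (?Q z) \<le> norm (?Q w)" by blast
  define c0 where "c0 = norm (?Q z)"
  have c0: "c0 > 0" using nzS[OF z(1)] by (simp add: c0_def)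
  \<comment> \<open>One entry for each regime: left, right and middle. In the middle, the division
    by \<open>exp ((p + q) * u)\<close> compensates for the largest value of the maximum
    there.\<close>
  define c where "c = min (min (\<bar>d\<bar> / 2) (1 / 2)) (c0 / exp ((p + q) * u))"
  have c: "c > 0" using d c0 by (simp add: c_def)
  have "c * max 1 (exp ((p + q) * Re w)) \<le> norm (?Q w)" if w: "\<bar>Im w\<bar> < b" for w
  proof -
    consider "Re w \<le> l" | "Re w \<ge> u" | "l \<le> Re w" "Re w \<le> u" by linarith
    thus ?thesis
    proof cases
      case 1
      hence "max 1 (exp ((p + q) * Re w)) = 1" using p q by (intro max.absorb1) (auto simp: l_def mult_nonneg_nonpos)
      thus ?thesis using low[OF 1] by (simp add: c_def)
    next
      case 2
      hence m: "max 1 (exp ((p + q) * Re w)) = exp ((p + q) * Re w)" using p q by (intro max.absorb2) (auto simp: u_def)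
      have "c * exp ((p + q) * Re w) \<le> 1 / 2 * exp ((p + q) * Re w)"
        by (intro mult_right_mono) (auto simp only: c_def exp_ge_zero intro!: min.coboundedI1 min.cobounded2)
      thus ?thesis unfolding m using high[OF 2] by (rule order_trans)
    next
      case 3
      have "w \<in> S'" using 3 w by (auto simp: S'_def cbox_def Basis_complex_def)
      have "(p + q) * Re w \<le> (p + q) * u" "0 \<le> (p + q) * u" using 3 p q by (auto simp: u_def intro: mult_left_mono)
      hence "max 1 (exp ((p + q) * Re w)) \<le> exp ((p + q) * u)" by simp
      hence "c * max 1 (exp ((p + q) * Re w)) \<le> (c0 / exp ((p + q) * u)) * exp ((p + q) * u)"
        using c c0 by (intro mult_mono) (auto simp: c_def)
      also have "\<dots> = c0" by simp
      also have "\<dots> \<le> norm (?Q w)" unfolding c0_def by (rule z(2)) fact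
      finally show ?thesis .
    qed
  qed
  thus ?thesis using that b c by blast
qed

text \<open>The fraction has the form of an entry of the adjugate of diag(s^alpha) - A over its
  determinant. As \<open>r\<close> is one of the two orders, \<open>p + q\<close> exceeds it by at
  least \<open>min p q\<close>, which gives the decay at infinity; near 0 every nonconstant power
  has exponent at least \<open>min p q\<close>, which gives the rate of approach to
  \<open>n0 / d\<close>.\<close>

lemma rational_kernel_exists:
  assumes p: "0 < p" "p \<le> 1" and q: "0 < q" "q \<le> 1" and d: "d \<noteq> 0"
    and nz: "\<And>w. \<bar>Im w\<bar> \<le> pi / 2 \<Longrightarrow> log_char p q a1 a2 d w \<noteq> 0"
    and r: "r = p \<or> r = q"
  shows "\<exists>K D. K \<in> borel_measurable borel \<and> (\<forall>t\<le>0. K t = 0) \<and>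
    (\<forall>t>0. \<bar>K t\<bar> \<le> D * t powr (- 1 - min p q)) \<and> integrable lborel K \<and>
    (\<forall>s>0. (LINT t|lborel. exp (- s * t) * K t) = (n1 * s powr r + n0) /
        (s powr (p + q) - a1 * s powr q - a2 * s powr p + d)) \<and>
    integral\<^sup>L lborel K = n0 / d"
proof -
  let ?Q = "log_char p q a1 a2 d"
  define nu where "nu = min p q"
  have nu: "0 < nu" "nu \<le> p" "nu \<le> q" "nu \<le> 1" "nu \<le> r" using p q r by (auto simp: nu_def)
  obtain b c where b: "pi / 2 < b" "b \<le> pi" and c: "c > 0"
    and Qge: "\<And>w. \<bar>Im w\<bar> < b \<Longrightarrow> c * max 1 (exp ((p + q) * Re w)) \<le> norm (?Q w)"
    using log_char_lower_bound[OF p(1) q(1) d nz] by metis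
  define N where "N = (\<lambda>w. of_real n1 * exp (of_real r * w) + complex_of_real n0)"
  define h where "h = (\<lambda>w. N w / ?Q w)"
  define h0 where "h0 = n0 / d"
  have Qpos: "norm (?Q w) > 0" if "\<bar>Im w\<bar> < b" for w
  proof -
    have "0 < c * max 1 (exp ((p + q) * Re w))" using c by (simp add: less_max_iff_disj)
    thus ?thesis using Qge[OF that] by linarith
  qed
  define C1 where "C1 = (\<bar>n1\<bar> + \<bar>n0\<bar>) / c"
  have C1: "C1 \<ge> 0" using c by (simp add: C1_def)
  have hbd: "norm (h w) \<le> C1 * (max 1 (exp (r * Re w)) / max 1 (exp ((p + q) * Re w)))" if w: "\<bar>Im w\<bar> < b" for w
  proof -
    let ?m = "max 1 (exp (r * Re w))"
    have "norm (N w) \<le> \<bar>n1\<bar> * exp (r * Re w) + \<bar>n0\<bar>"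
      unfolding N_def by (rule norm_triangle_le) (simp add: norm_mult norm_exp_eq_Re)
    also have "\<dots> \<le> \<bar>n1\<bar> * ?m + \<bar>n0\<bar> * ?m"
      by (intro add_mono mult_left_mono) (auto simp: mult_le_cancel_left1)
    also have "\<dots> = (\<bar>n1\<bar> + \<bar>n0\<bar>) * ?m" by (simp add: distrib_right)
    finally have "norm (h w) \<le> (\<bar>n1\<bar> + \<bar>n0\<bar>) * ?m / (c * max 1 (exp ((p + q) * Re w)))"
      unfolding h_def norm_divide using Qge[OF w] c
      by (intro frac_le) (auto simp: less_max_iff_disj)
    thus ?thesis by (simp add: C1_def)
  qed
  have bd1: "norm (h w) \<le> C1" if w: "\<bar>Im w\<bar> < b" for w
  proof -
    have "max 1 (exp (r * Re w)) \<le> max 1 (exp ((p + q) * Re w))"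
    proof (cases "Re w \<ge> 0")
      case True
      have "r * Re w \<le> (p + q) * Re w" using True p q r by (intro mult_right_mono) auto
      thus ?thesis by (simp add: max.coboundedI2)
    next
      case False
      thus ?thesis using nu by (simp add: mult_nonneg_nonpos max.coboundedI1)
    qed
    hence "max 1 (exp (r * Re w)) / max 1 (exp ((p + q) * Re w)) \<le> 1"
      by (simp add: divide_le_eq_1 less_max_iff_disj)
    from mult_left_mono[OF this C1] show ?thesis using hbd[OF w] by linarith
  qed
  \<comment> \<open>For large arguments the rate \<open>nu\<close> itself is available, but
    \<open>inverse_Laplace_sector\<close> asks for an exponent strictly below 1, and
    \<open>nu\<close> can be 1; hence \<open>nu / 2\<close>.\<close>
  have bd2: "norm (h w) \<le> C1 * exp (- (nu / 2) * Re w)" if w: "\<bar>Im w\<bar> < b" for w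
  proof (cases "Re w \<ge> 0")
    case True
    have "max 1 (exp (r * Re w)) = exp (r * Re w)" "max 1 (exp ((p + q) * Re w)) = exp ((p + q) * Re w)"
      using True p q r by (auto intro!: max.absorb2)
    hence "max 1 (exp (r * Re w)) / max 1 (exp ((p + q) * Re w)) = exp (- (p + q - r) * Re w)"
      by (simp add: exp_diff[symmetric] algebra_simps)
    also have "\<dots> \<le> exp (- (nu / 2) * Re w)"
      using True nu p q r mult_right_mono[of "nu / 2" "p + q - r" "Re w"] by auto
    finally show ?thesis using mult_left_mono[OF _ C1] hbd[OF w] by fastforce
  next
    case False
    hence "1 \<le> exp (- (nu / 2) * Re w)" using nu by (simp add: mult_nonneg_nonpos)
    from mult_left_mono[OF this C1] show ?thesis using bd1[OF w] by linarith
  qed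
  define C3 where "C3 = (\<bar>d * n1\<bar> + \<bar>n0\<bar> * (1 + \<bar>a1\<bar> + \<bar>a2\<bar>)) / (c * \<bar>d\<bar>)"
  have C3: "C3 \<ge> 0" using c by (simp add: C3_def)
  have bd3: "norm (h w - of_real h0) \<le> (C1 + \<bar>h0\<bar> + C3) * exp (nu * Re w)" if w: "\<bar>Im w\<bar> < b" for w
  proof (cases "Re w \<ge> 0")
    case True
    have "norm (h w - of_real h0) \<le> C1 + \<bar>h0\<bar>"
      using norm_triangle_ineq4[of "h w" "of_real h0"] bd1[OF w] by simp
    also have "\<dots> \<le> (C1 + \<bar>h0\<bar> + C3) * 1" using C3 by simp
    also have "\<dots> \<le> (C1 + \<bar>h0\<bar> + C3) * exp (nu * Re w)"
      using True nu C1 C3 by (intro mult_left_mono) auto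
    finally show ?thesis .
  next
    case False
    let ?e = "exp (nu * Re w)"
    have e: "exp (k * Re w) \<le> ?e" if "nu \<le> k" for k
      using that False by (simp add: mult_right_mono_neg)
    have Q0: "?Q w \<noteq> 0" using Qpos[OF w] by auto
    \<comment> \<open>Over the common denominator the constant terms cancel, so every power left in
      the numerator has exponent at least \<open>nu\<close>.\<close>
    let ?n = "of_real (d * n1) * exp (of_real r * w) - of_real n0 * (exp (of_real (p + q) * w) - of_real a1 * exp (of_real q * w)
        - of_real a2 * exp (of_real p * w))"
    have eq: "h w - of_real h0 = ?n / (?Q w * of_real d)"
    proof -
      have "h w - of_real h0 = (N w * of_real d - of_real n0 * ?Q w) / (?Q w * of_real d)"
        using Q0 d by (simp add: h_def h0_def field_simps)
      also have "N w * of_real d - of_real n0 * ?Q w = ?n"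
        by (simp add: N_def log_char_def algebra_simps)
      finally show ?thesis .
    qed
    have "norm ?n \<le> norm (of_real (d * n1) * exp (of_real r * w)) + norm (of_real n0 * (exp (of_real (p + q) * w) - of_real a1 * exp (of_real q * w)
        - of_real a2 * exp (of_real p * w)))"
      by (rule norm_triangle_ineq4)
    also have "norm (of_real (d * n1) * exp (of_real r * w)) = \<bar>d * n1\<bar> * exp (r * Re w)"
      by (simp only: norm_mult norm_exp_of_real_mult norm_of_real)
    also have "\<dots> \<le> \<bar>d * n1\<bar> * ?e" by (intro mult_left_mono e nu) auto
    also have "norm (of_real n0 * (exp (of_real (p + q) * w) - of_real a1 * exp (of_real q * w)
        - of_real a2 * exp (of_real p * w))) \<le> \<bar>n0\<bar> * (?e + \<bar>a1\<bar> * ?e + \<bar>a2\<bar> * ?e)"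
    proof -
      have "norm (exp (of_real (p + q) * w) - of_real a1 * exp (of_real q * w) - of_real a2 * exp (of_real p * w)) \<le>
         norm (exp (of_real (p + q) * w)) + norm (of_real a1 * exp (of_real q * w)) + norm (of_real a2 * exp (of_real p * w))"
        by norm
      also have "\<dots> = exp ((p + q) * Re w) + \<bar>a1\<bar> * exp (q * Re w) + \<bar>a2\<bar> * exp (p * Re w)"
        by (simp only: norm_mult norm_exp_of_real_mult norm_of_real)
      also have "\<dots> \<le> ?e + \<bar>a1\<bar> * ?e + \<bar>a2\<bar> * ?e"
        using p q nu by (intro add_mono mult_left_mono e) auto
      finally show ?thesis unfolding norm_mult norm_of_real by (intro mult_left_mono) auto
    qed
    also have "\<bar>d * n1\<bar> * ?e + \<bar>n0\<bar> * (?e + \<bar>a1\<bar> * ?e + \<bar>a2\<bar> * ?e) = (c * \<bar>d\<bar>) * (C3 * ?e)"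
      using c d by (simp add: C3_def field_simps)
    finally have n: "norm ?n \<le> (c * \<bar>d\<bar>) * (C3 * ?e)" by simp
    have "c * 1 \<le> c * max 1 (exp ((p + q) * Re w))" using c by (intro mult_left_mono) auto
    hence Qc: "c \<le> norm (?Q w)" using Qge[OF w] by linarith
    have "norm (h w - of_real h0) = norm ?n / (norm (?Q w) * \<bar>d\<bar>)"
      unfolding eq by (simp only: norm_divide norm_mult norm_of_real)
    also have "\<dots> \<le> (c * \<bar>d\<bar>) * (C3 * ?e) / (c * \<bar>d\<bar>)"
      using n Qc c d C3 by (intro frac_le mult_right_mono) auto
    also have "\<dots> = C3 * ?e" using c d by simp
    also have "\<dots> \<le> (C1 + \<bar>h0\<bar> + C3) * ?e" using C1 by (intro mult_right_mono) auto
    finally show ?thesis .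
  qed
  let ?C = "C1 + \<bar>h0\<bar> + C3"
  have hol: "h holomorphic_on {w. \<bar>Im w\<bar> < b}"
    unfolding h_def N_def using Qpos by (intro holomorphic_intros holomorphic_log_char) auto
  have C1C: "C1 \<le> ?C" using C3 by simp
  obtain K D where K: "K \<in> borel_measurable borel" "\<And>t. t \<le> 0 \<Longrightarrow> K t = 0"
    "\<And>t. t > 0 \<Longrightarrow> \<bar>K t\<bar> \<le> D * t powr (- 1 - nu)" "integrable lborel K"
    "\<And>s. s > 0 \<Longrightarrow> (LINT t|lborel. exp (- s * t) * K t) = Re (h (of_real (ln s)))"
    "integral\<^sup>L lborel K = h0"
  proof (rule inverse_Laplace_sector[OF hol b, of "nu / 2" nu ?C h0])
    show "norm (h w) \<le> ?C" if "\<bar>Im w\<bar> < b" for w using bd1[OF that] C1C by linarith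
    show "norm (h w) \<le> ?C * exp (- (nu / 2) * Re w)" if "\<bar>Im w\<bar> < b" for w
      by (rule order_trans[OF bd2[OF that] mult_right_mono[OF C1C]]) simp
    show "norm (h w - of_real h0) \<le> ?C * exp (nu * Re w)" if "\<bar>Im w\<bar> < b" for w by (rule bd3[OF that])
    show "h (of_real a) \<in> \<real>" for a
      unfolding h_def N_def log_char_def of_real_mult[symmetric] exp_of_real by simp
  qed (use nu in auto)
  have "Re (h (of_real (ln s))) = (n1 * s powr r + n0) / (s powr (p + q) - a1 * s powr q - a2 * s powr p + d)"
    if "s > 0" for s
  proof -
    have pw: "exp (complex_of_real k * of_real (ln s)) = of_real (s powr k)" for k
      using that by (simp add: powr_def exp_of_real[symmetric])
    have "h (of_real (ln s)) = of_real ((n1 * s powr r + n0) / (s powr (p + q) - a1 * s powr q - a2 * s powr p + d))"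
      unfolding h_def N_def log_char_def pw by simp
    thus ?thesis by (simp only: Re_complex_of_real)
  qed
  thus ?thesis using K unfolding h0_def nu_def by (intro exI[of _ K] exI[of _ D]) auto
qed

section \<open>Decay of the solutions\<close>

lemma loc_bdd_extend:
  assumes "continuous_on {0..} g"
  shows "loc_bdd (\<lambda>t. if 0 \<le> t then g t else 0)" "continuous_on {0..} (\<lambda>t. if 0 \<le> t then g t else 0)"
proof -
  show "continuous_on {0..} (\<lambda>t. if 0 \<le> t then g t else 0)"
    by (rule continuous_on_eq[OF assms]) auto
  show "loc_bdd (\<lambda>t. if 0 \<le> t then g t else 0)"
    unfolding loc_bdd_def
  proof (intro conjI allI)
    have "(\<lambda>t. indicator {0..} t *\<^sub>R g t) \<in> borel_measurable borel"
      using assms by (intro borel_measurable_continuous_on_indicator) auto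
    moreover have "(\<lambda>t. indicator {0..} t *\<^sub>R g t) = (\<lambda>t. if 0 \<le> t then g t else 0)" by auto
    ultimately show "(\<lambda>t. if 0 \<le> t then g t else 0) \<in> borel_measurable borel" by simp
    fix T :: real
    have "bounded (g ` {0..T})"
      by (intro compact_imp_bounded compact_continuous_image continuous_on_subset[OF assms]) auto
    then obtain B where "\<forall>t\<in>{0..T}. \<bar>g t\<bar> \<le> B" by (auto simp: bounded_iff)
    thus "\<exists>B. \<forall>t\<le>T. \<bar>if 0 \<le> t then g t else 0\<bar> \<le> B"
      by (intro exI[of _ "\<bar>B\<bar>"]) (auto intro: order_trans[OF _ abs_ge_self])
  qed auto
qed

lemma conv_bounded:
  assumes K: "loc_int K" "integrable lborel K" and g: "loc_bdd g" "\<And>t. \<bar>g t\<bar> \<le> B"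
  shows "\<bar>conv K g t\<bar> \<le> B * (LINT s|lborel. \<bar>K s\<bar>)"
proof -
  have B: "B \<ge> 0" using g(2)[of 0] by linarith
  have "\<bar>conv K g t\<bar> \<le> B * (LINT s|lborel. \<bar>indicator {..t} s * K s\<bar>)"
    using g(2) by (intro conv_bound[OF K(1) g(1)]) auto
  also have "\<dots> \<le> B * (LINT s|lborel. \<bar>K s\<bar>)"
    using K B by (intro mult_left_mono integral_mono) (auto simp: loc_int_def indicator_def)
  finally show ?thesis .
qed

text \<open>Dominated convergence: for fixed \<open>s\<close> the value \<open>g (t - s)\<close>
  tends to 0, and \<open>g\<close> is globally bounded, being locally bounded and below 1 in modulus
  near infinity.\<close>

lemma conv_tendsto_zero:
  assumes K: "loc_int K" "integrable lborel K" and g: "loc_bdd g" "(g \<longlongrightarrow> 0) at_top"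
  shows "(conv K g \<longlongrightarrow> 0) at_top"
proof -
  note [measurable] = loc_int_measurable[OF K(1)] loc_bdd_measurable[OF g(1)]
  have "\<forall>\<^sub>F t in at_top. \<bar>g t\<bar> < 1" using tendsto_rabs_zero[OF g(2)] by (simp add: order_tendstoD)
  then obtain T where T: "\<And>t. t \<ge> T \<Longrightarrow> \<bar>g t\<bar> < 1" by (auto simp: eventually_at_top_linorder)
  obtain B where B: "B \<ge> 0" "\<And>t. t \<le> T \<Longrightarrow> \<bar>g t\<bar> \<le> B" using loc_bdd_bound[OF g(1)] by blast
  have gB: "\<bar>g t\<bar> \<le> B + 1" for t using T[of t] B(1) B(2)[of t] by (cases "t \<le> T") auto
  have "((\<lambda>t. LINT s|lborel. g (t - s) * K s) \<longlongrightarrow> (LINT s::real|lborel. 0)) at_top"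
  proof (rule integral_dominated_convergence_at_top)
    show "integrable lborel (\<lambda>s. (B + 1) * \<bar>K s\<bar>)" using K by auto
    have "((\<lambda>t. g (t - s) * K s) \<longlongrightarrow> 0 * K s) at_top" for s
    proof (intro tendsto_intros filterlim_compose[OF g(2)])
      show "filterlim (\<lambda>t. t - s) at_top at_top" by real_asymp
    qed
    thus "AE s in lborel. ((\<lambda>t. g (t - s) * K s) \<longlongrightarrow> 0) at_top" by simp
    show "\<forall>\<^sub>F t in at_top. AE s in lborel. norm (g (t - s) * K s) \<le> (B + 1) * \<bar>K s\<bar>"
      using gB by (intro always_eventually allI AE_I2) (auto simp: abs_mult intro!: mult_right_mono)
  qed measurable
  moreover have "conv K g = (\<lambda>t. LINT s|lborel. g (t - s) * K s)"
    by (rule ext) (rule conv_alt)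
  ultimately show ?thesis by simp
qed

text \<open>Split at s = t / 2. Below, the decay of \<open>g (t - s)\<close> is paired with the
  total mass of \<open>K\<close>; above, the decay of \<open>K\<close> is paired with the
  boundedness of \<open>g\<close>. Hence the two bounds on \<open>g\<close> and the smaller of the
  two exponents.\<close>

lemma conv_powr_decay:
  assumes K: "loc_int K" "integrable lborel K" and nu: "nu > 0"
    and KD: "\<And>t. t > 0 \<Longrightarrow> \<bar>K t\<bar> \<le> D * t powr (- 1 - nu)"
    and g: "loc_bdd g" "\<And>t. \<bar>g t\<bar> \<le> B" "\<And>t. t > 0 \<Longrightarrow> \<bar>g t\<bar> \<le> B * t powr (- \<eta>)" and \<eta>: "\<eta> > 0"
  shows "\<exists>C. \<forall>t\<ge>1. \<bar>conv K g t\<bar> \<le> C * t powr (- min nu \<eta>)"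
proof (intro exI allI impI)
  fix t :: real assume t: "t \<ge> 1"
  have B: "B \<ge> 0" using g(2)[of 0] by linarith
  have D: "D \<ge> 0" using KD[of 1] by simp
  let ?I = "LINT s|lborel. \<bar>K s\<bar>"
  note tail = integral_powr_tail[OF nu, of "t / 2"]
  have w: "integrable lborel (\<lambda>s. B * (t / 2) powr (- \<eta>) * \<bar>K s\<bar> + B * D * (indicator {t / 2..} s * s powr (- 1 - nu)))"
    using K tail(1) t by auto
  have "\<bar>conv K g t\<bar> \<le> (LINT s|lborel. B * (t / 2) powr (- \<eta>) * \<bar>K s\<bar> + B * D * (indicator {t / 2..} s * s powr (- 1 - nu)))"
    unfolding conv_alt[of K g] real_norm_def[symmetric]
  proof (rule Bochner_Integration.integral_norm_bound_integral)
    show "integrable lborel (\<lambda>s. g (t - s) * K s)"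
      using lborel_integrable_real_affine[OF conv_integrable[OF K(1) g(1), of t], of "-1" t]
      by (simp add: mult.commute)
    fix s
    show "norm (g (t - s) * K s) \<le> B * (t / 2) powr (- \<eta>) * norm (K s) + B * D * (indicator {t / 2..} s * s powr (- 1 - nu))"
    proof (cases "s < t / 2")
      case True
      have "\<bar>g (t - s)\<bar> \<le> B * (t - s) powr (- \<eta>)" using True t by (intro g(3)) auto
      also have "\<dots> \<le> B * (t / 2) powr (- \<eta>)"
        using True t \<eta> B by (intro mult_left_mono powr_mono2') auto
      finally have "\<bar>g (t - s)\<bar> * \<bar>K s\<bar> \<le> B * (t / 2) powr (- \<eta>) * \<bar>K s\<bar>" by (intro mult_right_mono) auto
      thus ?thesis using True by (simp add: abs_mult)
    next
      case False
      have "\<bar>g (t - s)\<bar> * \<bar>K s\<bar> \<le> B * (D * s powr (- 1 - nu))"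
        using False t g(2) KD[of s] B by (intro mult_mono) auto
      moreover have "0 \<le> B * (t / 2) powr (- \<eta>) * \<bar>K s\<bar>" using B by simp
      ultimately show ?thesis using False by (simp add: abs_mult mult.assoc)
    qed
  qed (use w in simp)
  also have "\<dots> = B * (t / 2) powr (- \<eta>) * ?I + B * D * ((t / 2) powr (- nu) / nu)"
    using K(2) tail t by (subst Bochner_Integration.integral_add) (auto simp: mult.assoc)
  also have "\<dots> = B * 2 powr \<eta> * ?I * t powr (- \<eta>) + B * D * 2 powr nu / nu * t powr (- nu)"
    using t by (simp add: powr_divide powr_minus field_simps)
  also have "\<dots> \<le> B * 2 powr \<eta> * ?I * t powr (- min nu \<eta>) + B * D * 2 powr nu / nu * t powr (- min nu \<eta>)"
    using t B D nu by (intro add_mono mult_left_mono powr_mono) auto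
  finally show "\<bar>conv K g t\<bar> \<le> (B * 2 powr \<eta> * ?I + B * D * 2 powr nu / nu) * t powr (- min nu \<eta>)"
    by (simp add: distrib_right)
qed

text \<open>The difference is minus the integral of \<open>K\<close> over (t, infinity).\<close>

lemma conv_heaviside_tail:
  assumes K: "loc_int K" "integrable lborel K" and nu: "nu > 0"
    and KD: "\<And>t. t > 0 \<Longrightarrow> \<bar>K t\<bar> \<le> D * t powr (- 1 - nu)" and t: "t > 0"
  shows "\<bar>conv K heaviside t - integral\<^sup>L lborel K\<bar> \<le> D / nu * t powr (- nu)"
proof -
  note tail = integral_powr_tail[OF nu t]
  have i: "integrable lborel (\<lambda>s. heaviside (t - s) * K s)"
    using lborel_integrable_real_affine[OF conv_integrable[OF K(1) loc_bdd_heaviside, of t], of "-1" t]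
    by (simp add: mult.commute)
  have "conv K heaviside t - integral\<^sup>L lborel K = (LINT s|lborel. heaviside (t - s) * K s - K s)"
    unfolding conv_alt[of K heaviside] using i K(2) by simp
  also have "\<bar>\<dots>\<bar> \<le> (LINT s|lborel. D * (indicator {t..} s * s powr (- 1 - nu)))"
    unfolding real_norm_def[symmetric]
  proof (rule Bochner_Integration.integral_norm_bound_integral)
    show "norm (heaviside (t - s) * K s - K s) \<le> D * (indicator {t..} s * s powr (- 1 - nu))" for s
      using KD[of s] t order_trans[OF abs_ge_zero KD[of s]] by (auto simp: heaviside_def indicator_def)
  qed (use i K tail in auto)
  also have "\<dots> = D / nu * t powr (- nu)" using tail(2) by simp
  finally show ?thesis .
qed

text \<open>For \<open>\<bar>Im w\<bar> < pi\<close> the principal logarithm inverts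
  \<open>exp\<close>, so principal powers of \<open>exp w\<close> are exponentials of multiples of
  \<open>w\<close>.\<close>

lemma log_char_eq_char_fun:
  assumes "\<bar>Im w\<bar> < pi"
  shows "log_char (\<alpha> $ 1) (\<alpha> $ 2) (A $ 1 $ 1) (A $ 2 $ 2) (det A) w = char_fun \<alpha> A (exp w)"
proof -
  have "Ln (exp w) = w" using assms by (intro Ln_exp) auto
  thus ?thesis by (simp add: log_char_def char_fun_def powr_def)
qed

text \<open>The unknown x - x0 starts at 0 and is driven by f + A x0, so
  \<open>resolvent_representation\<close> applies to it. The total integral of \<open>K\<close> is
  H(0) = - A^-1, hence x0 equals minus that integral applied to A x0; this is what completes the
  convolution with \<open>heaviside\<close> to a decaying tail.\<close>

lemma caputo_solution_representation:
  fixes \<alpha> :: "real^2" and A :: "real^2^2" and f :: "real \<Rightarrow> real^2"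
  assumes \<alpha>: "\<And>i. 0 < \<alpha> $ i \<and> \<alpha> $ i \<le> 1" and f: "continuous_on {0..} f"
    and Q: "\<And>s. char_fun \<alpha> A s = 0 \<Longrightarrow> Re s < 0"
  obtains K :: "2 \<Rightarrow> 2 \<Rightarrow> real \<Rightarrow> real" and D where
    "\<And>i j. loc_int (K i j)" "\<And>i j. integrable lborel (K i j)"
    "\<And>i j t. t > 0 \<Longrightarrow> \<bar>K i j t\<bar> \<le> D i j * t powr (- 1 - min (\<alpha> $ 1) (\<alpha> $ 2))"
    "\<And>x0 x i t. caputo_solution \<alpha> A f x0 x \<Longrightarrow> t \<ge> 0 \<Longrightarrow> x t $ i = (\<Sum>j\<in>UNIV.
       conv (K i j) (\<lambda>s. if 0 \<le> s then f s $ j else 0) t +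
       (A *v x0) $ j * (conv (K i j) heaviside t - integral\<^sup>L lborel (K i j)))"
proof -
  define p where "p = \<alpha> $ 1"
  define q where "q = \<alpha> $ 2"
  define d where "d = det A"
  have p: "0 < p" "p \<le> 1" and q: "0 < q" "q \<le> 1" using \<alpha> by (auto simp: p_def q_def)
  \<comment> \<open>Since \<open>0 powr _ = 0\<close>, the value of \<open>char_fun\<close> at 0 is
    the determinant, and 0 does not lie in the open left half plane.\<close>
  have d: "d \<noteq> 0" using Q[of 0] by (auto simp: char_fun_def d_def)
  have d2: "d = A $ 1 $ 1 * A $ 2 $ 2 - A $ 1 $ 2 * A $ 2 $ 1" by (simp add: d_def det_2)
  have nz: "log_char p q (A $ 1 $ 1) (A $ 2 $ 2) d w \<noteq> 0" if "\<bar>Im w\<bar> \<le> pi / 2" for w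
  proof
    assume "log_char p q (A $ 1 $ 1) (A $ 2 $ 2) d w = 0"
    hence "char_fun \<alpha> A (exp w) = 0" using log_char_eq_char_fun[of w \<alpha> A] that pi_gt_zero
      by (simp add: p_def q_def d_def)
    hence "Re (exp w) < 0" by (rule Q)
    moreover have "cos (Im w) \<ge> 0" using that by (intro cos_ge_zero) auto
    ultimately show False by (simp add: Re_exp mult_less_0_iff not_less)
  qed
  \<comment> \<open>\<open>op i\<close> is the other index. With it,
    \<open>n1 i j * s powr (\<alpha> $ op i) + n0 i j\<close> is the (i, j) entry of the adjugate of
    diag(s^alpha) - A.\<close>
  define op :: "2 \<Rightarrow> 2" where "op = (\<lambda>i. if i = 1 then 2 else 1)"
  define n0 where "n0 = (\<lambda>i j. if i = j then - (A $ op i $ op i) else A $ i $ j)"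
  define n1 :: "2 \<Rightarrow> 2 \<Rightarrow> real" where "n1 = (\<lambda>i j. if i = j then 1 else 0)"
  define qs where "qs = (\<lambda>s. s powr (p + q) - A $ 1 $ 1 * s powr q - A $ 2 $ 2 * s powr p + d)"
  define P where "P = (\<lambda>i j K D. K \<in> borel_measurable borel \<and> (\<forall>t\<le>0. K t = 0) \<and>
    (\<forall>t>0. \<bar>K t\<bar> \<le> D * t powr (- 1 - min p q)) \<and> integrable lborel K \<and>
    (\<forall>s>0. (LINT t|lborel. exp (- s * t) * K t) = (n1 i j * s powr (\<alpha> $ op i) + n0 i j) / qs s) \<and>
    integral\<^sup>L lborel K = n0 i j / d)"
  have "\<forall>i j. \<exists>K D. P i j K D"
    unfolding P_def qs_def by (intro allI rational_kernel_exists[OF p q d nz]) (auto simp: op_def p_def q_def)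
  then obtain K D where KD: "\<And>i j. P i j (K i j) (D i j)"
    unfolding choice_iff by blast
  have K: "\<And>i j. K i j \<in> borel_measurable borel" "\<And>i j t. t \<le> 0 \<Longrightarrow> K i j t = 0"
    "\<And>i j t. t > 0 \<Longrightarrow> \<bar>K i j t\<bar> \<le> D i j * t powr (- 1 - min p q)" "\<And>i j. integrable lborel (K i j)"
    "\<And>i j s. s > 0 \<Longrightarrow> (LINT t|lborel. exp (- s * t) * K i j t) = (n1 i j * s powr (\<alpha> $ op i) + n0 i j) / qs s"
    "\<And>i j. integral\<^sup>L lborel (K i j) = n0 i j / d"
    using KD unfolding P_def by blast+
  have qsnz: "qs s \<noteq> 0" if "s > 0" for s
  proof -
    have pw: "exp (complex_of_real k * of_real (ln s)) = of_real (s powr k)" for k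
      using that by (simp add: powr_def exp_of_real[symmetric])
    have "log_char p q (A $ 1 $ 1) (A $ 2 $ 2) d (of_real (ln s)) = of_real (qs s)"
      unfolding log_char_def pw qs_def by simp
    thus ?thesis using nz[of "of_real (ln s)"] pi_gt_zero by auto
  qed
  have Lap: "(LINT t|lborel. exp (- s * t) * K i j t) * s powr (\<alpha> $ j) =
      (\<Sum>l\<in>UNIV. A $ l $ j * (LINT t|lborel. exp (- s * t) * K i l t)) + (if i = j then 1 else 0)"
    if s: "s > 0" for i j s
  proof -
    have pq: "s powr (p + q) = s powr p * s powr q" by (simp add: powr_add)
    \<comment> \<open>Adjugate times matrix is determinant times identity, read off entry by
      entry.\<close>
    have "(n1 i j * s powr (\<alpha> $ op i) + n0 i j) * s powr (\<alpha> $ j) =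
        (\<Sum>l\<in>UNIV. A $ l $ j * (n1 i l * s powr (\<alpha> $ op i) + n0 i l)) + (if i = j then qs s else 0)"
      using exhaust_2[of i] exhaust_2[of j]
      by (auto simp: sum_2 n0_def n1_def op_def qs_def d2 pq p_def[symmetric] q_def[symmetric] algebra_simps)
    hence "(n1 i j * s powr (\<alpha> $ op i) + n0 i j) * s powr (\<alpha> $ j) / qs s =
        (\<Sum>l\<in>UNIV. A $ l $ j * (n1 i l * s powr (\<alpha> $ op i) + n0 i l)) / qs s + (if i = j then qs s else 0) / qs s"
      by (simp only: add_divide_distrib)
    thus ?thesis using qsnz[OF s]
      unfolding K(5)[OF s] times_divide_eq_right times_divide_eq_left sum_divide_distrib[symmetric] by simp
  qed
  have Ki: "loc_int (K i j)" for i j using K by (intro loc_int_of_integrable) auto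
  show ?thesis
  proof (rule that[of K D])
    fix x0 :: "real^2" and x i and t :: real
    assume sol: "caputo_solution \<alpha> A f x0 x" and t: "t \<ge> 0"
    have xc: "continuous_on {0..} x" and x0: "x 0 = x0"
      and xD: "\<And>t i. t > 0 \<Longrightarrow> has_caputo_derivative (\<alpha> $ i) (\<lambda>s. x s $ i) ((A *v x t + f t) $ i) t"
      using sol by (auto simp: caputo_solution_def)
    define y where "y = (\<lambda>i t. if 0 \<le> t then x t $ i - x0 $ i else 0)"
    define fc where "fc = (\<lambda>j s. if 0 \<le> s then f s $ j else 0)"
    define pc where "pc = (\<lambda>j s. if 0 \<le> s then (A *v x0) $ j + f s $ j else 0)"
    define hc where "hc = (\<lambda>j s. if 0 \<le> s then (A *v x s + f s) $ j else 0)"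
    have y: "loc_bdd (y i)" "continuous_on {0..} (y i)" for i
      unfolding y_def by (intro loc_bdd_extend continuous_intros xc)+
    have fc: "loc_bdd (fc i)" for i
      unfolding fc_def by (intro loc_bdd_extend continuous_intros f)
    have pc: "loc_bdd (pc i)" "continuous_on {0..} (pc i)" for i
      unfolding pc_def by (intro loc_bdd_extend continuous_intros f)+
    have hc: "loc_bdd (hc i)" for i
      unfolding hc_def matrix_vector_mult_def by (intro loc_bdd_extend) (auto intro!: continuous_intros xc f)
    have hce: "hc i = (\<lambda>t. (\<Sum>j\<in>UNIV. A $ i $ j * y j t) + pc i t)" for i
      by (auto simp: hc_def y_def pc_def matrix_vector_mult_def sum_2 algebra_simps)
    have J: "(if \<alpha> $ i = 1 then y i else conv (frac_kernel (1 - \<alpha> $ i)) (y i)) = conv heaviside (hc i)" for i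
    proof (rule caputo_integrated[OF _ _ y _ hc])
      show "has_caputo_derivative (\<alpha> $ i) (\<lambda>s. x s $ i) (hc i t) t" if "t > 0" for t
        using xD[OF that, of i] that by (simp add: hc_def)
    qed (use \<alpha> x0 in \<open>auto simp: y_def\<close>)
    have yt: "y i t = (\<Sum>j\<in>UNIV. conv (K i j) (pc j) t)"
      using \<alpha> by (intro resolvent_representation[where K = K and \<alpha> = "\<lambda>i. \<alpha> $ i" and A = "\<lambda>i j. A $ i $ j" and h = hc])
        (use K y pc hc hce J Lap t in auto)
    have pt: "conv (K i j) (pc j) t = conv (K i j) (fc j) t + (A *v x0) $ j * conv (K i j) heaviside t" for j
    proof -
      have "pc j = (\<lambda>s. fc j s + (A *v x0) $ j * heaviside s)" by (auto simp: pc_def fc_def heaviside_def)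
      thus ?thesis
        by (simp add: conv_add_right[OF Ki fc loc_bdd_mult[OF loc_bdd_heaviside]] conv_mult_right)
    qed
    have 1: "x t $ i = x0 $ i + (\<Sum>j\<in>UNIV. conv (K i j) (fc j) t + (A *v x0) $ j * conv (K i j) heaviside t)"
      using yt t unfolding pt by (simp add: y_def)
    \<comment> \<open>\<open>n0\<close> is minus the adjugate of \<open>A\<close>, so
      \<open>n0\<close> times \<open>A\<close> is minus \<open>d\<close> times the identity.\<close>
    have "x0 $ i * d + (\<Sum>j\<in>UNIV. (A *v x0) $ j * n0 i j) = 0"
      using exhaust_2[of i] by (auto simp: sum_2 matrix_vector_mult_def n0_def op_def d2 algebra_simps)
    hence "x0 $ i + (\<Sum>j\<in>UNIV. (A *v x0) $ j * integral\<^sup>L lborel (K i j)) = 0"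
      using d by (simp add: K(6) sum_divide_distrib[symmetric] field_simps)
    thus "x t $ i = (\<Sum>j\<in>UNIV. conv (K i j) (\<lambda>s. if 0 \<le> s then f s $ j else 0) t +
       (A *v x0) $ j * (conv (K i j) heaviside t - integral\<^sup>L lborel (K i j)))"
      using 1 unfolding fc_def by (simp add: sum.distrib right_diff_distrib sum_subtractf)
  qed (use K Ki in \<open>auto simp: p_def q_def\<close>)
qed

lemma infnorm_vec_le_sum:
  fixes v :: "real^'n"
  shows "infnorm v \<le> (\<Sum>i\<in>UNIV. \<bar>v $ i\<bar>)"
  using infnorm_le_norm[of v] norm_le_l1_cart[of v] by linarith

theorem theorem5p1:
  fixes \<alpha> :: "real^2" and A :: "real^2^2" and f :: "real \<Rightarrow> real^2"
  assumes "\<And>i. 0 < \<alpha> $ i \<and> \<alpha> $ i \<le> 1"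
    and "continuous_on {0..} f"
    and "\<exists>M>0. \<exists>\<gamma>>0. \<forall>t\<ge>0. infnorm (f t) \<le> M * exp (\<gamma> * t)"
    and "\<And>s. char_fun \<alpha> A s = 0 \<Longrightarrow> Re s < 0"
  shows "(bounded (f ` {0..}) \<longrightarrow>
           (\<forall>x0 x. caputo_solution \<alpha> A f x0 x \<longrightarrow> bounded (x ` {0..})))
       \<and> ((f \<longlongrightarrow> 0) at_top \<longrightarrow>
           (\<forall>x0 x. caputo_solution \<alpha> A f x0 x \<longrightarrow> (x \<longlongrightarrow> 0) at_top))
       \<and> (\<forall>\<eta>>0. (\<lambda>t. infnorm (f t)) \<in> O[at_top](\<lambda>t. t powr (- \<eta>)) \<longrightarrow>
           (\<forall>x0 x. caputo_solution \<alpha> A f x0 x \<longrightarrow>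
             (\<lambda>t. infnorm (x t)) \<in> O[at_top](\<lambda>t. t powr (- min (min (\<alpha> $ 1) (\<alpha> $ 2)) \<eta>))))"
proof -
  define nu where "nu = min (\<alpha> $ 1) (\<alpha> $ 2)"
  have nu: "nu > 0" using assms(1) by (simp add: nu_def)
  obtain K :: "2 \<Rightarrow> 2 \<Rightarrow> real \<Rightarrow> real" and D where
    K: "\<And>i j. loc_int (K i j)" "\<And>i j. integrable lborel (K i j)"
      "\<And>i j t. t > 0 \<Longrightarrow> \<bar>K i j t\<bar> \<le> D i j * t powr (- 1 - nu)"
    and rep0: "\<And>x0 x i t. caputo_solution \<alpha> A f x0 x \<Longrightarrow> t \<ge> 0 \<Longrightarrow> x t $ i = (\<Sum>j\<in>UNIV.
       conv (K i j) (\<lambda>s. if 0 \<le> s then f s $ j else 0) t +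
       (A *v x0) $ j * (conv (K i j) heaviside t - integral\<^sup>L lborel (K i j)))"
    using caputo_solution_representation[OF assms(1,2,4)] unfolding nu_def by blast
  define fc where "fc = (\<lambda>j s. if 0 \<le> s then f s $ j else 0)"
  define T where "T = (\<lambda>i j t. conv (K i j) heaviside t - integral\<^sup>L lborel (K i j))"
  have rep: "x t $ i = (\<Sum>j\<in>UNIV. conv (K i j) (fc j) t + (A *v x0) $ j * T i j t)"
    if "caputo_solution \<alpha> A f x0 x" "t \<ge> 0" for x0 x i t
    using rep0[OF that] by (simp add: fc_def T_def)
  have fcb: "loc_bdd (fc j)" for j
    unfolding fc_def by (intro loc_bdd_extend continuous_intros assms(2))
  have fc_le: "\<bar>fc j t\<bar> \<le> infnorm (f t)" for j t
    using component_le_infnorm_cart[of "f t" j] by (simp add: fc_def infnorm_pos_le)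
  have Tdecay: "\<bar>T i j t\<bar> \<le> D i j / nu * t powr (- nu)" if "t > 0" for i j t
    unfolding T_def by (rule conv_heaviside_tail[OF K(1,2) nu K(3) that])
  \<comment> \<open>One copy of the L1 norm bounds the convolution, the other the total
    integral.\<close>
  have Tbd: "\<bar>T i j t\<bar> \<le> 2 * (LINT s|lborel. \<bar>K i j s\<bar>)" for i j t
    using conv_bounded[OF K(1,2) loc_bdd_heaviside abs_heaviside_le, of i j t]
      integral_abs_bound[of lborel "K i j"] unfolding T_def by linarith
  have bounded_case: "bounded (x ` {0..})" if bf: "bounded (f ` {0..})" and sol: "caputo_solution \<alpha> A f x0 x" for x0 x
  proof -
    obtain B where B: "\<And>t. t \<ge> 0 \<Longrightarrow> norm (f t) \<le> B" using bf by (auto simp: bounded_iff)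
    have "B \<ge> 0" using order_trans[OF norm_ge_zero B[of 0]] by simp
    have fB: "\<bar>fc j t\<bar> \<le> B" for j t
      using B[of t] component_le_norm_cart[of "f t" j] \<open>B \<ge> 0\<close> by (auto simp: fc_def)
    let ?I = "\<lambda>i j. LINT s|lborel. \<bar>K i j s\<bar>"
    have "\<bar>x t $ i\<bar> \<le> (\<Sum>j\<in>UNIV. B * ?I i j + \<bar>(A *v x0) $ j\<bar> * (2 * ?I i j))" if "t \<ge> 0" for t i
      unfolding rep[OF sol that]
      by (intro order_trans[OF sum_abs] sum_mono order_trans[OF abs_triangle_ineq] add_mono
          conv_bounded K fcb fB) (auto simp only: abs_mult intro!: mult_left_mono Tbd)
    hence "norm (x t) \<le> (\<Sum>i\<in>UNIV. \<Sum>j\<in>UNIV. B * ?I i j + \<bar>(A *v x0) $ j\<bar> * (2 * ?I i j))" if "t \<ge> 0" for t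
      using that by (intro order_trans[OF norm_le_l1_cart] sum_mono) auto
    thus ?thesis unfolding bounded_iff by fastforce
  qed
  have limit_case: "(x \<longlongrightarrow> 0) at_top" if lf: "(f \<longlongrightarrow> 0) at_top" and sol: "caputo_solution \<alpha> A f x0 x" for x0 x
  proof (rule vec_tendstoI)
    fix i
    have fc0: "(fc j \<longlongrightarrow> 0) at_top" for j
    proof (rule Lim_null_comparison)
      show "((\<lambda>t. norm (f t)) \<longlongrightarrow> 0) at_top" using lf by (rule tendsto_norm_zero)
      show "\<forall>\<^sub>F t in at_top. norm (fc j t) \<le> norm (f t)"
        using component_le_norm_cart[of "f _" j] by (intro always_eventually) (auto simp: fc_def)
    qed
    have T0: "(T i j \<longlongrightarrow> 0) at_top" for j
    proof (rule Lim_null_comparison)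
      show "\<forall>\<^sub>F t in at_top. norm (T i j t) \<le> D i j / nu * t powr (- nu)"
        using Tdecay by (intro eventually_mono[OF eventually_gt_at_top[of 0]]) auto
      show "((\<lambda>t. D i j / nu * t powr (- nu)) \<longlongrightarrow> 0) at_top"
        using nu by (intro tendsto_mult_right_zero) real_asymp
    qed
    have "((\<lambda>t. \<Sum>j\<in>UNIV. conv (K i j) (fc j) t + (A *v x0) $ j * T i j t) \<longlongrightarrow> 0) at_top"
      by (intro tendsto_null_sum tendsto_add_zero tendsto_mult_right_zero conv_tendsto_zero K fcb fc0 T0)
    moreover have "\<forall>\<^sub>F t in at_top. x t $ i = (\<Sum>j\<in>UNIV. conv (K i j) (fc j) t + (A *v x0) $ j * T i j t)"
      using rep[OF sol] by (intro eventually_mono[OF eventually_ge_at_top[of 0]]) auto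
    ultimately show "((\<lambda>t. x t $ i) \<longlongrightarrow> 0 $ i) at_top"
      by (simp add: tendsto_cong)
  qed
  have decay_case: "(\<lambda>t. infnorm (x t)) \<in> O[at_top](\<lambda>t. t powr (- min nu \<eta>))"
    if \<eta>: "\<eta> > 0" and Of: "(\<lambda>t. infnorm (f t)) \<in> O[at_top](\<lambda>t. t powr (- \<eta>))"
      and sol: "caputo_solution \<alpha> A f x0 x" for \<eta> x0 x
  proof -
    obtain c where "\<forall>\<^sub>F t in at_top. norm (infnorm (f t)) \<le> c * norm (t powr (- \<eta>))"
      using Of by (auto elim!: landau_o.bigE)
    then obtain t0 where t0: "\<And>t. t \<ge> t0 \<Longrightarrow> norm (infnorm (f t)) \<le> c * norm (t powr (- \<eta>))"
      by (auto simp: eventually_at_top_linorder)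
    \<comment> \<open>At least 1, so that \<open>t powr (- \<eta>)\<close> is at most 1 beyond
      \<open>t1\<close> and the decay bound doubles as a uniform bound there.\<close>
    define t1 where "t1 = max 1 t0"
    have dec: "\<bar>fc j t\<bar> \<le> c * t powr (- \<eta>)" if "t \<ge> t1" for j t
      using fc_le[of j t] t0[of t] that by (simp add: t1_def infnorm_pos_le)
    have "\<exists>B. (\<forall>t. \<bar>fc j t\<bar> \<le> B) \<and> (\<forall>t>0. \<bar>fc j t\<bar> \<le> B * t powr (- \<eta>))" for j
    proof -
      obtain M where M: "M \<ge> 0" "\<And>t. t \<le> t1 \<Longrightarrow> \<bar>fc j t\<bar> \<le> M" using loc_bdd_bound[OF fcb] by blast
      have t1: "t1 \<ge> 1" by (simp add: t1_def)
      have p1: "1 \<le> t1 powr \<eta>" using t1 \<eta> by (simp add: ge_one_powr_ge_zero)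
      have M1: "M \<le> M * t1 powr \<eta>" using mult_left_mono[OF p1 M(1)] by simp
      \<comment> \<open>\<open>\<bar>c\<bar>\<close> serves beyond \<open>t1\<close>. Before it,
        \<open>t powr (- \<eta>)\<close> is at least \<open>t1 powr (- \<eta>)\<close>, and
        \<open>M * t1 powr \<eta>\<close> times the latter is \<open>M\<close>.\<close>
      let ?B = "\<bar>c\<bar> + M * t1 powr \<eta>"
      have B0: "?B \<ge> 0" using M by simp
      have cB: "c \<le> ?B" using mult_nonneg_nonneg[OF M(1), of "t1 powr \<eta>"] by simp
      have d2: "\<bar>fc j t\<bar> \<le> ?B * t powr (- \<eta>)" if t: "t > 0" for t
      proof (cases "t \<ge> t1")
        case True
        have "c * t powr (- \<eta>) \<le> ?B * t powr (- \<eta>)" using cB by (intro mult_right_mono) auto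
        thus ?thesis using dec[OF True, of j] by linarith
      next
        case False
        have "t1 powr (- \<eta>) \<le> t powr (- \<eta>)" using False t \<eta> by (intro powr_mono2') auto
        hence "(M * t1 powr \<eta>) * t1 powr (- \<eta>) \<le> ?B * t powr (- \<eta>)"
          using M by (intro mult_mono) auto
        moreover have "(M * t1 powr \<eta>) * t1 powr (- \<eta>) = M" using t1 by (simp add: powr_minus)
        ultimately show ?thesis using M(2)[of t] False by simp
      qed
      have "\<bar>fc j t\<bar> \<le> ?B" for t
      proof (cases "t \<ge> t1")
        case True
        hence "t powr (- \<eta>) \<le> 1" using t1 \<eta> powr_mono[of "- \<eta>" 0 t] by simp
        from mult_left_mono[OF this B0] show ?thesis using d2[of t] True t1 by simp
      next
        case False
        thus ?thesis using M(2)[of t] M1 by simp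
      qed
      thus ?thesis using d2 by blast
    qed
    then obtain B where B: "\<And>j t. \<bar>fc j t\<bar> \<le> B j" "\<And>j t. t > 0 \<Longrightarrow> \<bar>fc j t\<bar> \<le> B j * t powr (- \<eta>)"
      by metis
    have "\<exists>C. \<forall>t\<ge>1. \<bar>conv (K i j) (fc j) t\<bar> \<le> C * t powr (- min nu \<eta>)" for i j
      by (rule conv_powr_decay[OF K(1,2) nu K(3) fcb B \<eta>])
    then obtain C where C: "\<And>i j t. t \<ge> 1 \<Longrightarrow> \<bar>conv (K i j) (fc j) t\<bar> \<le> C i j * t powr (- min nu \<eta>)"
      by metis
    have Tm: "\<bar>T i j t\<bar> \<le> \<bar>D i j / nu\<bar> * t powr (- min nu \<eta>)" if "t \<ge> 1" for i j t
    proof -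
      have "\<bar>T i j t\<bar> \<le> D i j / nu * t powr (- nu)" using that by (intro Tdecay) auto
      also have "\<dots> \<le> \<bar>D i j / nu\<bar> * t powr (- min nu \<eta>)"
        using that by (intro mult_mono powr_mono abs_ge_self) auto
      finally show ?thesis .
    qed
    let ?C = "\<lambda>i j. C i j + \<bar>(A *v x0) $ j\<bar> * \<bar>D i j / nu\<bar>"
    have xi: "\<bar>x t $ i\<bar> \<le> (\<Sum>j\<in>UNIV. ?C i j) * t powr (- min nu \<eta>)" if t: "t \<ge> 1" for t i
    proof -
      have "\<bar>conv (K i j) (fc j) t + (A *v x0) $ j * T i j t\<bar> \<le> ?C i j * t powr (- min nu \<eta>)" for j
        unfolding distrib_right mult.assoc
        by (intro order_trans[OF abs_triangle_ineq] add_mono C t) (auto simp only: abs_mult intro!: mult_left_mono Tm t)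
      moreover have "t \<ge> 0" using t by simp
      ultimately show ?thesis unfolding rep[OF sol \<open>t \<ge> 0\<close>] sum_distrib_right
        by (intro order_trans[OF sum_abs] sum_mono)
    qed
    have "infnorm (x t) \<le> (\<Sum>i\<in>UNIV. \<Sum>j\<in>UNIV. ?C i j) * t powr (- min nu \<eta>)" if "t \<ge> 1" for t
      unfolding sum_distrib_right[of _ UNIV "t powr (- min nu \<eta>)"]
      by (intro order_trans[OF infnorm_vec_le_sum] sum_mono) (use xi[OF that] in \<open>simp add: sum_distrib_right\<close>)
    hence "\<forall>\<^sub>F t in at_top. norm (infnorm (x t)) \<le> (\<Sum>i\<in>UNIV. \<Sum>j\<in>UNIV. ?C i j) * norm (t powr (- min nu \<eta>))"
      by (intro eventually_mono[OF eventually_ge_at_top[of 1]]) (auto simp: infnorm_pos_le)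
    thus ?thesis by (rule bigoI)
  qed
  show ?thesis
    using bounded_case limit_case decay_case unfolding nu_def by blast
qed

end
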